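(* Let $u$ be the solution of the parabolic problem $\partial_t u+\mathcal{L}u=f$ in $\Omega\times(0,T]$, $u(\cdot,0)=u^0$, $u=0$ on $\partial\Omega\times[0,T]$, and let the Green's function bounds (with constants $\kappa_0,\kappa_1,\kappa_1',\gamma$) stated in the context hold. Let $0=t_0<t_1<\dots<t_M=T$ be an arbitrary mesh and let $U^{j-2/3},U^j\in H_0^1(\Omega)$ be the approximations by the discontinuous Galerkin method dG(1): $U^0=u^0$ and, for $j=1,\dots,M$, $$U^{j-2/3}-U^{j-1}+\frac{\tau_j}{12}\left(5\mathcal{L}U^{j-2/3}-\mathcal{L}U^j\right)=\frac{\tau_j}{12}\left(5f^{j-2/3}-f^j\right),$$ $$U^j-U^{j-1}+\frac{\tau_j}{4}\left(3\mathcal{L}U^{j-2/3}+\mathcal{L}U^j\right)=\frac{\tau_j}{4}\left(3f^{j-2/3}+f^j\right).$$ Let $\psi^i:=f^i-\mathcal{L}U^i$ for $i\in\{j-1,j-2/3,j\}$ and $$\chi^j:=\frac{\psi^j-3\psi^{j-2/3}+2\psi^{j-1}}{2\tau_j^2},\qquad j=1,\dots,M.$$ Then $$\|u(T)-U^M\|_{\infty,\Omega}\le\sum_{j=1}^M\mathrm{e}^{-\gamma(T-t_j)}\left(\eta_{\breve f}^j+\eta_\chi^j\right)$$ with $$\eta_{\breve f}^j:=\kappa_0\int_{I_j}\|(f-\breve f)(s)\|_{\infty,\Omega}\,\mathrm{d}s,\qquad \eta_\chi^j:=\Psi_{2,j}\,\|\chi^j\|_{\infty,\Omega},$$ where $\Psi_{2,j}:=\min\{\Phi_{2,j},\Phi_{2,j}^*\}$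 and $$\Phi_{2,j}:=\kappa_1\int_{t_{j-1}}^{t_j}\frac{(t_j-s)^2(s-t_{j-1})}{T-s}\,\mathrm{d}s+\kappa_1'\frac{\tau_j^4}{12},\qquad \Phi_{2,j}^*:=\kappa_0\int_{t_{j-1}}^{t_j}\left|\frac{\mathrm{d}}{\mathrm{d}s}\left[(t_j-s)^2(s-t_{j-1})\right]\right|\mathrm{d}s.$$
   Context: Setting. $\Omega\subset\mathbb{R}^n$ is a spatial domain with Lipschitz boundary, $T>0$, $\mathcal{L}$ is a second-order linear elliptic operator in $\Omega$ with adjoint $\mathcal{L}^*$, $f\colon[0,T]\to L_2(\Omega)$, and $\mathcal{K}w:=\partial_t w+\mathcal{L}w$. For functions $w$ on $\Omega\times[0,T]$ write $w(t):=w(\cdot,t)$. $\|\cdot\|_{p,\Omega}$, $p\in[1,\infty]$, is the norm of $L_p(\Omega)$, and $\langle\cdot,\cdot\rangle$ denotes both the duality pairing on $H^{-1}(\Omega)\times H_0^1(\Omega)$ and the $L_2(\Omega)$ scalar product. Green's function. For fixed $x\in\Omega$, $\mathcal{G}$ solves $\partial_t\mathcal{G}+\mathcal{L}^*\mathcal{G}=0$ in $\Omega\times\mathbb{R}^+$, $\mathcal{G}|_{\partial\Omega}=0$, $\mathcal{G}(0)=\delta_x$ (Dirac distribution at $x$). For all $w\in W^{1,1}([0,T],H_0^1(\Omega))$ and $t\in(0,T]$ one has $w(x,t)=\langle\mathcal{G}(t),w(0)\rangle+\int_0^t\langle\mathcal{G}(t-s),(\mathcal{K}w)(s)\rangle\,\mathrm{d}s$;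 the solution $u$ is assumed regular enough that this representation applies to $u$ minus a continuous function that is piecewise polynomial in time and built from the discrete approximations. Standing assumption. There are non-negative constants $\kappa_0,\kappa_1,\kappa_2,\kappa_1',\kappa_2',\gamma$ such that, with $\kappa_0'=0$, $\|\partial_t^p\mathcal{G}(t)\|_{1,\Omega}\le\left(\frac{\kappa_p}{t^p}+\kappa_p'\right)\mathrm{e}^{-\gamma t}$ for all $x\in\bar\Omega$, $t\in[0,T]$, $p=0,1,2$. Mesh notation. $I_j:=(t_{j-1},t_j)$, $\tau_j:=t_j-t_{j-1}$, $t_{j-2/3}:=t_j-\tfrac23\tau_j$; $f^j:=f(t_j)$, $f^{j-2/3}:=f(t_{j-2/3})$. $\breve f$ is the continuous piecewise quadratic interpolant of $f$ defined, with $\zeta(s):=3(s-1)(s-1/3)$, by $$\breve f(t):=f^j-\frac32\,\frac{t_j-t}{\tau_j}\left(f^j-f^{j-2/3}\right)+\frac{f^j-3f^{j-2/3}+2f^{j-1}}{2}\,\zeta\left(\frac{t-t_{j-1}}{\tau_j}\right),\qquad t\in[t_{j-1},t_j].$$ *)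

theory Defs
  imports
    "HOL-Analysis.Analysis"
    "HOL-Probability.Essential_Supremum"
    "HOL-Computational_Algebra.Polynomial"
begin

text \<open>
  Functions on \<open>\<Omega>\<close> are represented by total functions on the whole space; the values outside
  \<open>\<Omega>\<close> are irrelevant.  Elements of \<open>H\<^sup>-\<^sup>1(\<Omega>)\<close> are functionals on such functions, applied only
  to members of \<open>H\<^sub>0\<^sup>1(\<Omega>)\<close>.
\<close>

type_synonym 'n fld = "real ^ 'n \<Rightarrow> real"
type_synonym 'n functional = "'n fld \<Rightarrow> real"


section \<open>Domains and Lebesgue spaces\<close>

text \<open>
  Near every boundary point the domain is, after a choice of a unit direction \<open>\<nu>\<close>, the region
  above the graph of a Lipschitz function defined on the hyperplane orthogonal to \<open>\<nu>\<close>.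
\<close>

definition lipschitz_boundary :: "(real ^ 'n) set \<Rightarrow> bool" where
  "lipschitz_boundary \<Omega> \<longleftrightarrow>
     (\<forall>z \<in> frontier \<Omega>. \<exists>\<nu> g r C. norm \<nu> = 1 \<and> 0 < r \<and>
        C-lipschitz_on {y. y \<bullet> \<nu> = 0} (g :: 'n fld) \<and>
        \<Omega> \<inter> ball z r = {y \<in> ball z r. g (y - (y \<bullet> \<nu>) *\<^sub>R \<nu>) < y \<bullet> \<nu>})"

definition lipschitz_domain :: "(real ^ 'n) set \<Rightarrow> bool" where
  "lipschitz_domain \<Omega> \<longleftrightarrow> open \<Omega> \<and> connected \<Omega> \<and> \<Omega> \<noteq> {} \<and> lipschitz_boundary \<Omega>"

definition L2 :: "(real ^ 'n) set \<Rightarrow> (real ^ 'n \<Rightarrow> 'b::euclidean_space) set" where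
  "L2 \<Omega> = {u. u \<in> borel_measurable (lebesgue_on \<Omega>) \<and>
              integrable (lebesgue_on \<Omega>) (\<lambda>x. (norm (u x))\<^sup>2)}"

definition ip :: "(real ^ 'n) set \<Rightarrow> 'n fld \<Rightarrow> 'n fld \<Rightarrow> real" where
  "ip \<Omega> u v = (LINT x|lebesgue_on \<Omega>. u x * v x)"

definition L1_norm :: "(real ^ 'n) set \<Rightarrow> 'n fld \<Rightarrow> ennreal" where
  "L1_norm \<Omega> u = (if u \<in> borel_measurable (lebesgue_on \<Omega>)
                  then \<integral>\<^sup>+ x. ennreal \<bar>u x\<bar> \<partial>lebesgue_on \<Omega> else \<infinity>)"

definition Linf_norm :: "(real ^ 'n) set \<Rightarrow> 'n fld \<Rightarrow> ennreal" where
  "Linf_norm \<Omega> u = esssup (lebesgue_on \<Omega>) (\<lambda>x. ennreal \<bar>u x\<bar>)"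

definition ae_eq :: "(real ^ 'n) set \<Rightarrow> 'n fld \<Rightarrow> 'n fld \<Rightarrow> bool" where
  "ae_eq \<Omega> u v \<longleftrightarrow> (AE x in lebesgue_on \<Omega>. u x = v x)"


section \<open>Sobolev spaces\<close>

definition pd :: "'n \<Rightarrow> 'n fld \<Rightarrow> 'n::finite fld" where
  "pd i \<phi> = (\<lambda>x. frechet_derivative \<phi> (at x) (axis i 1))"

primrec Ck :: "nat \<Rightarrow> 'n::finite fld \<Rightarrow> bool" where
  "Ck 0 \<phi> \<longleftrightarrow> continuous_on UNIV \<phi>"
| "Ck (Suc k) \<phi> \<longleftrightarrow> (\<forall>x. \<phi> differentiable (at x)) \<and> (\<forall>i. Ck k (pd i \<phi>))"

definition test_funs :: "(real ^ 'n::finite) set \<Rightarrow> 'n fld set" where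
  "test_funs \<Omega> = {\<phi>. (\<forall>k. Ck k \<phi>) \<and> compact (closure {x. \<phi> x \<noteq> 0}) \<and>
                     closure {x. \<phi> x \<noteq> 0} \<subseteq> \<Omega>}"

definition has_weak_gradient ::
    "(real ^ 'n::finite) set \<Rightarrow> 'n fld \<Rightarrow> (real ^ 'n \<Rightarrow> real ^ 'n) \<Rightarrow> bool" where
  "has_weak_gradient \<Omega> u g \<longleftrightarrow> u \<in> L2 \<Omega> \<and> g \<in> L2 \<Omega> \<and>
     (\<forall>\<phi> \<in> test_funs \<Omega>. \<forall>i. ip \<Omega> u (pd i \<phi>) = - ip \<Omega> (\<lambda>x. g x $ i) \<phi>)"

definition H1 :: "(real ^ 'n::finite) set \<Rightarrow> 'n fld set" where
  "H1 \<Omega> = {u. \<exists>g. has_weak_gradient \<Omega> u g}"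

text \<open>The weak gradient is unique up to null sets; any representative may be chosen.\<close>

definition weak_grad :: "(real ^ 'n::finite) set \<Rightarrow> 'n fld \<Rightarrow> real ^ 'n \<Rightarrow> real ^ 'n" where
  "weak_grad \<Omega> u = (SOME g. has_weak_gradient \<Omega> u g)"

definition H1_norm :: "(real ^ 'n::finite) set \<Rightarrow> 'n fld \<Rightarrow> real" where
  "H1_norm \<Omega> u = sqrt (LINT x|lebesgue_on \<Omega>. (u x)\<^sup>2 + (norm (weak_grad \<Omega> u x))\<^sup>2)"

definition H01 :: "(real ^ 'n::finite) set \<Rightarrow> 'n fld set" where
  "H01 \<Omega> = {u \<in> H1 \<Omega>. \<exists>\<phi>. (\<forall>k. \<phi> k \<in> test_funs \<Omega>) \<and>
                (\<lambda>k::nat. H1_norm \<Omega> (\<lambda>x. u x - \<phi> k x)) \<longlonglongrightarrow> 0}"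

definition H01_norm :: "(real ^ 'n::finite) set \<Rightarrow> 'n fld \<Rightarrow> ennreal" where
  "H01_norm \<Omega> u = (if u \<in> H01 \<Omega> then ennreal (H1_norm \<Omega> u) else \<infinity>)"

definition Hm1 :: "(real ^ 'n::finite) set \<Rightarrow> 'n functional set" where
  "Hm1 \<Omega> = {F. (\<forall>u \<in> H01 \<Omega>. \<forall>v \<in> H01 \<Omega>. \<forall>a b.
                  F (\<lambda>x. a * u x + b * v x) = a * F u + b * F v) \<and>
               (\<exists>C. \<forall>v \<in> H01 \<Omega>. \<bar>F v\<bar> \<le> C * H1_norm \<Omega> v)}"

text \<open>
  The \<open>L\<^sub>\<infinity>\<close> norm of an element of \<open>H\<^sup>-\<^sup>1(\<Omega>)\<close>: the functional is identified with a function
  \<open>h \<in> L\<^sub>\<infinity>(\<Omega>)\<close> if it acts as integration against \<open>h\<close> on \<open>H\<^sub>0\<^sup>1(\<Omega>) \<inter> L\<^sub>1(\<Omega>)\<close> (which contains all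
  test functions, so \<open>h\<close> is unique up to null sets).  If there is no such function, the norm
  is infinite.
\<close>

definition Linf_norm_functional :: "(real ^ 'n::finite) set \<Rightarrow> 'n functional \<Rightarrow> ennreal" where
  "Linf_norm_functional \<Omega> F =
     Inf {Linf_norm \<Omega> h | h. Linf_norm \<Omega> h < \<infinity> \<and>
            (\<forall>v \<in> H01 \<Omega>. integrable (lebesgue_on \<Omega>) v \<longrightarrow> F v = ip \<Omega> h v)}"


section \<open>Elliptic operators\<close>

text \<open>
  \<open>\<L> u = - div (A \<nabla>u + u d) + b \<cdot> \<nabla>u + c u\<close> with bounded measurable coefficients and uniformly
  positive definite \<open>A\<close>, as a map from \<open>H\<^sub>0\<^sup>1(\<Omega>)\<close> to \<open>H\<^sup>-\<^sup>1(\<Omega>)\<close>; \<open>L u v\<close> is the duality pairing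
  of \<open>\<L> u\<close> with \<open>v\<close>.
\<close>

definition elliptic_operator ::
    "(real ^ 'n::finite) set \<Rightarrow> ('n fld \<Rightarrow> 'n functional) \<Rightarrow> bool" where
  "elliptic_operator \<Omega> L \<longleftrightarrow>
     (\<exists>(A :: real ^ 'n \<Rightarrow> real ^ 'n ^ 'n) (b :: real ^ 'n \<Rightarrow> real ^ 'n)
        (d :: real ^ 'n \<Rightarrow> real ^ 'n) (c :: 'n fld) (lam :: real) (C :: real).
        A \<in> borel_measurable (lebesgue_on \<Omega>) \<and> b \<in> borel_measurable (lebesgue_on \<Omega>) \<and>
        d \<in> borel_measurable (lebesgue_on \<Omega>) \<and> c \<in> borel_measurable (lebesgue_on \<Omega>) \<and>
        (AE x in lebesgue_on \<Omega>.
           norm (A x) \<le> C \<and> norm (b x) \<le> C \<and> norm (d x) \<le> C \<and> \<bar>c x\<bar> \<le> C) \<and>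
        0 < lam \<and>
        (AE x in lebesgue_on \<Omega>. \<forall>\<xi>. lam * (norm \<xi>)\<^sup>2 \<le> \<xi> \<bullet> (A x *v \<xi>)) \<and>
        (\<forall>u \<in> H01 \<Omega>. \<forall>v \<in> H01 \<Omega>. L u v =
           (LINT x|lebesgue_on \<Omega>.
              (A x *v weak_grad \<Omega> u x) \<bullet> weak_grad \<Omega> v x + u x * (d x \<bullet> weak_grad \<Omega> v x)
              + (b x \<bullet> weak_grad \<Omega> u x) * v x + c x * u x * v x)))"

definition adjoint_op :: "('n fld \<Rightarrow> 'n functional) \<Rightarrow> 'n fld \<Rightarrow> 'n functional" where
  "adjoint_op L w v = L v w"


section \<open>Time-dependent functions\<close>

text \<open>
  Bochner integral of \<open>g\<close> over \<open>S\<close> with respect to a (possibly infinite) norm \<open>N\<close>: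
  \<open>g\<close> is approximated by simple functions of finite norm, almost everywhere and in the mean,
  and the integrals of these converge to \<open>I\<close>.
\<close>

definition has_bochner_integral_norm ::
    "('n fld \<Rightarrow> ennreal) \<Rightarrow> real set \<Rightarrow> (real \<Rightarrow> 'n fld) \<Rightarrow> 'n fld \<Rightarrow> bool" where
  "has_bochner_integral_norm N S g I \<longleftrightarrow>
     (\<exists>\<sigma> :: nat \<Rightarrow> real \<Rightarrow> 'n fld.
        (\<forall>k. finite (\<sigma> k ` S) \<and> (\<forall>y \<in> \<sigma> k ` S. {s \<in> S. \<sigma> k s = y} \<in> sets lebesgue \<and> N y < \<infinity>)) \<and>
        (AE s in lebesgue_on S. (\<lambda>k. N (\<lambda>x. g s x - \<sigma> k s x)) \<longlonglongrightarrow> 0) \<and>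
        (\<lambda>k. \<integral>\<^sup>+ s. N (\<lambda>x. g s x - \<sigma> k s x) \<partial>lebesgue_on S) \<longlonglongrightarrow> 0 \<and>
        (\<lambda>k. N (\<lambda>x. I x - (\<Sum>y \<in> \<sigma> k ` S. measure lebesgue {s \<in> S. \<sigma> k s = y} * y x)))
          \<longlonglongrightarrow> 0)"

text \<open>\<open>w \<in> W\<^sup>1\<^sup>,\<^sup>1([0,T], H\<^sub>0\<^sup>1(\<Omega>))\<close>, in its absolutely continuous representative, with \<open>\<partial>\<^sub>t w = w'\<close>.\<close>

definition W11_H01 ::
    "(real ^ 'n::finite) set \<Rightarrow> real \<Rightarrow> (real \<Rightarrow> 'n fld) \<Rightarrow> (real \<Rightarrow> 'n fld) \<Rightarrow> bool" where
  "W11_H01 \<Omega> T w w' \<longleftrightarrow>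
     (\<forall>t \<in> {0..T}. w t \<in> H01 \<Omega> \<and>
        has_bochner_integral_norm (H01_norm \<Omega>) {0..t} w' (\<lambda>x. w t x - w 0 x))"

definition has_L1_time_derivative ::
    "(real ^ 'n) set \<Rightarrow> (real \<Rightarrow> 'n fld) \<Rightarrow> 'n fld \<Rightarrow> real \<Rightarrow> bool" where
  "has_L1_time_derivative \<Omega> g g' t \<longleftrightarrow>
     integrable (lebesgue_on \<Omega>) g' \<and>
     ((\<lambda>h. L1_norm \<Omega> (\<lambda>x. (g (t + h) x - g t x) / h - g' x)) \<longlongrightarrow> 0) (at 0)"

definition has_Hm1_time_derivative ::
    "(real ^ 'n::finite) set \<Rightarrow> real \<Rightarrow> (real \<Rightarrow> 'n fld) \<Rightarrow> (real \<Rightarrow> 'n functional) \<Rightarrow> bool" where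
  "has_Hm1_time_derivative \<Omega> T w w' \<longleftrightarrow>
     (AE s in lebesgue_on {0..T}. w' s \<in> Hm1 \<Omega>) \<and>
     (\<forall>v \<in> H01 \<Omega>. \<forall>t \<in> {0..T}.
        integrable (lebesgue_on {0..t}) (\<lambda>s. w' s v) \<and>
        ip \<Omega> (w t) v = ip \<Omega> (w 0) v + (LINT s|lebesgue_on {0..t}. w' s v))"

text \<open>\<open>\<K> w = \<partial>\<^sub>t w + \<L> w\<close>, where \<open>\<partial>\<^sub>t w\<close> is passed as \<open>w'\<close>.\<close>

definition parabolic_op ::
    "('n fld \<Rightarrow> 'n functional) \<Rightarrow> (real \<Rightarrow> 'n fld) \<Rightarrow> (real \<Rightarrow> 'n functional)
     \<Rightarrow> real \<Rightarrow> 'n functional" where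
  "parabolic_op L w w' s v = w' s v + L (w s) v"

definition parabolic_solution ::
    "(real ^ 'n::finite) set \<Rightarrow> ('n fld \<Rightarrow> 'n functional) \<Rightarrow> real \<Rightarrow> (real \<Rightarrow> 'n fld) \<Rightarrow> 'n fld
     \<Rightarrow> (real \<Rightarrow> 'n fld) \<Rightarrow> (real \<Rightarrow> 'n functional) \<Rightarrow> bool" where
  "parabolic_solution \<Omega> L T f u0 u u' \<longleftrightarrow>
     (\<forall>t \<in> {0..T}. u t \<in> H01 \<Omega>) \<and>
     ae_eq \<Omega> (u 0) u0 \<and>
     has_Hm1_time_derivative \<Omega> T u u' \<and>
     (AE s in lebesgue_on {0..T}. \<forall>v \<in> H01 \<Omega>. parabolic_op L u u' s v = ip \<Omega> (f s) v)"


section \<open>The Green's function\<close>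

text \<open>
  \<open>G x t\<close> is the function \<open>\<G>(t)\<close> belonging to the point \<open>x\<close>.  Members of \<open>H\<^sub>0\<^sup>1(\<Omega>)\<close> have point
  values only almost everywhere, hence so is the representation formula.
\<close>

definition green_representation ::
    "(real ^ 'n::finite) set \<Rightarrow> ('n fld \<Rightarrow> 'n functional) \<Rightarrow> real \<Rightarrow> (real ^ 'n \<Rightarrow> real \<Rightarrow> 'n fld)
     \<Rightarrow> (real \<Rightarrow> 'n fld) \<Rightarrow> (real \<Rightarrow> 'n functional) \<Rightarrow> bool" where
  "green_representation \<Omega> L T G w w' \<longleftrightarrow>
     (\<forall>t \<in> {0<..T}. AE x in lebesgue_on \<Omega>.
        integrable (lebesgue_on {0<..<t}) (\<lambda>s. parabolic_op L w w' s (G x (t - s))) \<and>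
        w t x = ip \<Omega> (G x t) (w 0)
          + (LINT s|lebesgue_on {0<..<t}. parabolic_op L w w' s (G x (t - s))))"

definition green_function ::
    "(real ^ 'n::finite) set \<Rightarrow> ('n fld \<Rightarrow> 'n functional) \<Rightarrow> real \<Rightarrow> (real ^ 'n \<Rightarrow> real \<Rightarrow> 'n fld)
     \<Rightarrow> bool" where
  "green_function \<Omega> L T G \<longleftrightarrow>
     (\<forall>x \<in> \<Omega>.
        (\<forall>t > 0. G x t \<in> H01 \<Omega>) \<and>
        (\<forall>t > 0. \<forall>v \<in> H01 \<Omega>.
           ((\<lambda>t. ip \<Omega> (G x t) v) has_real_derivative - adjoint_op L (G x t) v) (at t)) \<and>
        (\<forall>\<phi> \<in> test_funs \<Omega>. ((\<lambda>t. ip \<Omega> (G x t) \<phi>) \<longlongrightarrow> \<phi> x) (at_right 0))) \<and>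
     (\<forall>w w'. W11_H01 \<Omega> T w w' \<longrightarrow>
        green_representation \<Omega> L T G w (\<lambda>s v. ip \<Omega> (w' s) v))"

text \<open>
  At \<open>t = 0\<close> the Green's function is a Dirac distribution and the bounds for \<open>p \<ge> 1\<close> are infinite,
  so the bounds are imposed for positive times only.
\<close>

definition green_bounds ::
    "(real ^ 'n) set \<Rightarrow> real \<Rightarrow> (real ^ 'n \<Rightarrow> real \<Rightarrow> 'n fld) \<Rightarrow> (nat \<Rightarrow> real) \<Rightarrow> (nat \<Rightarrow> real)
     \<Rightarrow> real \<Rightarrow> bool" where
  "green_bounds \<Omega> T G \<kappa> \<kappa>' \<gamma> \<longleftrightarrow>
     (\<forall>x \<in> \<Omega>. \<exists>D :: nat \<Rightarrow> real \<Rightarrow> 'n fld. D 0 = G x \<and>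
        (\<forall>p < 2. \<forall>t \<in> {0<..T}. has_L1_time_derivative \<Omega> (D p) (D (Suc p) t) t) \<and>
        (\<forall>p \<le> 2. \<forall>t \<in> {0<..T}.
           L1_norm \<Omega> (D p t) \<le> ennreal ((\<kappa> p / t ^ p + \<kappa>' p) * exp (- \<gamma> * t))))"


section \<open>The mesh and the dG(1) method\<close>

definition mesh :: "real \<Rightarrow> nat \<Rightarrow> (nat \<Rightarrow> real) \<Rightarrow> bool" where
  "mesh T M t \<longleftrightarrow> t 0 = 0 \<and> t M = T \<and> (\<forall>j < M. t j < t (Suc j))"

definition tau :: "(nat \<Rightarrow> real) \<Rightarrow> nat \<Rightarrow> real" where
  "tau t j = t j - t (j - 1)"

text \<open>The intermediate point \<open>t\<^sub>j\<^sub>-\<^sub>2\<^sub>/\<^sub>3\<close>.\<close>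

definition tmid :: "(nat \<Rightarrow> real) \<Rightarrow> nat \<Rightarrow> real" where
  "tmid t j = t j - 2 / 3 * tau t j"

text \<open>\<open>U j\<close> stands for \<open>U\<^sup>j\<close> and \<open>V j\<close> for \<open>U\<^sup>j\<^sup>-\<^sup>2\<^sup>/\<^sup>3\<close>.  The equations hold in \<open>H\<^sup>-\<^sup>1(\<Omega>)\<close>.\<close>

definition dG1 ::
    "(real ^ 'n::finite) set \<Rightarrow> ('n fld \<Rightarrow> 'n functional) \<Rightarrow> (real \<Rightarrow> 'n fld) \<Rightarrow> 'n fld
     \<Rightarrow> nat \<Rightarrow> (nat \<Rightarrow> real) \<Rightarrow> (nat \<Rightarrow> 'n fld) \<Rightarrow> (nat \<Rightarrow> 'n fld) \<Rightarrow> bool" where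
  "dG1 \<Omega> L f u0 M t U V \<longleftrightarrow>
     (\<forall>j \<le> M. U j \<in> H01 \<Omega>) \<and> (\<forall>j \<in> {1..M}. V j \<in> H01 \<Omega>) \<and>
     ae_eq \<Omega> (U 0) u0 \<and>
     (\<forall>j \<in> {1..M}. \<forall>v \<in> H01 \<Omega>.
        ip \<Omega> (\<lambda>x. V j x - U (j - 1) x) v + tau t j / 12 * (5 * L (V j) v - L (U j) v)
          = tau t j / 12 * (5 * ip \<Omega> (f (tmid t j)) v - ip \<Omega> (f (t j)) v) \<and>
        ip \<Omega> (\<lambda>x. U j x - U (j - 1) x) v + tau t j / 4 * (3 * L (V j) v + L (U j) v)
          = tau t j / 4 * (3 * ip \<Omega> (f (tmid t j)) v + ip \<Omega> (f (t j)) v))"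

definition cont_pw_poly :: "nat \<Rightarrow> (nat \<Rightarrow> real) \<Rightarrow> (real \<Rightarrow> real) \<Rightarrow> bool" where
  "cont_pw_poly M t a \<longleftrightarrow> continuous_on {t 0..t M} a \<and>
     (\<forall>j \<in> {1..M}. \<exists>q :: real poly. \<forall>s \<in> {t (j - 1)..t j}. a s = poly q s)"

definition nodal_comb ::
    "nat \<Rightarrow> (nat \<Rightarrow> 'n fld) \<Rightarrow> (nat \<Rightarrow> 'n fld) \<Rightarrow> (nat \<Rightarrow> real) \<Rightarrow> (nat \<Rightarrow> real) \<Rightarrow> 'n fld" where
  "nodal_comb M U V a b x = (\<Sum>j = 0..M. a j * U j x) + (\<Sum>j = 1..M. b j * V j x)"

text \<open>
  The regularity of the solution: the representation formula applies to \<open>u - w\<close> for every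
  continuous, piecewise polynomial \<open>w(s) = \<Sum> a\<^sub>j(s) U\<^sup>j + \<Sum> b\<^sub>j(s) U\<^sup>j\<^sup>-\<^sup>2\<^sup>/\<^sup>3\<close>.
  (For \<open>u\<close> in \<open>W\<^sup>1\<^sup>,\<^sup>1([0,T], H\<^sub>0\<^sup>1(\<Omega>))\<close> this is the general representation formula.)  The
  derivatives of \<open>a\<^sub>j\<close> and \<open>b\<^sub>j\<close> exist except possibly at the mesh points.
\<close>

definition regular_solution ::
    "(real ^ 'n::finite) set \<Rightarrow> ('n fld \<Rightarrow> 'n functional) \<Rightarrow> real \<Rightarrow> (real ^ 'n \<Rightarrow> real \<Rightarrow> 'n fld)
     \<Rightarrow> nat \<Rightarrow> (nat \<Rightarrow> real) \<Rightarrow> (nat \<Rightarrow> 'n fld) \<Rightarrow> (nat \<Rightarrow> 'n fld)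
     \<Rightarrow> (real \<Rightarrow> 'n fld) \<Rightarrow> (real \<Rightarrow> 'n functional) \<Rightarrow> bool" where
  "regular_solution \<Omega> L T G M t U V u u' \<longleftrightarrow>
     (\<forall>a b :: nat \<Rightarrow> real \<Rightarrow> real.
        (\<forall>j \<le> M. cont_pw_poly M t (a j)) \<and> (\<forall>j \<in> {1..M}. cont_pw_poly M t (b j)) \<longrightarrow>
        green_representation \<Omega> L T G
          (\<lambda>s x. u s x - nodal_comb M U V (\<lambda>j. a j s) (\<lambda>j. b j s) x)
          (\<lambda>s v. u' s v - ip \<Omega> (nodal_comb M U V (\<lambda>j. deriv (a j) s) (\<lambda>j. deriv (b j) s)) v))"


section \<open>The error estimator\<close>

definition zeta :: "real \<Rightarrow> real" where
  "zeta s = 3 * (s - 1) * (s - 1 / 3)"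

text \<open>The restriction to \<open>[t\<^sub>j\<^sub>-\<^sub>1, t\<^sub>j]\<close> of the continuous piecewise quadratic interpolant of \<open>f\<close>.\<close>

definition breve :: "(nat \<Rightarrow> real) \<Rightarrow> (real \<Rightarrow> 'n fld) \<Rightarrow> nat \<Rightarrow> real \<Rightarrow> 'n fld" where
  "breve t f j s x =
     f (t j) x - 3 / 2 * ((t j - s) / tau t j) * (f (t j) x - f (tmid t j) x)
     + (f (t j) x - 3 * f (tmid t j) x + 2 * f (t (j - 1)) x) / 2
       * zeta ((s - t (j - 1)) / tau t j)"

definition residual ::
    "(real ^ 'n) set \<Rightarrow> ('n fld \<Rightarrow> 'n functional) \<Rightarrow> 'n fld \<Rightarrow> 'n fld \<Rightarrow> 'n functional" where
  "residual \<Omega> L g W v = ip \<Omega> g v - L W v"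

definition chi ::
    "(real ^ 'n) set \<Rightarrow> ('n fld \<Rightarrow> 'n functional) \<Rightarrow> (real \<Rightarrow> 'n fld) \<Rightarrow> (nat \<Rightarrow> real)
     \<Rightarrow> (nat \<Rightarrow> 'n fld) \<Rightarrow> (nat \<Rightarrow> 'n fld) \<Rightarrow> nat \<Rightarrow> 'n functional" where
  "chi \<Omega> L f t U V j v =
     (residual \<Omega> L (f (t j)) (U j) v - 3 * residual \<Omega> L (f (tmid t j)) (V j) v
       + 2 * residual \<Omega> L (f (t (j - 1))) (U (j - 1)) v) / (2 * (tau t j)\<^sup>2)"

definition Phi2 :: "real \<Rightarrow> (nat \<Rightarrow> real) \<Rightarrow> real \<Rightarrow> real \<Rightarrow> nat \<Rightarrow> real" where
  "Phi2 T t \<kappa>1 \<kappa>1' j =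
     \<kappa>1 * integral {t (j - 1)..t j} (\<lambda>s. (t j - s)\<^sup>2 * (s - t (j - 1)) / (T - s))
     + \<kappa>1' * ((tau t j) ^ 4 / 12)"

definition Phi2_star :: "(nat \<Rightarrow> real) \<Rightarrow> real \<Rightarrow> nat \<Rightarrow> real" where
  "Phi2_star t \<kappa>0 j =
     \<kappa>0 * integral {t (j - 1)..t j} (\<lambda>s. \<bar>deriv (\<lambda>s. (t j - s)\<^sup>2 * (s - t (j - 1))) s\<bar>)"

definition Psi2 :: "real \<Rightarrow> (nat \<Rightarrow> real) \<Rightarrow> (nat \<Rightarrow> real) \<Rightarrow> (nat \<Rightarrow> real) \<Rightarrow> nat \<Rightarrow> real" where
  "Psi2 T t \<kappa> \<kappa>' j = min (Phi2 T t (\<kappa> 1) (\<kappa>' 1) j) (Phi2_star t (\<kappa> 0) j)"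

definition eta_f ::
    "(real ^ 'n) set \<Rightarrow> (real \<Rightarrow> 'n fld) \<Rightarrow> (nat \<Rightarrow> real) \<Rightarrow> real \<Rightarrow> nat \<Rightarrow> ennreal" where
  "eta_f \<Omega> f t \<kappa>0 j = ennreal \<kappa>0 *
     (\<integral>\<^sup>+ s. Linf_norm \<Omega> (\<lambda>x. f s x - breve t f j s x) \<partial>lebesgue_on {t (j - 1)<..<t j})"

definition eta_chi ::
    "(real ^ 'n::finite) set \<Rightarrow> ('n fld \<Rightarrow> 'n functional) \<Rightarrow> real \<Rightarrow> (real \<Rightarrow> 'n fld)
     \<Rightarrow> (nat \<Rightarrow> real) \<Rightarrow> (nat \<Rightarrow> 'n fld) \<Rightarrow> (nat \<Rightarrow> 'n fld) \<Rightarrow> (nat \<Rightarrow> real) \<Rightarrow> (nat \<Rightarrow> real)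
     \<Rightarrow> nat \<Rightarrow> ennreal" where
  "eta_chi \<Omega> L T f t U V \<kappa> \<kappa>' j =
     ennreal (Psi2 T t \<kappa> \<kappa>' j) * Linf_norm_functional \<Omega> (chi \<Omega> L f t U V j)"

end

theory Submission
  imports Defs
begin

text \<open>
  Interpolate the discrete solution: on each interval \<open>[t\<^sub>j\<^sub>-\<^sub>1, t\<^sub>j]\<close> let \<open>W\<close> be the quadratic polynomial in
  time with the values \<open>U\<^sup>j\<^sup>-\<^sup>1\<close>, \<open>U\<^sup>j\<^sup>-\<^sup>2\<^sup>/\<^sup>3\<close>, \<open>U\<^sup>j\<close> at \<open>t\<^sub>j\<^sub>-\<^sub>1\<close>, \<open>t\<^sub>j\<^sub>-\<^sub>2\<^sub>/\<^sub>3\<close>, \<open>t\<^sub>j\<close>.  The two equations of the scheme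
  say precisely that \<open>\<partial>\<^sub>t W\<close> is the linear interpolant of \<open>\<psi>\<^sup>j\<^sup>-\<^sup>2\<^sup>/\<^sup>3\<close> and \<open>\<psi>\<^sup>j\<close>.  The residual of \<open>W\<close> with
  respect to the interpolated right-hand side is therefore the difference between the quadratic and
  the linear interpolant of \<open>\<psi>\<close>, a multiple of a single quadratic polynomial, and that polynomial is
  the derivative of \<open>q(s) = (t\<^sub>j - s)\<^sup>2 (s - t\<^sub>j\<^sub>-\<^sub>1)\<close>.  So in the \<open>j\<close>-th interval
  \<open>\<K>(u - W) = (f - breve f) + q' \<chi>\<^sup>j\<close> (\<open>residual_identity\<close>), and as \<open>u - W\<close> vanishes initially, the
  representation formula gives \<open>u(T) - U\<^sup>M\<close> at almost every \<open>x\<close> as a sum over the intervals of the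
  integrals of \<open>\<langle>f - breve f, \<G>(T - s)\<rangle> + q'(s) \<langle>\<chi>\<^sup>j, \<G>(T - s)\<rangle>\<close>.

  The first summand is bounded by duality of \<open>L\<^sub>\<infinity>\<close> and \<open>L\<^sub>1\<close>.  The second one can be bounded in the same
  way, which gives the variant \<open>\<Phi>\<^sup>*\<close> of the estimator, or one can integrate by parts and move the
  derivative from \<open>q\<close>, which vanishes at both ends, to the Green's function, which gives \<open>\<Phi>\<close>.
  The functional \<open>\<chi>\<^sup>j\<close> acts on \<open>H\<^sub>0\<^sup>1(\<Omega>)\<close>, to which \<open>\<partial>\<^sub>t \<G>\<close> need not belong.  The
  integration by parts is therefore replaced by an inequality that uses only a modulus of continuity
  of \<open>s \<mapsto> \<langle>\<chi>\<^sup>j, \<G>(T - s)\<rangle>\<close> (\<open>dcubic_mean_value\<close>); that modulus comes from a mean value theorem for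
  \<open>L\<^sub>1\<close>-valued functions (\<open>L1_norm_mean_value\<close>).  All this is put together for one interval in
  \<open>interval_contribution\<close>.

  The functional-analytic basis is the bilinearity of the weak form of \<open>\<L>\<close> on \<open>H\<^sub>0\<^sup>1(\<Omega>)\<close>.  Weak gradients
  are chosen representatives, so linearity rests on their uniqueness almost everywhere, that is, on the
  fundamental lemma of the calculus of variations (\<open>fundamental_lemma_variations\<close>), for which smooth
  bump functions on boxes are constructed.  That \<open>H\<^sub>0\<^sup>1(\<Omega>)\<close> is a vector space also needs the classical
  gradient of a test function to be a weak one (\<open>has_weak_gradient_test_fun\<close>).
\<close>

section \<open>Smooth functions with compact support\<close>

lemma Ck_imp_continuous: "Ck k \<phi> \<Longrightarrow> continuous_on UNIV \<phi>"
  by (cases k) (auto simp: continuous_on_eq_continuous_within differentiable_imp_continuous_within)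

text \<open>
  The class \<open>Ck (Suc k)\<close> asks for differentiability and for partial derivatives in \<open>Ck k\<close>, but not for
  membership in \<open>Ck k\<close>.  The product rule needs the latter, since the factors occur undifferentiated.
\<close>

lemma Ck_Suc_imp_Ck: "Ck (Suc k) \<phi> \<Longrightarrow> Ck k \<phi>"
proof (induction k arbitrary: \<phi>)
  case 0
  then show ?case using Ck_imp_continuous[of "Suc 0"] by auto
next
  case (Suc k)
  have "Ck k (pd i \<phi>)" for i
    using Suc.prems by (intro Suc.IH) simp
  then show ?case using Suc.prems by simp
qed

lemma pd_eqI:
  assumes "\<And>x. (\<phi> has_derivative D x) (at x)"
  shows "pd i \<phi> = (\<lambda>x. D x (axis i 1))"
  unfolding pd_def by (rule ext) (metis assms frechet_derivative_at)

lemma differentiable_has_frechet: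
  "\<phi> differentiable (at x) \<Longrightarrow> (\<phi> has_derivative frechet_derivative \<phi> (at x)) (at x)"
  by (simp add: frechet_derivative_works)

lemma pd_lincomb:
  assumes "\<And>x. \<phi> differentiable (at x)" "\<And>x. \<psi> differentiable (at x)"
  shows "pd i (\<lambda>x. a * \<phi> x + b * \<psi> x) = (\<lambda>x. a * pd i \<phi> x + b * pd i \<psi> x)"
  using assms
  by (subst pd_eqI[where D="\<lambda>x h. a * frechet_derivative \<phi> (at x) h + b * frechet_derivative \<psi> (at x) h"])
     (auto intro!: derivative_eq_intros differentiable_has_frechet simp: pd_def)

lemma pd_mult:
  assumes "\<And>x. \<phi> differentiable (at x)" "\<And>x. \<psi> differentiable (at x)"
  shows "pd i (\<lambda>x. \<phi> x * \<psi> x) = (\<lambda>x. 1 * (\<phi> x * pd i \<psi> x) + 1 * (pd i \<phi> x * \<psi> x))"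
  using assms
  by (subst pd_eqI[where D="\<lambda>x h. \<phi> x * frechet_derivative \<psi> (at x) h + frechet_derivative \<phi> (at x) h * \<psi> x"])
     (auto intro!: derivative_eq_intros differentiable_has_frechet simp: pd_def)

lemma Ck_lincomb: "Ck k \<phi> \<Longrightarrow> Ck k \<psi> \<Longrightarrow> Ck k (\<lambda>x. a * \<phi> x + b * \<psi> x)"
proof (induction k arbitrary: \<phi> \<psi>)
  case 0
  then show ?case by (auto intro!: continuous_intros)
next
  case (Suc k)
  then show ?case by (auto simp: pd_lincomb)
qed

lemma Ck_mult: "Ck k \<phi> \<Longrightarrow> Ck k \<psi> \<Longrightarrow> Ck k (\<lambda>x. \<phi> x * \<psi> x)"
proof (induction k arbitrary: \<phi> \<psi>)
  case 0
  then show ?case by (auto intro!: continuous_intros)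
next
  case (Suc k)
  have "Ck k (\<lambda>x. 1 * (\<phi> x * pd i \<psi> x) + 1 * (pd i \<phi> x * \<psi> x))" for i
    using Suc.prems Ck_Suc_imp_Ck by (intro Ck_lincomb Suc.IH) auto
  then show ?case using Suc.prems by (auto simp: pd_mult)
qed

lemma Ck_const: "Ck k ((\<lambda>x. c) :: 'n::finite fld)"
proof (induction k arbitrary: c)
  case (Suc k)
  have "pd i ((\<lambda>x. c) :: 'n fld) = (\<lambda>x. 0)" for i
    by (subst pd_eqI[where D="\<lambda>x h. 0"]) auto
  then show ?case using Suc by simp
qed simp

lemma Ck_prod: "(\<And>i. i \<in> I \<Longrightarrow> Ck k (\<phi> i)) \<Longrightarrow> Ck k (\<lambda>x. \<Prod>i\<in>I. \<phi> i x)"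
  by (induction I rule: infinite_finite_induct) (auto intro: Ck_const Ck_mult)

text \<open>
  The functions \<open>p(1/y) exp(-1/y)\<close>, extended by zero to \<open>y \<le> 0\<close>.  The polynomial is a parameter because
  this makes the family closed under differentiation, and smoothness becomes an induction over \<open>k\<close>.
\<close>

definition flat_exp :: "real poly \<Rightarrow> real \<Rightarrow> real" where
  "flat_exp p y = (if 0 < y then poly p (1 / y) * exp (- (1 / y)) else 0)"

lemma poly_times_exp_minus_tendsto_0: "((\<lambda>z::real. poly p z * exp (- z)) \<longlongrightarrow> 0) at_top"
proof -
  have "(\<lambda>z::real. poly p z * exp (- z)) = (\<lambda>z. \<Sum>i\<le>degree p. coeff p i * (z ^ i / exp z))"
    by (auto simp: poly_altdef sum_distrib_right sum_divide_distrib exp_minus field_simps)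
  moreover have "((\<lambda>z::real. \<Sum>i\<le>degree p. coeff p i * (z ^ i / exp z)) \<longlongrightarrow> (\<Sum>i\<le>degree p. coeff p i * 0)) at_top"
    by (intro tendsto_intros tendsto_power_div_exp_0)
  ultimately show ?thesis by simp
qed

lemma flat_exp_has_derivative:
  "(flat_exp p has_real_derivative flat_exp ([:0,0,1:] * (p - pderiv p)) y) (at y)"
proof -
  consider "0 < y" | "y < 0" | "y = 0" by linarith
  then show ?thesis
  proof cases
    case 1
    have "((\<lambda>y. poly p (1 / y) * exp (- (1 / y))) has_real_derivative
        flat_exp ([:0,0,1:] * (p - pderiv p)) y) (at y)"
      using 1 unfolding flat_exp_def
      by (auto intro!: derivative_eq_intros poly_DERIV[THEN DERIV_chain2]
          simp: field_simps power2_eq_square)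
    then show ?thesis
      by (rule has_field_derivative_transform_within_open[where S="{0<..}"])
         (use 1 in \<open>auto simp: flat_exp_def\<close>)
  next
    case 2
    have "((\<lambda>y. 0) has_real_derivative flat_exp ([:0,0,1:] * (p - pderiv p)) y) (at y)"
      using 2 by (auto simp: flat_exp_def)
    then show ?thesis
      by (rule has_field_derivative_transform_within_open[where S="{..<0}"])
         (use 2 in \<open>auto simp: flat_exp_def\<close>)
  next
    case 3
    have "((\<lambda>h. flat_exp p h / h) \<longlongrightarrow> 0) (at_right 0)"
    proof -
      have "((\<lambda>h::real. poly ([:0,1:] * p) (inverse h) * exp (- (inverse h))) \<longlongrightarrow> 0) (at_right 0)"
        by (rule filterlim_compose[OF poly_times_exp_minus_tendsto_0 filterlim_inverse_at_top_right])
      moreover have "\<forall>\<^sub>F h in at_right 0. poly ([:0,1:] * p) (inverse h) * exp (- (inverse h)) = flat_exp p h / h"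
        using eventually_at_right_less[of "0::real"]
        by eventually_elim (simp add: flat_exp_def inverse_eq_divide)
      ultimately show ?thesis by (rule Lim_transform_eventually)
    qed
    moreover have "((\<lambda>h. flat_exp p h / h) \<longlongrightarrow> 0) (at_left 0)"
    proof (rule Lim_transform_eventually[OF tendsto_const])
      show "\<forall>\<^sub>F x in at_left 0. 0 = flat_exp p x / x"
        by (auto simp: flat_exp_def eventually_at_filter)
    qed
    ultimately have "((\<lambda>h. flat_exp p h / h) \<longlongrightarrow> 0) (at 0)"
      by (simp add: filterlim_split_at)
    then show ?thesis using 3 by (simp add: DERIV_def flat_exp_def)
  qed
qed

lemma Ck_flat_exp: "Ck k ((\<lambda>x. flat_exp p (c * x $ i + d)) :: 'n::finite fld)"
proof (induction k arbitrary: p)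
  case 0
  have "isCont (flat_exp p) y" for y
    using flat_exp_has_derivative by (rule DERIV_isCont)
  then have "continuous_on UNIV (flat_exp p)"
    by (simp add: continuous_on_eq_continuous_at)
  then show ?case
    by (auto intro!: continuous_on_compose2[of UNIV "flat_exp p"] continuous_intros)
next
  case (Suc k)
  have D: "((\<lambda>x. flat_exp p (c * x $ i + d)) has_derivative
      (\<lambda>h. flat_exp ([:0,0,1:] * (p - pderiv p)) (c * x $ i + d) * (c * h $ i))) (at x)" for x :: "real^'n"
  proof (rule has_derivative_compose[where g="flat_exp p" and f="\<lambda>x. c * x $ i + d" and f'="\<lambda>h. c * h $ i"
        and g'="(*) (flat_exp ([:0,0,1:] * (p - pderiv p)) (c * x $ i + d))"])
    show "((\<lambda>x. c * x $ i + d) has_derivative (\<lambda>h. c * h $ i)) (at x)"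
      by (auto intro!: derivative_eq_intros bounded_linear.has_derivative[OF bounded_linear_vec_nth])
    show "(flat_exp p has_derivative (*) (flat_exp ([:0,0,1:] * (p - pderiv p)) (c * x $ i + d))) (at (c * x $ i + d))"
      using flat_exp_has_derivative by (simp add: has_field_derivative_def)
  qed
  have "pd j (\<lambda>x. flat_exp p (c * x $ i + d)) =
     (\<lambda>x. (c * axis j 1 $ i) * flat_exp ([:0,0,1:] * (p - pderiv p)) (c * x $ i + d) + 0 * 0)" for j
    by (subst pd_eqI[OF D]) auto
  moreover have "Ck k (\<lambda>x. (c * axis j 1 $ i) * flat_exp ([:0,0,1:] * (p - pderiv p)) (c * x $ i + d) + 0 * 0)" for j
    by (intro Ck_lincomb Suc Ck_const)
  ultimately show ?case
    using D by (auto simp: differentiable_def)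
qed

text \<open>
  A test function living exactly on an open box.  With growing \<open>m\<close> each factor is stretched,
  and the functions tend to the indicator of the box while staying bounded by one.
\<close>

definition box_bump :: "real ^ 'n \<Rightarrow> real ^ 'n \<Rightarrow> nat \<Rightarrow> 'n::finite fld" where
  "box_bump a b m x = (\<Prod>i\<in>UNIV. flat_exp 1 (real (Suc m) * (x $ i - a $ i)) *
     flat_exp 1 (real (Suc m) * (b $ i - x $ i)))"

lemma box_bump_nonzero_iff: "box_bump a b m x \<noteq> 0 \<longleftrightarrow> x \<in> box a b"
  unfolding box_bump_def by (auto simp: mem_box_cart flat_exp_def zero_less_mult_iff)

lemma box_bump_le_1: "\<bar>box_bump a b m x\<bar> \<le> 1"
  unfolding box_bump_def abs_prod abs_mult
  by (intro prod_le_1) (auto simp: flat_exp_def intro!: mult_le_one)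

lemma box_bump_in_test_funs:
  assumes "cbox a b \<subseteq> \<Omega>"
  shows "box_bump a b m \<in> test_funs \<Omega>"
proof -
  have "Ck k (box_bump a b m)" for k
  proof -
    have "box_bump a b m = (\<lambda>x. \<Prod>i\<in>UNIV. flat_exp 1 (real (Suc m) * x $ i + (- real (Suc m) * a $ i)) *
     flat_exp 1 ((- real (Suc m)) * x $ i + real (Suc m) * b $ i))"
      unfolding box_bump_def by (auto simp: algebra_simps)
    then show ?thesis by (auto intro!: Ck_prod Ck_mult Ck_flat_exp)
  qed
  moreover have "closure {x. box_bump a b m x \<noteq> 0} \<subseteq> cbox a b"
    by (intro closure_minimal) (auto simp: box_bump_nonzero_iff intro: box_subset_cbox[THEN subsetD])
  moreover have "bounded {x. box_bump a b m x \<noteq> 0}"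
    by (rule bounded_subset[OF bounded_cbox[of a b]])
       (auto simp: box_bump_nonzero_iff intro: box_subset_cbox[THEN subsetD])
  ultimately show ?thesis
    using assms unfolding test_funs_def by auto
qed

lemma box_bump_tendsto: "(\<lambda>m. box_bump a b m x) \<longlonglongrightarrow> indicator (box a b) x"
proof (cases "x \<in> box a b")
  case True
  have *: "(\<lambda>m. flat_exp 1 (real (Suc m) * y)) \<longlonglongrightarrow> 1" if "0 < y" for y :: real
  proof -
    have "(\<lambda>m. exp (- (inverse y * inverse (real (Suc m))))) \<longlonglongrightarrow> exp (- (inverse y * 0))"
      by (intro tendsto_intros LIMSEQ_inverse_real_of_nat)
    moreover have "flat_exp 1 (real (Suc m) * y) = exp (- (inverse y * inverse (real (Suc m))))" for m
      using that by (simp add: flat_exp_def inverse_eq_divide)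
    ultimately show ?thesis by simp
  qed
  have "(\<lambda>m. box_bump a b m x) \<longlonglongrightarrow> (\<Prod>i\<in>(UNIV::'a set). 1 * 1)"
    unfolding box_bump_def using True by (intro tendsto_intros *) (auto simp: mem_box_cart)
  then show ?thesis using True by simp
next
  case False
  then have "box_bump a b m x = 0" for m
    using box_bump_nonzero_iff[of a b m x] by auto
  then show ?thesis using False by simp
qed

lemma test_funs_lincomb:
  assumes "\<phi> \<in> test_funs \<Omega>" "\<psi> \<in> test_funs \<Omega>"
  shows "(\<lambda>x. a * \<phi> x + b * \<psi> x) \<in> test_funs \<Omega>"
proof -
  have "closure {x. a * \<phi> x + b * \<psi> x \<noteq> 0} \<subseteq> closure ({x. \<phi> x \<noteq> 0} \<union> {x. \<psi> x \<noteq> 0})"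
    by (intro closure_mono) auto
  also have "\<dots> = closure {x. \<phi> x \<noteq> 0} \<union> closure {x. \<psi> x \<noteq> 0}" by (rule closure_Un)
  finally have *: "closure {x. a * \<phi> x + b * \<psi> x \<noteq> 0} \<subseteq> closure {x. \<phi> x \<noteq> 0} \<union> closure {x. \<psi> x \<noteq> 0}" .
  moreover have "compact (closure {x. \<phi> x \<noteq> 0} \<union> closure {x. \<psi> x \<noteq> 0})"
    using assms by (auto simp: test_funs_def)
  ultimately have "compact (closure {x. a * \<phi> x + b * \<psi> x \<noteq> 0})"
    by (meson closed_closure compact_eq_bounded_closed bounded_subset)
  then show ?thesis
    using assms * by (auto simp: test_funs_def intro!: Ck_lincomb)
qed

lemma zero_off_support: "x \<notin> closure {x. \<phi> x \<noteq> 0} \<Longrightarrow> \<phi> x = 0"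
  using closure_subset[of "{x. \<phi> x \<noteq> 0}"] by auto

lemma pd_zero_off_support:
  assumes "x \<notin> closure {x. \<phi> x \<noteq> 0}"
  shows "pd i \<phi> x = 0"
proof -
  have "open (- closure {x. \<phi> x \<noteq> 0})" by auto
  moreover have "x \<in> - closure {x. \<phi> x \<noteq> 0}" using assms by simp
  moreover have "0 = \<phi> y" if "y \<in> - closure {x. \<phi> x \<noteq> 0}" for y
    by (rule zero_off_support[symmetric]) (use that in simp)
  ultimately have "(\<phi> has_derivative (\<lambda>h. 0)) (at x)"
    using has_derivative_transform_within_open[where f="\<lambda>x. 0", OF has_derivative_const] by metis
  then show ?thesis unfolding pd_def by (metis frechet_derivative_at)
qed

lemma pd_test_funs: "\<phi> \<in> test_funs \<Omega> \<Longrightarrow> pd i \<phi> \<in> test_funs \<Omega>"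
proof -
  assume \<phi>: "\<phi> \<in> test_funs \<Omega>"
  have "Ck k (pd i \<phi>)" for k using \<phi> by (auto simp: test_funs_def dest!: spec[of _ "Suc k"])
  moreover have "closure {x. pd i \<phi> x \<noteq> 0} \<subseteq> closure {x. \<phi> x \<noteq> 0}"
    by (rule closure_minimal) (use pd_zero_off_support[of _ \<phi> i] in blast)+
  moreover from this have "compact (closure {x. pd i \<phi> x \<noteq> 0})"
    using \<phi> unfolding test_funs_def
    by (metis (no_types, lifting) bounded_subset closed_closure compact_eq_bounded_closed mem_Collect_eq)
  ultimately show ?thesis using \<phi> by (auto simp: test_funs_def)
qed

section \<open>The fundamental lemma of the calculus of variations\<close>

lemma L2_bound_integrable:
  fixes u :: "real ^ 'n \<Rightarrow> 'b::euclidean_space" and v :: "real ^ 'n \<Rightarrow> 'c::euclidean_space"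
    and f :: "real ^ 'n \<Rightarrow> real"
  assumes "u \<in> L2 \<Omega>" "v \<in> L2 \<Omega>" and [measurable]: "f \<in> borel_measurable (lebesgue_on \<Omega>)"
    and "AE x in lebesgue_on \<Omega>. \<bar>f x\<bar> \<le> C * (norm (u x) * norm (v x))"
  shows "integrable (lebesgue_on \<Omega>) f"
proof (rule Bochner_Integration.integrable_bound)
  show "integrable (lebesgue_on \<Omega>) (\<lambda>x. \<bar>C\<bar> * ((norm (u x))\<^sup>2 + (norm (v x))\<^sup>2))"
    using assms(1,2) by (auto simp: L2_def)
  show "AE x in lebesgue_on \<Omega>. norm (f x) \<le> norm (\<bar>C\<bar> * ((norm (u x))\<^sup>2 + (norm (v x))\<^sup>2))"
    using assms(4)
  proof eventually_elim
    case (elim x)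
    have "norm (u x) * norm (v x) \<le> (norm (u x))\<^sup>2 + (norm (v x))\<^sup>2"
      using sum_squares_bound[of "norm (u x)" "norm (v x)"]
        mult_nonneg_nonneg[OF norm_ge_zero[of "u x"] norm_ge_zero[of "v x"]] by linarith
    then have "\<bar>C\<bar> * (norm (u x) * norm (v x)) \<le> \<bar>C\<bar> * ((norm (u x))\<^sup>2 + (norm (v x))\<^sup>2)"
      by (intro mult_left_mono) auto
    moreover have "C * (norm (u x) * norm (v x)) \<le> \<bar>C\<bar> * (norm (u x) * norm (v x))"
      by (intro mult_right_mono) auto
    ultimately show ?case using elim by auto
  qed
qed simp

lemma L2_mult_integrable:
  fixes u v :: "'n::finite fld"
  assumes "u \<in> L2 \<Omega>" "v \<in> L2 \<Omega>"
  shows "integrable (lebesgue_on \<Omega>) (\<lambda>x. u x * v x)"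
  using assms by (intro L2_bound_integrable[where C=1 and u=u and v=v]) (auto simp: L2_def abs_mult)

text \<open>
  Bump functions tend boundedly to the indicator of the box.  A square integrable function is integrable
  over a bounded set because \<open>\<bar>g\<bar> \<le> 1 + g\<^sup>2\<close>, which provides the dominating function.
\<close>

lemma integral_box_eq_0:
  fixes g :: "'n::finite fld"
  assumes [measurable]: "\<Omega> \<in> sets lebesgue" and [measurable]: "g \<in> borel_measurable (lebesgue_on \<Omega>)"
    and sq: "integrable (lebesgue_on \<Omega>) (\<lambda>x. (g x)\<^sup>2)"
    and orth: "\<And>\<phi>. \<phi> \<in> test_funs \<Omega> \<Longrightarrow> ip \<Omega> g \<phi> = 0"
    and sub: "cbox a b \<subseteq> \<Omega>"
  shows "integrable (lebesgue_on \<Omega>) (\<lambda>x. indicator (box a b) x * g x)"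
    and "(LINT x|lebesgue_on \<Omega>. indicator (box a b) x * g x) = 0"
proof -
  have ind: "integrable (lebesgue_on \<Omega>) (indicator (box a b) :: 'n fld)"
    using assms(1)
  proof (subst integrable_restrict_space)
    have "integrable lebesgue (indicator (box a b) :: 'n fld)"
      by (intro integrable_real_indicator) (auto simp: emeasure_lborel_box_eq)
    then show "integrable lebesgue (\<lambda>x. indicator \<Omega> x *\<^sub>R (indicator (box a b) x :: real))"
      by (intro integrable_mult_indicator) auto
  qed auto
  have m[measurable]: "(indicator (box a b) :: 'n fld) \<in> borel_measurable (lebesgue_on \<Omega>)"
    using ind by (rule borel_measurable_integrable)
  have dom: "integrable (lebesgue_on \<Omega>) (\<lambda>x. indicator (box a b) x + (g x)\<^sup>2)"
    using ind sq by auto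
  have gle: "\<bar>g x\<bar> \<le> 1 + (g x)\<^sup>2" for x
    using sum_squares_bound[of 1 "\<bar>g x\<bar>"] by simp
  have le: "\<bar>c * g x\<bar> \<le> indicator (box a b) x + (g x)\<^sup>2"
    if "\<bar>c\<bar> \<le> 1" "c \<noteq> 0 \<Longrightarrow> x \<in> box a b" for c x
  proof (cases "c = 0")
    case False
    have "\<bar>c * g x\<bar> \<le> 1 * \<bar>g x\<bar>" unfolding abs_mult using that(1) by (intro mult_right_mono) auto
    then show ?thesis using gle[of x] that(2)[OF False] by simp
  qed auto
  have bump: "(\<lambda>m. LINT x|lebesgue_on \<Omega>. box_bump a b m x * g x)
      \<longlonglongrightarrow> (LINT x|lebesgue_on \<Omega>. indicator (box a b) x * g x)"
    and int: "integrable (lebesgue_on \<Omega>) (\<lambda>x. indicator (box a b) x * g x)"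
  proof -
    have "continuous_on UNIV (box_bump a b k)" for k
      using box_bump_in_test_funs[OF sub, of k] by (auto simp: test_funs_def intro: Ck_imp_continuous)
    then have [measurable]: "box_bump a b k \<in> borel_measurable (lebesgue_on \<Omega>)" for k
      by (auto intro!: measurable_restrict_space1 measurable_completion borel_measurable_continuous_onI)
    show "(\<lambda>m. LINT x|lebesgue_on \<Omega>. box_bump a b m x * g x)
      \<longlonglongrightarrow> (LINT x|lebesgue_on \<Omega>. indicator (box a b) x * g x)"
      by (rule integral_dominated_convergence[OF _ _ dom])
         (auto intro!: tendsto_mult box_bump_tendsto AE_I2 le simp: box_bump_le_1 box_bump_nonzero_iff)
    show "integrable (lebesgue_on \<Omega>) (\<lambda>x. indicator (box a b) x * g x)"
      by (rule Bochner_Integration.integrable_bound[OF dom])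
         (auto simp: gle split: split_indicator)
  qed
  show "integrable (lebesgue_on \<Omega>) (\<lambda>x. indicator (box a b) x * g x)" by (rule int)
  have "(LINT x|lebesgue_on \<Omega>. box_bump a b m x * g x) = 0" for m
    using orth[OF box_bump_in_test_funs[OF sub, of m]] by (simp add: ip_def mult.commute)
  then show "(LINT x|lebesgue_on \<Omega>. indicator (box a b) x * g x) = 0"
    using bump LIMSEQ_unique[OF _ tendsto_const] by (metis (no_types, lifting) ext)
qed

text \<open>
  The sets over which the integral of \<open>h\<close> vanishes form a Dynkin system, and the boxes are an
  intersection-stable generator of the Borel sets.
\<close>

lemma AE_zero_if_box_integrals_zero:
  fixes h :: "'a::euclidean_space \<Rightarrow> real"
  assumes h: "integrable lborel h"
    and box: "\<And>c d. (LINT x|lborel. indicator (box c d) x * h x) = 0"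
    and UNIV: "(LINT x|lborel. h x) = 0"
  shows "AE x in lborel. h x = 0"
proof (rule density_unique_real)
  show "integrable lborel h" "integrable lborel (\<lambda>x. 0 :: real)" using h by auto
  fix A :: "'a set" assume "A \<in> sets lborel"
  then have A: "A \<in> sigma_sets UNIV (range (\<lambda>(a, b). box a b))"
    by (simp add: borel_eq_box)
  have int: "integrable lborel (\<lambda>x. indicator B x * h x)" if "B \<in> sets borel" for B
    using integrable_mult_indicator[OF _ h, of B] that by simp
  have sets: "B \<in> sets borel" if "B \<in> sigma_sets UNIV (range (\<lambda>(a, b). box a b))" for B :: "'a set"
    using that by (simp add: borel_eq_box)
  have "Int_stable (range (\<lambda>(a, b). box a b :: 'a set))"
    by (auto simp: Int_stable_def box_Int_box)
  then have "(LINT x|lborel. indicator A x * h x) = 0"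
    using subset_UNIV[of "range (\<lambda>(a, b). box a b :: 'a set)", folded Pow_UNIV] A
  proof (induction A rule: sigma_sets_induct_disjoint)
    case (basic B)
    then show ?case using box by auto
  next
    case (compl B)
    have "(\<lambda>x. indicator (UNIV - B) x * h x) = (\<lambda>x. h x - indicator B x * h x)"
      by (auto simp: indicator_def)
    then show ?case using compl h int[OF sets[OF compl(1)]] UNIV by simp
  next
    case (union B)
    have "(LINT x:(\<Union>i. B i)|lborel. h x) = (\<Sum>i. LINT x:B i|lborel. h x)"
    proof (rule lebesgue_integral_countable_add)
      show m: "B i \<in> sets lborel" for i using sets union(2) by auto
      show "B i \<inter> B j = {}" if "i \<noteq> j" for i j using union(1) that by (auto simp: disjoint_family_on_def)
      show "set_integrable lborel (\<Union>i. B i) h"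
        unfolding set_integrable_def using h m by (intro integrable_mult_indicator) auto
    qed
    then show ?case using union(3) by (simp add: set_lebesgue_integral_def)
  qed auto
  then show "(LINT x:A|lborel. h x) = (LINT x:A|lborel. 0)"
    by (simp add: set_lebesgue_integral_def)
qed

text \<open>
  Restricted to a box whose closure lies in \<open>\<Omega>\<close>, \<open>g\<close> has vanishing integrals over all boxes, because the
  intersection of two boxes is again one.  Countably many closed boxes exhaust \<open>\<Omega>\<close>, and their
  boundaries are null sets.
\<close>

lemma fundamental_lemma_variations:
  fixes g :: "'n::finite fld"
  assumes "open \<Omega>" and g: "g \<in> borel_measurable (lebesgue_on \<Omega>)"
    and sq: "integrable (lebesgue_on \<Omega>) (\<lambda>x. (g x)\<^sup>2)"
    and orth: "\<And>\<phi>. \<phi> \<in> test_funs \<Omega> \<Longrightarrow> ip \<Omega> g \<phi> = 0"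
  shows "AE x in lebesgue_on \<Omega>. g x = 0"
proof -
  have \<Omega>[measurable]: "\<Omega> \<in> sets lebesgue" using \<open>open \<Omega>\<close> by auto
  note box0 = integral_box_eq_0[OF \<Omega> g sq orth]
  have "AE x in lebesgue. x \<in> box a b \<longrightarrow> g x = 0" if "cbox a b \<subseteq> \<Omega>" for a b :: "real^'n"
  proof -
    have sub: "box a b \<subseteq> \<Omega>" using that box_subset_cbox by blast
    have eq: "(\<lambda>x. indicator \<Omega> x *\<^sub>R (indicator (box c d) x * g x)) = (\<lambda>x. indicator (box c d) x * g x)"
      if "box c d \<subseteq> \<Omega>" for c d
      using subsetD[OF that] by (intro ext) (simp add: indicator_def)
    have intg: "integrable lebesgue (\<lambda>x. indicator (box c d) x * g x)"
      and int0: "(LINT x|lebesgue. indicator (box c d) x * g x) = 0" if "cbox c d \<subseteq> \<Omega>" for c d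
    proof -
      have "box c d \<subseteq> \<Omega>" using that box_subset_cbox by blast
      then show "integrable lebesgue (\<lambda>x. indicator (box c d) x * g x)"
        "(LINT x|lebesgue. indicator (box c d) x * g x) = 0"
        using box0[OF _ that] \<Omega> eq[of c d]
        by (simp_all add: integrable_restrict_space integral_restrict_space)
    qed
    define k where "k = (\<lambda>x. indicator (box a b) x * g x)"
    have "k \<in> borel_measurable lebesgue"
      unfolding k_def using intg[OF that] by auto
    then obtain h where h[measurable]: "h \<in> borel_measurable lborel" and kh: "AE x in lborel. k x = h x"
      using completion_ex_borel_measurable_real[of k lborel] by auto
    have khL: "AE x in lebesgue. k x = h x" using kh by (rule AE_completion)
    have "AE x in lborel. h x = 0"
    proof (rule AE_zero_if_box_integrals_zero)
      have "integrable lebesgue h"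
        using intg[OF that] khL h unfolding k_def[symmetric]
        by (subst integrable_cong_AE[where g=k]) (auto intro: measurable_completion)
      then show "integrable lborel h" by (simp add: integrable_completion)
      have *: "(LINT x|lborel. indicator (box c d) x * h x) = 0" for c d
      proof -
        obtain p q where pq: "box c d \<inter> box a b = box p q" "cbox p q \<subseteq> cbox a b"
        proof (cases "box c d \<inter> box a b = {}")
          case True
          have "cbox (1 :: real^'n) 0 = {}"
            by (auto simp: mem_box_cart dest!: spec[of _ undefined])
          moreover have "box (1 :: real^'n) 0 = {}" using box_subset_cbox calculation by blast
          ultimately show ?thesis using True by (intro that[of 1 0]) auto
        next
          case False
          obtain p q where *: "box c d \<inter> box a b = box p q" by (simp add: box_Int_box)
          have "cbox p q = closure (box p q)" using False * closure_box by metis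
          also have "\<dots> \<subseteq> cbox a b"
            unfolding *[symmetric] by (rule closure_minimal) (auto intro: box_subset_cbox[THEN subsetD])
          finally show ?thesis using * that by blast
        qed
        have "(LINT x|lborel. indicator (box c d) x * h x) = (LINT x|lebesgue. indicator (box c d) x * h x)"
          by (subst integral_completion) auto
        also have "\<dots> = (LINT x|lebesgue. indicator (box p q) x * g x)"
        proof (rule integral_cong_AE)
          show "AE x in lebesgue. indicator (box c d) x * h x = indicator (box p q) x * g x"
            using khL by eventually_elim (simp add: k_def pq(1)[symmetric] indicator_inter_arith mult.assoc)
          show "(\<lambda>x. indicator (box p q) x * g x) \<in> borel_measurable lebesgue"
            using intg[of p q] pq(2) \<open>cbox a b \<subseteq> \<Omega>\<close> by auto
          show "(\<lambda>x. indicator (box c d) x * h x) \<in> borel_measurable lebesgue"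
            by (auto intro: measurable_completion)
        qed
        also have "\<dots> = 0" using pq(2) \<open>cbox a b \<subseteq> \<Omega>\<close> by (intro int0) auto
        finally show ?thesis .
      qed
      show "(LINT x|lborel. indicator (box c d) x * h x) = 0" for c d by (rule *)
      have "(LINT x|lborel. h x) = (LINT x|lborel. indicator (box a b) x * h x)"
      proof (rule integral_cong_AE)
        show "AE x in lborel. h x = indicator (box a b) x * h x"
          using kh by eventually_elim (auto simp: k_def indicator_def)
      qed auto
      then show "(LINT x|lborel. h x) = 0" using * by simp
    qed
    then have "AE x in lebesgue. h x = 0" by (rule AE_completion)
    with khL show ?thesis by eventually_elim (auto simp: k_def)
  qed note boxAE = this
  \<comment> \<open>closed boxes, since a box in an open cover of \<open>\<Omega>\<close> may touch the boundary of \<open>\<Omega>\<close>\<close>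
  have cboxAE: "AE x in lebesgue. x \<in> cbox a b \<longrightarrow> g x = 0" if "cbox a b \<subseteq> \<Omega>" for a b :: "real^'n"
  proof -
    have "cbox a b - box a b \<in> null_sets lebesgue"
      using negligible_frontier_interval negligible_iff_null_sets by blast
    from AE_not_in[OF this] boxAE[OF that] show ?thesis by eventually_elim auto
  qed
  obtain D where D: "countable D" "D \<subseteq> Pow \<Omega>" "\<And>B. B \<in> D \<Longrightarrow> \<exists>a b. B = cbox a b" "\<Union>D = \<Omega>"
    using open_countable_Union_open_cbox[OF \<open>open \<Omega>\<close>] by metis
  have "AE x in lebesgue. \<forall>B\<in>D. x \<in> B \<longrightarrow> g x = 0"
    using D(1)
  proof (rule AE_ball_countable[THEN iffD2], intro ballI)
    fix B assume "B \<in> D"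
    then show "AE x in lebesgue. x \<in> B \<longrightarrow> g x = 0" using D(2,3) cboxAE by blast
  qed
  then show ?thesis
    using D(4) \<Omega> by (subst AE_restrict_space_iff) auto
qed

section \<open>Integration by parts for test functions\<close>

text \<open>
  The integral of a difference quotient vanishes by translation invariance of Lebesgue measure.  The
  difference quotients are bounded by the maximum of the derivative and live in a fixed ball, so the
  limit may be taken under the integral.
\<close>

lemma integral_pd_eq_0:
  fixes F :: "'n::finite fld"
  assumes F: "Ck (Suc 0) F" and K: "compact K" and supp: "\<And>x. x \<notin> K \<Longrightarrow> F x = 0"
  shows "(LINT x|lborel. pd i F x) = 0"
proof -
  let ?e = "axis i 1 :: real ^ 'n"
  have diff: "F differentiable (at x)" for x using F by simp
  have contF: "continuous_on UNIV F" using F Ck_imp_continuous by blast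
  have contP: "continuous_on UNIV (pd i F)" using F by simp
  have line: "((\<lambda>s. F (x + s *\<^sub>R ?e)) has_real_derivative pd i F (x + s *\<^sub>R ?e)) (at s)" for x s
  proof -
    have "((\<lambda>s. F (x + s *\<^sub>R ?e)) has_derivative (\<lambda>h. frechet_derivative F (at (x + s *\<^sub>R ?e)) (h *\<^sub>R ?e))) (at s)"
      by (rule has_derivative_compose[where g=F and f="\<lambda>s. x + s *\<^sub>R ?e" and f'="\<lambda>h. h *\<^sub>R ?e"])
         (auto intro!: derivative_eq_intros differentiable_has_frechet diff)
    moreover have "linear (frechet_derivative F (at (x + s *\<^sub>R ?e)))"
      using diff linear_frechet_derivative by blast
    ultimately show ?thesis
      by (simp add: has_field_derivative_def pd_def linear_cmul mult.commute[of _ "frechet_derivative F _ _"])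
  qed
  have pd0: "pd i F x = 0" if "x \<notin> K" for x
  proof -
    have "open (- K)" using K by (simp add: compact_imp_closed open_Compl)
    then have "(F has_derivative (\<lambda>h. 0)) (at x)"
      by (rule has_derivative_transform_within_open[where f="\<lambda>x. 0", OF has_derivative_const])
         (use that supp in auto)
    then show ?thesis unfolding pd_def by (metis frechet_derivative_at)
  qed
  \<comment> \<open>a bound for the derivative, which also bounds the difference quotients by the mean value theorem\<close>
  obtain D where D: "\<And>x. \<bar>pd i F x\<bar> \<le> D"
  proof -
    have "bounded (pd i F ` K)"
      using K contP continuous_on_subset by (blast intro: compact_imp_bounded compact_continuous_image)
    then obtain D where "0 < D" "\<And>x. x \<in> K \<Longrightarrow> \<bar>pd i F x\<bar> \<le> D"
      by (auto simp: bounded_pos)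
    then have "\<bar>pd i F x\<bar> \<le> D" for x using pd0[of x] by (cases "x \<in> K") auto
    then show ?thesis by (rule that)
  qed
  obtain r where r: "\<And>x. x \<in> K \<Longrightarrow> norm x \<le> r"
    using compact_imp_bounded[OF K] by (auto simp: bounded_iff)
  define d where "d m = inverse (real (Suc m))" for m
  have d: "0 < d m" "d m \<le> 1" for m by (auto simp: d_def field_simps)
  define q where "q m x = (F (x + d m *\<^sub>R ?e) - F x) / d m" for m x
  have q_lim: "(\<lambda>m. q m x) \<longlonglongrightarrow> pd i F x" for x
  proof -
    have "((\<lambda>h. (F (x + h *\<^sub>R ?e) - F x) / h) \<longlongrightarrow> pd i F x) (at 0)"
      using line[of x 0] by (simp add: DERIV_def)
    moreover have "filterlim d (at 0) sequentially"
      unfolding filterlim_at d_def using LIMSEQ_inverse_real_of_nat by auto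
    ultimately show ?thesis unfolding q_def by (rule filterlim_compose)
  qed
  have q_bd: "\<bar>q m x\<bar> \<le> D * indicator (cball 0 (r + 1)) x" for m x
  proof (cases "norm x \<le> r + 1")
    case True
    obtain z where "F (x + d m *\<^sub>R ?e) - F (x + 0 *\<^sub>R ?e) = (d m - 0) * pd i F (x + z *\<^sub>R ?e)"
      using MVT2[of 0 "d m" "\<lambda>s. F (x + s *\<^sub>R ?e)" "\<lambda>s. pd i F (x + s *\<^sub>R ?e)"] line d by blast
    then have "q m x = pd i F (x + z *\<^sub>R ?e)" using d[of m] by (simp add: q_def)
    then show ?thesis using D True by simp
  next
    case False
    have "norm x \<le> norm (x + d m *\<^sub>R ?e) + norm (d m *\<^sub>R ?e)" by (metis add_diff_cancel_right' norm_triangle_ineq4)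
    then have "x + d m *\<^sub>R ?e \<notin> K" "x \<notin> K" using r False d[of m] by fastforce+
    then show ?thesis using supp False by (simp add: q_def)
  qed
  have [measurable]: "F \<in> borel_measurable borel" "pd i F \<in> borel_measurable borel"
    using contF contP by (auto intro: borel_measurable_continuous_onI)
  have "(\<lambda>m. LINT x|lborel. q m x) \<longlonglongrightarrow> (LINT x|lborel. pd i F x)"
  proof (rule integral_dominated_convergence)
    show "integrable lborel (\<lambda>x. D * indicator (cball 0 (r + 1)) x :: real)"
      by (intro integrable_mult_right integrable_real_indicator) (auto simp: emeasure_lborel_cball_finite[unfolded infinity_ennreal_def])
    show "AE x in lborel. norm (q m x) \<le> D * indicator (cball 0 (r + 1)) x" for m
      using q_bd by simp
    show "(\<lambda>x. q m x) \<in> borel_measurable lborel" for m unfolding q_def by measurable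
  qed (use q_lim in auto)
  moreover have "(LINT x|lborel. q m x) = 0" for m
  proof -
    have F1: "integrable lborel F"
    proof -
      have "integrable lborel (\<lambda>x. indicator K x *\<^sub>R F x)"
        using K contF by (intro borel_integrable_compact) (auto intro: continuous_on_subset)
      moreover have "(\<lambda>x. indicator K x *\<^sub>R F x) = F"
        using supp by (auto simp: fun_eq_iff split: split_indicator)
      ultimately show ?thesis by simp
    qed
    have eq: "(LINT x|lborel. F x) = (LINT x|lborel. F (x + d m *\<^sub>R ?e))" "integrable lborel (\<lambda>x. F (x + d m *\<^sub>R ?e))"
      using F1 integral_distr[of "(+) (d m *\<^sub>R ?e)" lborel borel F]
        integrable_distr_eq[of "(+) (d m *\<^sub>R ?e)" lborel borel F]
        lborel_distr_plus[of "d m *\<^sub>R ?e"]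
      by (auto simp: add.commute)
    then show ?thesis unfolding q_def using F1 by simp
  qed
  ultimately show ?thesis by (simp add: LIMSEQ_const_iff)
qed

section \<open>The Sobolev space as a vector space\<close>

lemma L2_measurable: "u \<in> L2 \<Omega> \<Longrightarrow> u \<in> borel_measurable (lebesgue_on \<Omega>)"
  by (simp add: L2_def)

text \<open>
  This replaces the triangle inequality for the \<open>H\<^sup>1\<close> norm: it holds pointwise and can be integrated
  directly.
\<close>

lemma norm_lincomb_sq_le:
  fixes p q :: "'b::real_inner"
  shows "(norm (a *\<^sub>R p + b *\<^sub>R q))\<^sup>2 \<le> 2 * a\<^sup>2 * (norm p)\<^sup>2 + 2 * b\<^sup>2 * (norm q)\<^sup>2"
  using inner_ge_zero[of "a *\<^sub>R p - b *\<^sub>R q"]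
  unfolding power2_norm_eq_inner
  by (simp add: inner_diff inner_add power2_eq_square algebra_simps inner_commute del: dot_square_norm)

lemma L2_lincomb:
  fixes u v :: "real ^ 'n \<Rightarrow> 'b::euclidean_space"
  assumes "u \<in> L2 \<Omega>" "v \<in> L2 \<Omega>"
  shows "(\<lambda>x. a *\<^sub>R u x + b *\<^sub>R v x) \<in> L2 \<Omega>"
proof -
  have m[measurable]: "u \<in> borel_measurable (lebesgue_on \<Omega>)" "v \<in> borel_measurable (lebesgue_on \<Omega>)"
    using assms by (auto simp: L2_def)
  have "integrable (lebesgue_on \<Omega>) (\<lambda>x. (norm (a *\<^sub>R u x + b *\<^sub>R v x))\<^sup>2)"
  proof (rule Bochner_Integration.integrable_bound)
    show "integrable (lebesgue_on \<Omega>) (\<lambda>x. 2 * a\<^sup>2 * (norm (u x))\<^sup>2 + 2 * b\<^sup>2 * (norm (v x))\<^sup>2)"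
      using assms by (auto simp: L2_def)
    have "(norm (a *\<^sub>R p + b *\<^sub>R q))\<^sup>2 \<le> 2 * a\<^sup>2 * (norm p)\<^sup>2 + 2 * b\<^sup>2 * (norm q)\<^sup>2" for p q :: 'b
      by (rule norm_lincomb_sq_le)
    then show "AE x in lebesgue_on \<Omega>. norm ((norm (a *\<^sub>R u x + b *\<^sub>R v x))\<^sup>2)
        \<le> norm (2 * a\<^sup>2 * (norm (u x))\<^sup>2 + 2 * b\<^sup>2 * (norm (v x))\<^sup>2)"
      by (auto intro!: AE_I2)
  qed simp
  then show ?thesis by (simp add: L2_def)
qed

lemma L2_component:
  fixes g :: "real ^ 'n::finite \<Rightarrow> real ^ 'n"
  assumes "g \<in> L2 \<Omega>"
  shows "(\<lambda>x. g x $ i) \<in> L2 \<Omega>"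
proof -
  have m[measurable]: "g \<in> borel_measurable (lebesgue_on \<Omega>)" using assms by (auto simp: L2_def)
  have [measurable]: "(\<lambda>x. g x $ i) \<in> borel_measurable (lebesgue_on \<Omega>)"
    using m by (rule measurable_compose) (auto intro!: borel_measurable_continuous_onI continuous_intros)
  have "integrable (lebesgue_on \<Omega>) (\<lambda>x. (norm (g x $ i))\<^sup>2)"
  proof (rule Bochner_Integration.integrable_bound)
    show "integrable (lebesgue_on \<Omega>) (\<lambda>x. (norm (g x))\<^sup>2)" using assms by (simp add: L2_def)
    show "AE x in lebesgue_on \<Omega>. norm ((norm (g x $ i))\<^sup>2) \<le> norm ((norm (g x))\<^sup>2)"
    proof (intro AE_I2)
      fix x
      have "\<bar>g x $ i\<bar> \<le> \<bar>norm (g x)\<bar>" using component_le_norm_cart[of "g x" i] by simp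
      then have "(g x $ i)\<^sup>2 \<le> (norm (g x))\<^sup>2" by (simp only: abs_le_square_iff)
      then show "norm ((norm (g x $ i))\<^sup>2) \<le> norm ((norm (g x))\<^sup>2)" by simp
    qed
  qed simp
  then show ?thesis by (simp add: L2_def)
qed

lemma ip_lincomb_left:
  assumes "u \<in> L2 \<Omega>" "v \<in> L2 \<Omega>" "w \<in> L2 \<Omega>"
  shows "ip \<Omega> (\<lambda>x. a * u x + b * v x) w = a * ip \<Omega> u w + b * ip \<Omega> v w"
  using L2_mult_integrable[OF assms(1,3)] L2_mult_integrable[OF assms(2,3)]
  by (simp add: ip_def distrib_right mult.assoc)

lemma ip_commute: "ip \<Omega> u v = ip \<Omega> v u"
  by (simp add: ip_def mult.commute)

lemma L2_real_lincomb:
  fixes u v :: "'n::finite fld"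
  assumes "u \<in> L2 \<Omega>" "v \<in> L2 \<Omega>"
  shows "(\<lambda>x. a * u x + b * v x) \<in> L2 \<Omega>"
  using L2_lincomb[OF assms, of a b] by simp

context
  fixes \<Omega> :: "(real ^ 'n::finite) set"
  assumes opn: "open \<Omega>"
begin

lemma continuous_compact_support_L2:
  assumes c: "continuous_on UNIV F" and K: "compact K" "K \<subseteq> \<Omega>" and supp: "\<And>x. x \<notin> K \<Longrightarrow> F x = 0"
  shows "(F :: real ^ 'n \<Rightarrow> 'b::euclidean_space) \<in> L2 \<Omega>"
proof -
  have [measurable]: "F \<in> borel_measurable borel"
    using c by (rule borel_measurable_continuous_onI)
  have "integrable lborel (\<lambda>x. indicator K x *\<^sub>R (norm (F x))\<^sup>2)"
    using K c by (intro borel_integrable_compact) (auto intro!: continuous_intros intro: continuous_on_subset)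
  moreover have "(\<lambda>x. indicator K x *\<^sub>R (norm (F x))\<^sup>2) = (\<lambda>x. indicator \<Omega> x *\<^sub>R (norm (F x))\<^sup>2)"
    using supp K(2) by (auto simp: fun_eq_iff split: split_indicator)
  ultimately have "integrable lborel (\<lambda>x. indicator \<Omega> x *\<^sub>R (norm (F x))\<^sup>2)" by simp
  then have "integrable lebesgue (\<lambda>x. indicator \<Omega> x *\<^sub>R (norm (F x))\<^sup>2)"
    using opn by (subst integrable_completion) auto
  then have "integrable (lebesgue_on \<Omega>) (\<lambda>x. (norm (F x))\<^sup>2)"
    using opn by (subst integrable_restrict_space) auto
  then show ?thesis
    by (auto simp: L2_def intro!: measurable_restrict_space1 measurable_completion)
qed

lemma test_funs_L2: "\<phi> \<in> test_funs \<Omega> \<Longrightarrow> \<phi> \<in> L2 \<Omega>"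
  by (rule continuous_compact_support_L2[of _ "closure {x. \<phi> x \<noteq> 0}"])
     (auto simp: test_funs_def intro: Ck_imp_continuous zero_off_support)

text \<open>
  The integral of \<open>\<partial>\<^sub>i(\<phi> \<psi>)\<close> vanishes.  It is needed because the norms \<open>H1_norm \<Omega> (u - \<phi>)\<close> in the
  definition of \<open>H\<^sub>0\<^sup>1(\<Omega>)\<close> are meaningful only if the approximating test functions have weak gradients.
\<close>

lemma has_weak_gradient_test_fun:
  assumes \<phi>: "\<phi> \<in> test_funs \<Omega>"
  shows "has_weak_gradient \<Omega> \<phi> (\<lambda>x. \<chi> i. pd i \<phi> x)"
  unfolding has_weak_gradient_def
proof (intro conjI ballI allI)
  show "\<phi> \<in> L2 \<Omega>" by (rule test_funs_L2[OF \<phi>])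
  have pd: "pd i \<phi> \<in> test_funs \<Omega>" for i using pd_test_funs[OF \<phi>] .
  have contpd: "continuous_on UNIV (pd i \<phi>)" for i
    using pd[of i] by (auto simp: test_funs_def intro: Ck_imp_continuous)
  show "(\<lambda>x. \<chi> i. pd i \<phi> x) \<in> L2 \<Omega>"
  proof (rule continuous_compact_support_L2)
    show "continuous_on UNIV (\<lambda>x. \<chi> i. pd i \<phi> x)"
      using contpd by (intro continuous_intros) auto
    show "compact (closure {x. \<phi> x \<noteq> 0})" "closure {x. \<phi> x \<noteq> 0} \<subseteq> \<Omega>"
      using \<phi> by (auto simp: test_funs_def)
    show "(\<chi> i. pd i \<phi> x) = 0" if "x \<notin> closure {x. \<phi> x \<noteq> 0}" for x
      using pd_zero_off_support[OF that] by (simp add: vec_eq_iff)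
  qed
  fix \<psi> i assume \<psi>: "\<psi> \<in> test_funs \<Omega>"
  have 0: "(LINT x|lborel. pd i (\<lambda>x. \<phi> x * \<psi> x) x) = 0"
  proof (rule integral_pd_eq_0)
    show "Ck (Suc 0) (\<lambda>x. \<phi> x * \<psi> x)" using \<phi> \<psi> by (intro Ck_mult) (auto simp only: test_funs_def)
    show "compact (closure {x. \<phi> x \<noteq> 0})" using \<phi> by (auto simp: test_funs_def)
    show "\<phi> x * \<psi> x = 0" if "x \<notin> closure {x. \<phi> x \<noteq> 0}" for x
      using zero_off_support[OF that] by simp
  qed
  have d: "\<phi> differentiable (at x)" "\<psi> differentiable (at x)" for x
    using \<phi> \<psi> by (auto simp: test_funs_def dest!: spec[of _ "Suc 0"])
  have c: "continuous_on UNIV \<phi>" "continuous_on UNIV \<psi>" "continuous_on UNIV (pd i \<psi>)"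
    using \<phi> \<psi> pd_test_funs[OF \<psi>, of i] by (auto simp: test_funs_def intro: Ck_imp_continuous)
  have [measurable]: "\<phi> \<in> borel_measurable borel" "\<psi> \<in> borel_measurable borel"
    "pd i \<phi> \<in> borel_measurable borel" "pd i \<psi> \<in> borel_measurable borel"
    using c contpd by (auto intro: borel_measurable_continuous_onI)
  have eq: "pd i (\<lambda>x. \<phi> x * \<psi> x) = (\<lambda>x. \<phi> x * pd i \<psi> x + pd i \<phi> x * \<psi> x)"
    using pd_mult[OF d] by simp
  have supp: "indicator \<Omega> x *\<^sub>R (\<phi> x * pd i \<psi> x + pd i \<phi> x * \<psi> x) = \<phi> x * pd i \<psi> x + pd i \<phi> x * \<psi> x" for x
  proof (cases "x \<in> \<Omega>")
    case False
    then have "x \<notin> closure {x. \<phi> x \<noteq> 0}" using \<phi> by (auto simp: test_funs_def)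
    moreover from this have "\<phi> x = 0" by (rule zero_off_support)
    ultimately show ?thesis using False pd_zero_off_support[of x \<phi> i] by simp
  qed simp
  have "ip \<Omega> \<phi> (pd i \<psi>) + ip \<Omega> (pd i \<phi>) \<psi> = (LINT x|lebesgue_on \<Omega>. \<phi> x * pd i \<psi> x + pd i \<phi> x * \<psi> x)"
    unfolding ip_def
    by (intro Bochner_Integration.integral_add[symmetric] L2_mult_integrable test_funs_L2 pd_test_funs \<phi> \<psi>)
  also have "\<dots> = (LINT x|lebesgue. \<phi> x * pd i \<psi> x + pd i \<phi> x * \<psi> x)"
    using opn by (subst integral_restrict_space) (simp_all only: supp, simp)
  also have "\<dots> = 0" using 0 unfolding eq by (subst integral_completion) auto
  finally show "ip \<Omega> \<phi> (pd i \<psi>) = - ip \<Omega> (\<lambda>x. (\<chi> i. pd i \<phi> x) $ i) \<psi>" by simp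
qed

lemma has_weak_gradient_lincomb:
  assumes "has_weak_gradient \<Omega> u g" "has_weak_gradient \<Omega> v h"
  shows "has_weak_gradient \<Omega> (\<lambda>x. a * u x + b * v x) (\<lambda>x. a *\<^sub>R g x + b *\<^sub>R h x)"
  using assms unfolding has_weak_gradient_def
  by (auto simp: ip_lincomb_left L2_component test_funs_L2 pd_test_funs L2_real_lincomb L2_lincomb algebra_simps)

text \<open>
  The components of \<open>g - h\<close> are orthogonal to all test functions.  Comparing two
  functions that agree almost everywhere covers both sums of functions and null functions.
\<close>

lemma weak_gradient_unique:
  assumes "has_weak_gradient \<Omega> u g" "has_weak_gradient \<Omega> v h" "AE x in lebesgue_on \<Omega>. u x = v x"
  shows "AE x in lebesgue_on \<Omega>. g x = h x"
proof -
  have L: "u \<in> L2 \<Omega>" "v \<in> L2 \<Omega>" "g \<in> L2 \<Omega>" "h \<in> L2 \<Omega>"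
    using assms by (auto simp: has_weak_gradient_def)
  have "AE x in lebesgue_on \<Omega>. 1 * g x $ i + (-1) * h x $ i = 0" for i
  proof (rule fundamental_lemma_variations[OF opn])
    have L2: "(\<lambda>x. 1 * g x $ i + (-1) * h x $ i) \<in> L2 \<Omega>"
      by (intro L2_real_lincomb L2_component L)
    then show "(\<lambda>x. 1 * g x $ i + (-1) * h x $ i) \<in> borel_measurable (lebesgue_on \<Omega>)"
      "integrable (lebesgue_on \<Omega>) (\<lambda>x. (1 * g x $ i + (-1) * h x $ i)\<^sup>2)"
      by (auto simp: L2_def)
    fix \<phi> assume \<phi>: "\<phi> \<in> test_funs \<Omega>"
    have "ip \<Omega> u (pd i \<phi>) = ip \<Omega> v (pd i \<phi>)"
      unfolding ip_def
    proof (rule integral_cong_AE)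
      show "AE x in lebesgue_on \<Omega>. u x * pd i \<phi> x = v x * pd i \<phi> x"
        using assms(3) by eventually_elim simp
    qed (use L L2_mult_integrable[OF _ test_funs_L2[OF pd_test_funs[OF \<phi>]]] in auto)
    then show "ip \<Omega> (\<lambda>x. 1 * g x $ i + (-1) * h x $ i) \<phi> = 0"
      using assms(1,2) \<phi> by (subst ip_lincomb_left) (auto simp: has_weak_gradient_def L2_component test_funs_L2)
  qed
  then have "AE x in lebesgue_on \<Omega>. \<forall>i. g x $ i - h x $ i = 0"
    by (simp add: AE_all_countable)
  then show ?thesis by eventually_elim (simp add: vec_eq_iff)
qed

lemma weak_grad: "u \<in> H1 \<Omega> \<Longrightarrow> has_weak_gradient \<Omega> u (weak_grad \<Omega> u)"
  using someI_ex[of "has_weak_gradient \<Omega> u"] by (simp add: H1_def weak_grad_def)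

lemma H1_lincomb: "u \<in> H1 \<Omega> \<Longrightarrow> v \<in> H1 \<Omega> \<Longrightarrow> (\<lambda>x. a * u x + b * v x) \<in> H1 \<Omega>"
  using has_weak_gradient_lincomb unfolding H1_def by blast

lemma weak_grad_lincomb:
  assumes "u \<in> H1 \<Omega>" "v \<in> H1 \<Omega>"
  shows "AE x in lebesgue_on \<Omega>. weak_grad \<Omega> (\<lambda>x. a * u x + b * v x) x = a *\<^sub>R weak_grad \<Omega> u x + b *\<^sub>R weak_grad \<Omega> v x"
  using assms
  by (intro weak_gradient_unique[OF weak_grad has_weak_gradient_lincomb]) (auto intro: H1_lincomb weak_grad)

lemma H1_L2: "u \<in> H1 \<Omega> \<Longrightarrow> u \<in> L2 \<Omega>" "u \<in> H1 \<Omega> \<Longrightarrow> weak_grad \<Omega> u \<in> L2 \<Omega>"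
  using weak_grad by (auto simp: has_weak_gradient_def)

lemma H1_norm_sq: "(H1_norm \<Omega> u)\<^sup>2 = (LINT x|lebesgue_on \<Omega>. (u x)\<^sup>2 + (norm (weak_grad \<Omega> u x))\<^sup>2)"
  unfolding H1_norm_def by (simp add: integral_nonneg_AE)

lemma H1_norm_lincomb_sq:
  assumes "u \<in> H1 \<Omega>" "v \<in> H1 \<Omega>"
  shows "(H1_norm \<Omega> (\<lambda>x. a * u x + b * v x))\<^sup>2 \<le> 2 * a\<^sup>2 * (H1_norm \<Omega> u)\<^sup>2 + 2 * b\<^sup>2 * (H1_norm \<Omega> v)\<^sup>2"
proof -
  have I: "integrable (lebesgue_on \<Omega>) (\<lambda>x. (w x)\<^sup>2 + (norm (weak_grad \<Omega> w x))\<^sup>2)" if "w \<in> H1 \<Omega>" for w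
    using H1_L2[OF that] by (auto simp: L2_def)
  let ?w = "\<lambda>x. a * u x + b * v x"
  have "(LINT x|lebesgue_on \<Omega>. (?w x)\<^sup>2 + (norm (weak_grad \<Omega> ?w x))\<^sup>2) \<le>
    (LINT x|lebesgue_on \<Omega>. 2 * a\<^sup>2 * ((u x)\<^sup>2 + (norm (weak_grad \<Omega> u x))\<^sup>2) + 2 * b\<^sup>2 * ((v x)\<^sup>2 + (norm (weak_grad \<Omega> v x))\<^sup>2))"
  proof (rule integral_mono_AE)
    show "AE x in lebesgue_on \<Omega>. (?w x)\<^sup>2 + (norm (weak_grad \<Omega> ?w x))\<^sup>2 \<le>
      2 * a\<^sup>2 * ((u x)\<^sup>2 + (norm (weak_grad \<Omega> u x))\<^sup>2) + 2 * b\<^sup>2 * ((v x)\<^sup>2 + (norm (weak_grad \<Omega> v x))\<^sup>2)"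
      using weak_grad_lincomb[OF assms, of a b]
    proof eventually_elim
      case (elim x)
      show ?case
        unfolding elim
        using norm_lincomb_sq_le[of a "u x" b "v x"]
          norm_lincomb_sq_le[of a "weak_grad \<Omega> u x" b "weak_grad \<Omega> v x"]
        by (simp add: distrib_left)
    qed
  qed (use I assms H1_lincomb in auto)
  also have "\<dots> = 2 * a\<^sup>2 * (H1_norm \<Omega> u)\<^sup>2 + 2 * b\<^sup>2 * (H1_norm \<Omega> v)\<^sup>2"
    unfolding H1_norm_sq using I[OF assms(1)] I[OF assms(2)] by simp
  finally show ?thesis unfolding H1_norm_sq .
qed

lemma test_funs_H1: "\<phi> \<in> test_funs \<Omega> \<Longrightarrow> \<phi> \<in> H1 \<Omega>"
  using has_weak_gradient_test_fun unfolding H1_def by blast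

lemma H01_lincomb:
  assumes "u \<in> H01 \<Omega>" "v \<in> H01 \<Omega>"
  shows "(\<lambda>x. a * u x + b * v x) \<in> H01 \<Omega>"
proof -
  obtain \<phi> \<psi> where \<phi>: "\<And>k. \<phi> k \<in> test_funs \<Omega>" "(\<lambda>k::nat. H1_norm \<Omega> (\<lambda>x. u x - \<phi> k x)) \<longlonglongrightarrow> 0"
    and \<psi>: "\<And>k. \<psi> k \<in> test_funs \<Omega>" "(\<lambda>k::nat. H1_norm \<Omega> (\<lambda>x. v x - \<psi> k x)) \<longlonglongrightarrow> 0"
    using assms unfolding H01_def by blast
  have H1: "u \<in> H1 \<Omega>" "v \<in> H1 \<Omega>" using assms by (auto simp: H01_def)
  define D where "D k = H1_norm \<Omega> (\<lambda>x. (a * u x + b * v x) - (a * \<phi> k x + b * \<psi> k x))" for k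
  have le: "(D k)\<^sup>2 \<le> 2 * a\<^sup>2 * (H1_norm \<Omega> (\<lambda>x. u x - \<phi> k x))\<^sup>2 + 2 * b\<^sup>2 * (H1_norm \<Omega> (\<lambda>x. v x - \<psi> k x))\<^sup>2" for k
  proof -
    have "D k = H1_norm \<Omega> (\<lambda>x. a * (u x - \<phi> k x) + b * (v x - \<psi> k x))"
      unfolding D_def by (simp add: algebra_simps)
    moreover have "(\<lambda>x. u x - \<phi> k x) \<in> H1 \<Omega>" "(\<lambda>x. v x - \<psi> k x) \<in> H1 \<Omega>"
      using H1_lincomb[OF H1(1) test_funs_H1[OF \<phi>(1)], of 1 "-1"]
        H1_lincomb[OF H1(2) test_funs_H1[OF \<psi>(1)], of 1 "-1"] by auto
    ultimately show ?thesis using H1_norm_lincomb_sq by simp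
  qed
  have lim: "(\<lambda>k. 2 * a\<^sup>2 * (H1_norm \<Omega> (\<lambda>x. u x - \<phi> k x))\<^sup>2 + 2 * b\<^sup>2 * (H1_norm \<Omega> (\<lambda>x. v x - \<psi> k x))\<^sup>2)
      \<longlonglongrightarrow> 2 * a\<^sup>2 * 0\<^sup>2 + 2 * b\<^sup>2 * 0\<^sup>2"
    by (intro tendsto_intros \<phi> \<psi>)
  have "(\<lambda>k. (D k)\<^sup>2) \<longlonglongrightarrow> 0"
  proof (rule tendsto_sandwich[OF _ _ tendsto_const])
    show "\<forall>\<^sub>F k in sequentially. 0 \<le> (D k)\<^sup>2" by simp
    show "\<forall>\<^sub>F k in sequentially. (D k)\<^sup>2 \<le>
        2 * a\<^sup>2 * (H1_norm \<Omega> (\<lambda>x. u x - \<phi> k x))\<^sup>2 + 2 * b\<^sup>2 * (H1_norm \<Omega> (\<lambda>x. v x - \<psi> k x))\<^sup>2"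
      using le by (intro always_eventually allI)
  qed (use lim in simp)
  then have "(\<lambda>k. sqrt ((D k)\<^sup>2)) \<longlonglongrightarrow> sqrt 0" by (rule tendsto_real_sqrt)
  then have "D \<longlonglongrightarrow> 0" by (simp add: tendsto_rabs_zero_iff)
  then have "(\<lambda>k. H1_norm \<Omega> (\<lambda>x. (a * u x + b * v x) - (a * \<phi> k x + b * \<psi> k x))) \<longlonglongrightarrow> 0"
    unfolding D_def .
  moreover have "\<forall>k. (\<lambda>x. a * \<phi> k x + b * \<psi> k x) \<in> test_funs \<Omega>"
    by (intro allI test_funs_lincomb \<phi>(1) \<psi>(1))
  ultimately have "\<exists>\<theta>. (\<forall>k. \<theta> k \<in> test_funs \<Omega>) \<and>
      (\<lambda>k. H1_norm \<Omega> (\<lambda>x. (a * u x + b * v x) - \<theta> k x)) \<longlonglongrightarrow> 0"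
    by (intro exI[of _ "\<lambda>k x. a * \<phi> k x + b * \<psi> k x"] conjI)
  then show ?thesis
    unfolding H01_def by (intro CollectI conjI H1_lincomb H1)
qed

lemma H01_H1: "u \<in> H01 \<Omega> \<Longrightarrow> u \<in> H1 \<Omega>"
  by (simp add: H01_def)

lemma H01_L2: "u \<in> H01 \<Omega> \<Longrightarrow> u \<in> L2 \<Omega>"
  using H1_L2(1) by (auto simp: H01_def)

lemma H01_lincomb3:
  assumes "u \<in> H01 \<Omega>" "v \<in> H01 \<Omega>" "w \<in> H01 \<Omega>"
  shows "(\<lambda>x. a * u x + b * v x + c * w x) \<in> H01 \<Omega>"
  using H01_lincomb[OF H01_lincomb[OF assms(1,2)] assms(3), of 1 a b c] by simp

end

section \<open>Bilinearity of the elliptic form\<close>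

context
  fixes \<Omega> :: "(real ^ 'n::finite) set" and L :: "'n fld \<Rightarrow> 'n functional"
  assumes opn: "open \<Omega>" and ell: "elliptic_operator \<Omega> L"
begin

text \<open>
  The integrand of the weak form as a pointwise bilinear function \<open>E x p P q Q\<close> of the values and weak
  gradients of both arguments.  Since linearity of the weak gradient holds only almost everywhere, it has
  to be used under the integral, and integrability (bounded coefficients times products of square
  integrable functions) is needed to split the integral.
\<close>

lemma elliptic_form:
  obtains E :: "real ^ 'n \<Rightarrow> real \<Rightarrow> real ^ 'n \<Rightarrow> real \<Rightarrow> real ^ 'n \<Rightarrow> real" where
    "\<And>u v. u \<in> H01 \<Omega> \<Longrightarrow> v \<in> H01 \<Omega> \<Longrightarrow> L u v = (LINT x|lebesgue_on \<Omega>. E x (u x) (weak_grad \<Omega> u x) (v x) (weak_grad \<Omega> v x))"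
    "\<And>u v. u \<in> H1 \<Omega> \<Longrightarrow> v \<in> H1 \<Omega> \<Longrightarrow> integrable (lebesgue_on \<Omega>) (\<lambda>x. E x (u x) (weak_grad \<Omega> u x) (v x) (weak_grad \<Omega> v x))"
    "\<And>x \<alpha> \<beta> p P p' P' q Q. E x (\<alpha> * p + \<beta> * p') (\<alpha> *\<^sub>R P + \<beta> *\<^sub>R P') q Q = \<alpha> * E x p P q Q + \<beta> * E x p' P' q Q"
    "\<And>x \<alpha> \<beta> p P q Q q' Q'. E x p P (\<alpha> * q + \<beta> * q') (\<alpha> *\<^sub>R Q + \<beta> *\<^sub>R Q') = \<alpha> * E x p P q Q + \<beta> * E x p P q' Q'"
proof -
  obtain A b d c C where m[measurable]: "A \<in> borel_measurable (lebesgue_on \<Omega>)" "b \<in> borel_measurable (lebesgue_on \<Omega>)"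
        "d \<in> borel_measurable (lebesgue_on \<Omega>)" "c \<in> borel_measurable (lebesgue_on \<Omega>)"
    and bd: "AE x in lebesgue_on \<Omega>. norm (A x) \<le> C \<and> norm (b x) \<le> C \<and> norm (d x) \<le> C \<and> \<bar>c x\<bar> \<le> C"
    and L: "\<And>u v. u \<in> H01 \<Omega> \<Longrightarrow> v \<in> H01 \<Omega> \<Longrightarrow> L u v =
           (LINT x|lebesgue_on \<Omega>.
              (A x *v weak_grad \<Omega> u x) \<bullet> weak_grad \<Omega> v x + u x * (d x \<bullet> weak_grad \<Omega> v x)
              + (b x \<bullet> weak_grad \<Omega> u x) * v x + c x * u x * v x)"
    using ell unfolding elliptic_operator_def by auto
  define E where "E x p P q Q = (A x *v P) \<bullet> Q + p * (d x \<bullet> Q) + (b x \<bullet> P) * q + c x * p * q" for x p P q Q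
  show ?thesis
  proof (rule that[of E])
    show "L u v = (LINT x|lebesgue_on \<Omega>. E x (u x) (weak_grad \<Omega> u x) (v x) (weak_grad \<Omega> v x))"
      if "u \<in> H01 \<Omega>" "v \<in> H01 \<Omega>" for u v using L[OF that] by (simp add: E_def)
    show "E x (\<alpha> * p + \<beta> * p') (\<alpha> *\<^sub>R P + \<beta> *\<^sub>R P') q Q = \<alpha> * E x p P q Q + \<beta> * E x p' P' q Q" for x \<alpha> \<beta> p P p' P' q Q
      by (simp add: E_def matrix_vector_right_distrib scaleR_matrix_vector_assoc[symmetric] matrix_vector_mult_scaleR inner_add algebra_simps)
    show "E x p P (\<alpha> * q + \<beta> * q') (\<alpha> *\<^sub>R Q + \<beta> *\<^sub>R Q') = \<alpha> * E x p P q Q + \<beta> * E x p P q' Q'" for x \<alpha> \<beta> p P q Q q' Q'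
      by (simp add: E_def inner_add algebra_simps)
    fix u v assume uv: "u \<in> H1 \<Omega>" "v \<in> H1 \<Omega>"
    note L2 = H1_L2[OF opn uv(1)] H1_L2[OF opn uv(2)]
    have [measurable]: "u \<in> borel_measurable (lebesgue_on \<Omega>)" "v \<in> borel_measurable (lebesgue_on \<Omega>)"
      "weak_grad \<Omega> u \<in> borel_measurable (lebesgue_on \<Omega>)" "weak_grad \<Omega> v \<in> borel_measurable (lebesgue_on \<Omega>)"
      using L2 by (auto simp: L2_def)
    have "integrable (lebesgue_on \<Omega>) (\<lambda>x. A x $ i $ j * weak_grad \<Omega> u x $ j * weak_grad \<Omega> v x $ i)" for i j
    proof (rule L2_bound_integrable[OF L2_component[OF L2(2)] L2_component[OF L2(4)]])
      have [measurable]: "(\<lambda>x. A x $ i $ j) \<in> borel_measurable (lebesgue_on \<Omega>)"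
        using m(1) by (rule measurable_compose) (auto intro!: borel_measurable_continuous_onI continuous_intros)
      have [measurable]: "(\<lambda>x. weak_grad \<Omega> u x $ j) \<in> borel_measurable (lebesgue_on \<Omega>)"
         "(\<lambda>x. weak_grad \<Omega> v x $ i) \<in> borel_measurable (lebesgue_on \<Omega>)"
        using L2_component[OF L2(2)] L2_component[OF L2(4)] by (auto intro: L2_measurable)
      show "(\<lambda>x. A x $ i $ j * weak_grad \<Omega> u x $ j * weak_grad \<Omega> v x $ i) \<in> borel_measurable (lebesgue_on \<Omega>)"
        by measurable
      show "AE x in lebesgue_on \<Omega>. \<bar>A x $ i $ j * weak_grad \<Omega> u x $ j * weak_grad \<Omega> v x $ i\<bar> \<le>
          C * (norm (weak_grad \<Omega> u x $ j) * norm (weak_grad \<Omega> v x $ i))"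
        using bd
      proof eventually_elim
        case (elim x)
        have "\<bar>A x $ i $ j\<bar> \<le> norm (A x $ i)" by (rule component_le_norm_cart)
        also have "\<dots> \<le> norm (A x)" by (rule Finite_Cartesian_Product.norm_nth_le)
        finally have "\<bar>A x $ i $ j\<bar> \<le> C" using elim by linarith
        then show ?case by (simp add: abs_mult mult.assoc mult_right_mono)
      qed
    qed
    moreover have "integrable (lebesgue_on \<Omega>) (\<lambda>x. u x * (d x \<bullet> weak_grad \<Omega> v x))"
    proof (rule L2_bound_integrable[OF L2(1) L2(4)])
      show "AE x in lebesgue_on \<Omega>. \<bar>u x * (d x \<bullet> weak_grad \<Omega> v x)\<bar> \<le> C * (norm (u x) * norm (weak_grad \<Omega> v x))"
        using bd
      proof eventually_elim
        case (elim x)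
        have "\<bar>d x \<bullet> weak_grad \<Omega> v x\<bar> \<le> norm (d x) * norm (weak_grad \<Omega> v x)" by (rule Cauchy_Schwarz_ineq2)
        also have "\<dots> \<le> C * norm (weak_grad \<Omega> v x)" using elim by (intro mult_right_mono) auto
        finally have "\<bar>u x\<bar> * \<bar>d x \<bullet> weak_grad \<Omega> v x\<bar> \<le> \<bar>u x\<bar> * (C * norm (weak_grad \<Omega> v x))"
          by (rule mult_left_mono) simp
        then show ?case by (simp add: abs_mult mult_ac)
      qed
    qed measurable
    moreover have "integrable (lebesgue_on \<Omega>) (\<lambda>x. (b x \<bullet> weak_grad \<Omega> u x) * v x)"
    proof (rule L2_bound_integrable[OF L2(3) L2(2)])
      show "AE x in lebesgue_on \<Omega>. \<bar>(b x \<bullet> weak_grad \<Omega> u x) * v x\<bar> \<le> C * (norm (v x) * norm (weak_grad \<Omega> u x))"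
        using bd
      proof eventually_elim
        case (elim x)
        have "\<bar>b x \<bullet> weak_grad \<Omega> u x\<bar> \<le> norm (b x) * norm (weak_grad \<Omega> u x)" by (rule Cauchy_Schwarz_ineq2)
        also have "\<dots> \<le> C * norm (weak_grad \<Omega> u x)" using elim by (intro mult_right_mono) auto
        finally have "\<bar>v x\<bar> * \<bar>b x \<bullet> weak_grad \<Omega> u x\<bar> \<le> \<bar>v x\<bar> * (C * norm (weak_grad \<Omega> u x))"
          by (rule mult_left_mono) simp
        then show ?case by (simp add: abs_mult mult_ac)
      qed
    qed measurable
    moreover have "integrable (lebesgue_on \<Omega>) (\<lambda>x. c x * u x * v x)"
    proof (rule L2_bound_integrable[OF L2(1) L2(3)])
      show "AE x in lebesgue_on \<Omega>. \<bar>c x * u x * v x\<bar> \<le> C * (norm (u x) * norm (v x))"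
        using bd by eventually_elim (simp add: abs_mult mult.assoc mult_right_mono)
    qed measurable
    moreover have "(A x *v P) \<bullet> Q = (\<Sum>i\<in>UNIV. \<Sum>j\<in>UNIV. A x $ i $ j * P $ j * Q $ i)" for x P Q
      by (simp add: inner_vec_def matrix_vector_mult_def sum_distrib_right)
    ultimately show "integrable (lebesgue_on \<Omega>) (\<lambda>x. E x (u x) (weak_grad \<Omega> u x) (v x) (weak_grad \<Omega> v x))"
      unfolding E_def by (auto intro!: Bochner_Integration.integrable_add Bochner_Integration.integrable_sum)
  qed
qed

lemma elliptic_lincomb_left:
  assumes "u \<in> H01 \<Omega>" "v \<in> H01 \<Omega>" "w \<in> H01 \<Omega>"
  shows "L (\<lambda>x. a * u x + b * v x) w = a * L u w + b * L v w"
proof -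
  obtain E where E: "\<And>u v. u \<in> H01 \<Omega> \<Longrightarrow> v \<in> H01 \<Omega> \<Longrightarrow> L u v = (LINT x|lebesgue_on \<Omega>. E x (u x) (weak_grad \<Omega> u x) (v x) (weak_grad \<Omega> v x))"
    "\<And>u v. u \<in> H1 \<Omega> \<Longrightarrow> v \<in> H1 \<Omega> \<Longrightarrow> integrable (lebesgue_on \<Omega>) (\<lambda>x. E x (u x) (weak_grad \<Omega> u x) (v x) (weak_grad \<Omega> v x))"
    and lin: "\<And>x \<alpha> \<beta> p P p' P' q Q. E x (\<alpha> * p + \<beta> * p') (\<alpha> *\<^sub>R P + \<beta> *\<^sub>R P') q Q = \<alpha> * E x p P q Q + \<beta> * E x p' P' q Q"
    by (rule elliptic_form) blast
  note H1 = assms[THEN H01_H1[OF opn]]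
  note int = E(2)[OF H1(1,3)] E(2)[OF H1(2,3)] E(2)[OF H1_lincomb[OF opn H1(1,2)] H1(3)]
  have "L (\<lambda>x. a * u x + b * v x) w = (LINT x|lebesgue_on \<Omega>. a * E x (u x) (weak_grad \<Omega> u x) (w x) (weak_grad \<Omega> w x)
      + b * E x (v x) (weak_grad \<Omega> v x) (w x) (weak_grad \<Omega> w x))"
    unfolding E(1)[OF H01_lincomb[OF opn assms(1,2)] assms(3)]
  proof (rule integral_cong_AE)
    show "AE x in lebesgue_on \<Omega>. E x (a * u x + b * v x) (weak_grad \<Omega> (\<lambda>x. a * u x + b * v x) x) (w x) (weak_grad \<Omega> w x) =
      a * E x (u x) (weak_grad \<Omega> u x) (w x) (weak_grad \<Omega> w x) + b * E x (v x) (weak_grad \<Omega> v x) (w x) (weak_grad \<Omega> w x)"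
      using weak_grad_lincomb[OF opn H1(1,2), of a b] by eventually_elim (simp only: lin)
  qed (use int in \<open>auto simp del: borel_measurable_const_add\<close>)
  also have "\<dots> = a * L u w + b * L v w" using int assms by (simp add: E(1))
  finally show ?thesis .
qed

lemma elliptic_lincomb_right:
  assumes "u \<in> H01 \<Omega>" "v \<in> H01 \<Omega>" "w \<in> H01 \<Omega>"
  shows "L w (\<lambda>x. a * u x + b * v x) = a * L w u + b * L w v"
proof -
  obtain E where E: "\<And>u v. u \<in> H01 \<Omega> \<Longrightarrow> v \<in> H01 \<Omega> \<Longrightarrow> L u v = (LINT x|lebesgue_on \<Omega>. E x (u x) (weak_grad \<Omega> u x) (v x) (weak_grad \<Omega> v x))"
    "\<And>u v. u \<in> H1 \<Omega> \<Longrightarrow> v \<in> H1 \<Omega> \<Longrightarrow> integrable (lebesgue_on \<Omega>) (\<lambda>x. E x (u x) (weak_grad \<Omega> u x) (v x) (weak_grad \<Omega> v x))"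
    and lin: "\<And>x \<alpha> \<beta> p P q Q q' Q'. E x p P (\<alpha> * q + \<beta> * q') (\<alpha> *\<^sub>R Q + \<beta> *\<^sub>R Q') = \<alpha> * E x p P q Q + \<beta> * E x p P q' Q'"
    by (rule elliptic_form) blast
  note H1 = assms[THEN H01_H1[OF opn]]
  note int = E(2)[OF H1(3,1)] E(2)[OF H1(3,2)] E(2)[OF H1(3) H1_lincomb[OF opn H1(1,2)]]
  have "L w (\<lambda>x. a * u x + b * v x) = (LINT x|lebesgue_on \<Omega>. a * E x (w x) (weak_grad \<Omega> w x) (u x) (weak_grad \<Omega> u x)
      + b * E x (w x) (weak_grad \<Omega> w x) (v x) (weak_grad \<Omega> v x))"
    unfolding E(1)[OF assms(3) H01_lincomb[OF opn assms(1,2)]]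
  proof (rule integral_cong_AE)
    show "AE x in lebesgue_on \<Omega>. E x (w x) (weak_grad \<Omega> w x) (a * u x + b * v x) (weak_grad \<Omega> (\<lambda>x. a * u x + b * v x) x) =
      a * E x (w x) (weak_grad \<Omega> w x) (u x) (weak_grad \<Omega> u x) + b * E x (w x) (weak_grad \<Omega> w x) (v x) (weak_grad \<Omega> v x)"
      using weak_grad_lincomb[OF opn H1(1,2), of a b] by eventually_elim (simp only: lin)
  qed (use int in \<open>auto\<close>)
  also have "\<dots> = a * L w u + b * L w v" using int assms by (simp add: E(1))
  finally show ?thesis .
qed

text \<open>
  The weak form respects almost everywhere equality in its second argument.  This serves when the
  \<open>L\<^sub>1\<close> bounds force a member of the Green's family, or a difference of two, to be a null function.
\<close>

lemma elliptic_null_right: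
  assumes "w \<in> H01 \<Omega>" "v \<in> H01 \<Omega>" "AE x in lebesgue_on \<Omega>. v x = 0"
  shows "L w v = 0"
proof -
  obtain E where E: "\<And>u v. u \<in> H01 \<Omega> \<Longrightarrow> v \<in> H01 \<Omega> \<Longrightarrow> L u v = (LINT x|lebesgue_on \<Omega>. E x (u x) (weak_grad \<Omega> u x) (v x) (weak_grad \<Omega> v x))"
    and lin: "\<And>x \<alpha> \<beta> p P q Q q' Q'. E x p P (\<alpha> * q + \<beta> * q') (\<alpha> *\<^sub>R Q + \<beta> *\<^sub>R Q') = \<alpha> * E x p P q Q + \<beta> * E x p P q' Q'"
    by (rule elliptic_form) blast
  have wg: "has_weak_gradient \<Omega> v (weak_grad \<Omega> v)" using assms(2) weak_grad[OF opn] H01_H1[OF opn] by blast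
  have E0: "E x p P 0 0 = 0" for x p P
    using lin[of x p P 0 0 0 0 0 0] by simp
  have "AE x in lebesgue_on \<Omega>. weak_grad \<Omega> v x = 0 *\<^sub>R weak_grad \<Omega> v x + 0 *\<^sub>R weak_grad \<Omega> v x"
    using assms(3) by (intro weak_gradient_unique[OF opn wg has_weak_gradient_lincomb[OF opn wg wg, of 0 0]]) simp
  then have "AE x in lebesgue_on \<Omega>. E x (w x) (weak_grad \<Omega> w x) (v x) (weak_grad \<Omega> v x) = 0"
    using assms(3) by eventually_elim (simp add: E0)
  then show ?thesis unfolding E(1)[OF assms(1,2)] by (rule integral_eq_zero_AE)
qed

end

section \<open>Duality of the sup norm and the \<open>L\<^sub>1\<close> norm\<close>

text \<open>
  Hoelder's inequality, including functions \<open>h\<close> for which only \<open>\<bar>h\<bar>\<close> is measurable: if \<open>h * v\<close> is not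
  integrable, then the inner product is zero by convention.
\<close>

lemma ip_le_Linf_L1:
  fixes v :: "'n::finite fld"
  assumes v[measurable]: "v \<in> borel_measurable (lebesgue_on \<Omega>)"
  shows "ennreal \<bar>ip \<Omega> h v\<bar> \<le> Linf_norm \<Omega> h * L1_norm \<Omega> v"
proof (cases "integrable (lebesgue_on \<Omega>) (\<lambda>x. h x * v x)")
  case True
  have "ennreal \<bar>ip \<Omega> h v\<bar> \<le> (\<integral>\<^sup>+ x. ennreal (norm (h x * v x)) \<partial>lebesgue_on \<Omega>)"
    unfolding ip_def real_norm_def[symmetric] by (rule integral_norm_bound_ennreal[OF True])
  also have "\<dots> \<le> (\<integral>\<^sup>+ x. Linf_norm \<Omega> h * ennreal \<bar>v x\<bar> \<partial>lebesgue_on \<Omega>)"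
  proof (rule nn_integral_mono_AE)
    have "AE x in lebesgue_on \<Omega>. ennreal \<bar>h x\<bar> \<le> Linf_norm \<Omega> h"
      unfolding Linf_norm_def by (rule esssup_AE)
    then show "AE x in lebesgue_on \<Omega>. ennreal (norm (h x * v x)) \<le> Linf_norm \<Omega> h * ennreal \<bar>v x\<bar>"
      by eventually_elim (simp add: abs_mult ennreal_mult mult_right_mono)
  qed
  also have "\<dots> = Linf_norm \<Omega> h * L1_norm \<Omega> v"
    using v by (simp add: nn_integral_cmult L1_norm_def)
  finally show ?thesis .
qed (simp add: ip_def not_integrable_integral_eq)

lemma L1_norm_integrable:
  "L1_norm \<Omega> v < \<infinity> \<longleftrightarrow> integrable (lebesgue_on \<Omega>) v"
  by (auto simp: L1_norm_def integrable_iff_bounded)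

lemma L1_norm_zero: "L1_norm \<Omega> v = 0 \<Longrightarrow> AE x in lebesgue_on \<Omega>. v x = 0"
  by (auto simp: L1_norm_def nn_integral_0_iff_AE split: if_splits)

text \<open>
  Testing with the sign \<open>w\<close> of \<open>g t2 - g t1\<close> turns the \<open>L\<^sub>1\<close> norm of the increment into the increment of
  the real function \<open>t \<mapsto> ip \<Omega> w (g t)\<close>, whose derivative is bounded by \<open>c\<close> because \<open>\<bar>w\<bar> \<le> 1\<close>.
\<close>

lemma L1_norm_mean_value:
  fixes g g' :: "real \<Rightarrow> 'n::finite fld"
  assumes t: "a < t1" "t1 \<le> t2" "t2 < b"
    and int: "\<And>t. t \<in> {a<..<b} \<Longrightarrow> integrable (lebesgue_on \<Omega>) (g t)"
    and der: "\<And>t. t \<in> {a<..<b} \<Longrightarrow> has_L1_time_derivative \<Omega> g (g' t) t"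
    and bound: "\<And>t. t \<in> {t1..t2} \<Longrightarrow> L1_norm \<Omega> (g' t) \<le> ennreal (c t)"
    and nonneg: "\<And>t. t \<in> {t1..t2} \<Longrightarrow> 0 \<le> c t"
    and B: "\<And>t. t \<in> {t1..t2} \<Longrightarrow> (B has_real_derivative c t) (at t)"
  shows "L1_norm \<Omega> (\<lambda>x. g t2 x - g t1 x) \<le> ennreal (B t2 - B t1)"
proof -
  have int12: "integrable (lebesgue_on \<Omega>) (g t1)" "integrable (lebesgue_on \<Omega>) (g t2)" using t int by auto
  define w where "w x = sgn (g t2 x - g t1 x)" for x
  have [measurable]: "w \<in> borel_measurable (lebesgue_on \<Omega>)"
    unfolding w_def sgn_if using int12[THEN borel_measurable_integrable] by measurable
  have w1: "\<bar>w x\<bar> \<le> 1" for x by (auto simp: w_def sgn_if)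
  have wint: "integrable (lebesgue_on \<Omega>) (\<lambda>x. w x * v x)" if "integrable (lebesgue_on \<Omega>) v" for v
    by (rule Bochner_Integration.integrable_bound[OF that])
       (use that[THEN borel_measurable_integrable] w1 in \<open>auto simp: abs_mult intro!: AE_I2 mult_left_le_one_le\<close>)
  have wle: "ennreal \<bar>ip \<Omega> w v\<bar> \<le> L1_norm \<Omega> v" if "integrable (lebesgue_on \<Omega>) v" for v
  proof -
    have "Linf_norm \<Omega> w \<le> 1"
      unfolding Linf_norm_def by (intro esssup_I AE_I2) (auto simp: w1 ennreal_le_1)
    then show ?thesis
      using ip_le_Linf_L1[OF borel_measurable_integrable[OF that], of w] mult_right_mono[of "Linf_norm \<Omega> w" 1 "L1_norm \<Omega> v"]
      by (auto intro: order_trans)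
  qed
  define \<omega> where "\<omega> t = ip \<Omega> w (g t)" for t
  have \<omega>': "(\<omega> has_real_derivative ip \<Omega> w (g' t)) (at t)" if "t \<in> {a<..<b}" for t
  proof -
    have g': "integrable (lebesgue_on \<Omega>) (g' t)"
      and lim: "((\<lambda>h. L1_norm \<Omega> (\<lambda>x. (g (t + h) x - g t x) / h - g' t x)) \<longlongrightarrow> 0) (at 0)"
      using der[OF that] by (auto simp: has_L1_time_derivative_def)
    have "\<forall>\<^sub>F h in at 0. h \<in> {a - t<..<b - t} - {0}"
      using that by (intro eventually_at_in_open) auto
    then have ev: "\<forall>\<^sub>F h in at 0. t + h \<in> {a<..<b}" by eventually_elim auto
    have "((\<lambda>h. ennreal \<bar>(\<omega> (t + h) - \<omega> t) / h - ip \<Omega> w (g' t)\<bar>) \<longlongrightarrow> 0) (at 0)"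
    proof (rule tendsto_sandwich[OF _ _ tendsto_const lim])
      show "\<forall>\<^sub>F h in at 0. ennreal \<bar>(\<omega> (t + h) - \<omega> t) / h - ip \<Omega> w (g' t)\<bar>
          \<le> L1_norm \<Omega> (\<lambda>x. (g (t + h) x - g t x) / h - g' t x)"
        using ev
      proof eventually_elim
        case (elim h)
        have "ip \<Omega> w (\<lambda>x. (g (t + h) x - g t x) / h - g' t x) = (\<omega> (t + h) - \<omega> t) / h - ip \<Omega> w (g' t)"
          unfolding ip_def \<omega>_def using wint[OF int[OF elim]] wint[OF int[OF that]] wint[OF g']
          by (simp add: right_diff_distrib)
        moreover have "integrable (lebesgue_on \<Omega>) (\<lambda>x. (g (t + h) x - g t x) / h - g' t x)"
          using int[OF elim] int[OF that] g' by auto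
        ultimately show ?case using wle by metis
      qed
    qed simp
    then have "((\<lambda>h. \<bar>(\<omega> (t + h) - \<omega> t) / h - ip \<Omega> w (g' t)\<bar>) \<longlongrightarrow> 0) (at 0)"
      using tendsto_ennreal_iff[of "\<lambda>h. \<bar>(\<omega> (t + h) - \<omega> t) / h - ip \<Omega> w (g' t)\<bar>" "at 0" 0] by simp
    then have "((\<lambda>h. (\<omega> (t + h) - \<omega> t) / h - ip \<Omega> w (g' t)) \<longlongrightarrow> 0) (at 0)"
      by (rule tendsto_rabs_zero_cancel)
    then show ?thesis unfolding DERIV_def by (simp add: LIM_zero_cancel)
  qed
  have "B t1 - \<omega> t1 \<le> B t2 - \<omega> t2"
  proof (rule DERIV_nonneg_imp_nondecreasing[OF t(2)])
    fix t assume tt: "t1 \<le> t" "t \<le> t2"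
    then have tab: "t \<in> {a<..<b}" "t \<in> {t1..t2}" using t by auto
    have "integrable (lebesgue_on \<Omega>) (g' t)" using der[OF tab(1)] by (auto simp: has_L1_time_derivative_def)
    then have "ennreal \<bar>ip \<Omega> w (g' t)\<bar> \<le> ennreal (c t)"
      using wle bound[OF tab(2)] order_trans by blast
    then have "\<bar>ip \<Omega> w (g' t)\<bar> \<le> c t" using nonneg[OF tab(2)] by simp
    then show "\<exists>y. ((\<lambda>t. B t - \<omega> t) has_real_derivative y) (at t) \<and> 0 \<le> y"
      using B[OF tab(2)] \<omega>'[OF tab(1)]
      by (intro exI[of _ "c t - ip \<Omega> w (g' t)"]) (auto intro!: derivative_eq_intros)
  qed
  moreover have "\<omega> t2 - \<omega> t1 = (LINT x|lebesgue_on \<Omega>. \<bar>g t2 x - g t1 x\<bar>)"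
  proof -
    have "\<omega> t2 - \<omega> t1 = (LINT x|lebesgue_on \<Omega>. w x * g t2 x - w x * g t1 x)"
      unfolding \<omega>_def ip_def using wint[OF int12(1)] wint[OF int12(2)] by simp
    also have "(\<lambda>x. w x * g t2 x - w x * g t1 x) = (\<lambda>x. \<bar>g t2 x - g t1 x\<bar>)"
      by (auto simp: w_def abs_sgn algebra_simps)
    finally show ?thesis .
  qed
  moreover have "L1_norm \<Omega> (\<lambda>x. g t2 x - g t1 x) = ennreal (LINT x|lebesgue_on \<Omega>. \<bar>g t2 x - g t1 x\<bar>)"
    using int12 by (auto simp: L1_norm_def nn_integral_eq_integral)
  ultimately show ?thesis by (simp add: ennreal_leI)
qed

section \<open>Integrals against the derivative of the cubic\<close>

definition cubic :: "real \<Rightarrow> real \<Rightarrow> real \<Rightarrow> real" where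
  "cubic a b s = (b - s)\<^sup>2 * (s - a)"

text \<open>
  The derivative of \<open>cubic a b\<close>.  Between \<open>a\<close> and \<open>b\<close> it changes sign once, from positive to negative, at
  \<open>(b + 2 * a) / 3\<close>, which is the intermediate point of the scheme.
\<close>

definition dcubic :: "real \<Rightarrow> real \<Rightarrow> real \<Rightarrow> real" where
  "dcubic a b s = (b - s) * (b + 2 * a - 3 * s)"

lemma cubic_has_derivative: "(cubic a b has_real_derivative dcubic a b s) (at s)"
  unfolding cubic_def dcubic_def
  by (auto intro!: derivative_eq_intros simp: power2_eq_square algebra_simps)

lemma has_integral_cubic:
  assumes "a \<le> b"
  shows "(cubic a b has_integral (b - a) ^ 4 / 12) {a..b}"
proof -
  let ?F = "\<lambda>s. (b - s) ^ 4 / 4 - (b - a) * (b - s) ^ 3 / 3"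
  have "(cubic a b has_integral ?F b - ?F a) {a..b}"
  proof (rule fundamental_theorem_of_calculus[OF assms])
    fix s
    show "(?F has_vector_derivative cubic a b s) (at s within {a..b})"
      unfolding has_real_derivative_iff_has_vector_derivative[symmetric] cubic_def
      by (rule derivative_eq_intros refl | simp add: field_simps power2_eq_square power3_eq_cube)+
  qed
  moreover have "?F b - ?F a = (b - a) ^ 4 / 12"
    by (simp add: power4_eq_xxxx power3_eq_cube field_simps)
  ultimately show ?thesis by simp
qed

lemma has_integral_dcubic:
  assumes "a \<le> b"
  shows "(dcubic a b has_integral 0) {a..b}"
proof -
  have "(dcubic a b has_integral cubic a b b - cubic a b a) {a..b}"
    by (rule fundamental_theorem_of_calculus[OF assms])
       (simp add: has_real_derivative_iff_has_vector_derivative[symmetric] has_field_derivative_at_within cubic_has_derivative)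
  then show ?thesis by (simp add: cubic_def)
qed

lemma continuous_on_dcubic: "continuous_on S (dcubic a b)"
  unfolding dcubic_def by (intro continuous_intros)

text \<open>
  The crude bound, which leads to \<open>\<Phi>\<^sup>*\<close>.
\<close>

lemma dcubic_weighted_integrable:
  assumes ab: "a < b" and cont: "continuous_on {a<..<b} g" and bd: "\<And>s. s \<in> {a<..<b} \<Longrightarrow> \<bar>g s\<bar> \<le> P"
  shows "integrable (lebesgue_on {a<..<b}) (\<lambda>s. dcubic a b s * g s)"
    and "\<bar>LINT s|lebesgue_on {a<..<b}. dcubic a b s * g s\<bar> \<le> P * integral {a..b} (\<lambda>s. \<bar>dcubic a b s\<bar>)"
proof -
  have d: "(\<lambda>s. \<bar>dcubic a b s\<bar>) absolutely_integrable_on {a..b}"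
    by (intro absolutely_integrable_continuous_real continuous_intros continuous_on_dcubic)
  then have d': "(\<lambda>s. \<bar>dcubic a b s\<bar>) absolutely_integrable_on {a<..<b}"
    by (rule set_integrable_subset) auto
  then have dom: "integrable (lebesgue_on {a<..<b}) (\<lambda>s. P * \<bar>dcubic a b s\<bar>)"
    by (subst integrable_restrict_space) (auto simp: set_integrable_def algebra_simps)
  have le: "\<bar>dcubic a b s * g s\<bar> \<le> P * \<bar>dcubic a b s\<bar>" if "s \<in> {a<..<b}" for s
    using mult_right_mono[OF bd[OF that], of "\<bar>dcubic a b s\<bar>"] by (simp add: abs_mult mult.commute)
  show int: "integrable (lebesgue_on {a<..<b}) (\<lambda>s. dcubic a b s * g s)"
  proof (rule Bochner_Integration.integrable_bound[OF dom])
    show "(\<lambda>s. dcubic a b s * g s) \<in> borel_measurable (lebesgue_on {a<..<b})"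
      by (intro continuous_imp_measurable_on_sets_lebesgue continuous_intros continuous_on_dcubic cont) auto
    show "AE s in lebesgue_on {a<..<b}. norm (dcubic a b s * g s) \<le> norm (P * \<bar>dcubic a b s\<bar>)"
      using le by (intro AE_I2) (fastforce intro: order_trans)
  qed
  have "\<bar>LINT s|lebesgue_on {a<..<b}. dcubic a b s * g s\<bar> \<le> (LINT s|lebesgue_on {a<..<b}. P * \<bar>dcubic a b s\<bar>)"
    using integral_norm_bound[of "lebesgue_on {a<..<b}" "\<lambda>s. dcubic a b s * g s"]
      integral_mono[OF Bochner_Integration.integrable_norm[OF int] dom] le by (auto simp: abs_mult)
  also have "\<dots> = P * integral {a<..<b} (\<lambda>s. \<bar>dcubic a b s\<bar>)"
    using lebesgue_integral_eq_integral[OF dom] by simp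
  also have "integral {a<..<b} (\<lambda>s. \<bar>dcubic a b s\<bar>) = integral {a..b} (\<lambda>s. \<bar>dcubic a b s\<bar>)"
    by (rule integral_open_interval_real[symmetric])
  finally show "\<bar>LINT s|lebesgue_on {a<..<b}. dcubic a b s * g s\<bar> \<le> P * integral {a..b} (\<lambda>s. \<bar>dcubic a b s\<bar>)" .
qed

text \<open>
  For \<open>b = T\<close> the double zero of the cubic cancels the pole, and the convention \<open>0 / 0 = 0\<close> yields the
  value of the continuous extension.
\<close>

lemma cubic_div_integrable:
  assumes "a \<le> b" "b \<le> T"
  shows "(\<lambda>s. cubic a b s / (T - s)) integrable_on {a..b}"
proof (cases "b = T")
  case True
  have "cubic a b s / (T - s) = (b - s) * (s - a)" for s
    by (simp add: cubic_def True power2_eq_square)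
  then show ?thesis by (simp only:) (intro integrable_continuous_real continuous_intros)
next
  case False
  then show ?thesis
    using assms unfolding cubic_def by (intro integrable_continuous_real continuous_intros) auto
qed

text \<open>
  Integration by parts for the explicit function \<open>k' * s - k * ln (T - s)\<close>.  For \<open>b = T\<close> it has a
  logarithmic singularity at the end point, where its product with the cubic still tends to zero, which
  is also the value of the product there, since the cubic vanishes.
\<close>

lemma dcubic_log_integral:
  assumes ab: "a < b" "b \<le> T"
  shows "((\<lambda>s. dcubic a b s * (k' * s - k * ln (T - s))) has_integral
      - (k * integral {a..b} (\<lambda>s. cubic a b s / (T - s)) + k' * ((b - a) ^ 4 / 12))) {a..b}"
proof -
  let ?N = "\<lambda>s. k' * s - k * ln (T - s)"
  have ln0: "((\<lambda>s. (b - s)\<^sup>2 * (s - a) * (k' * s - k * ln (b - s))) \<longlongrightarrow> 0) (at_left b)"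
    by real_asymp
  have cont: "continuous_on {a..b} (\<lambda>s. cubic a b s * ?N s)"
  proof (cases "b = T")
    case True
    have "continuous (at s within {a..b}) (\<lambda>s. cubic a b s * ?N s)" if "s \<in> {a..b}" for s
    proof (cases "s = b")
      case True
      then show ?thesis
        using ln0 ab(1) \<open>b = T\<close>
        by (simp add: continuous_within cubic_def at_within_Icc_at_left mult.assoc)
    next
      case False
      then show ?thesis
        using that \<open>b = T\<close> unfolding cubic_def by (intro continuous_intros) auto
    qed
    then show ?thesis by (simp add: continuous_on_eq_continuous_within)
  next
    case False
    then show ?thesis
      using ab unfolding cubic_def by (intro continuous_intros) auto
  qed
  have "((\<lambda>s. dcubic a b s * ?N s + cubic a b s * (k' + k / (T - s))) has_integral
      cubic a b b * ?N b - cubic a b a * ?N a) {a..b}"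
  proof (rule fundamental_theorem_of_calculus_interior[OF _ cont])
    fix s assume s: "s \<in> {a<..<b}"
    have "(?N has_real_derivative k' + k / (T - s)) (at s)"
      using s ab by (auto intro!: derivative_eq_intros simp: field_simps)
    from DERIV_mult[OF cubic_has_derivative this]
    show "((\<lambda>s. cubic a b s * ?N s) has_vector_derivative
        dcubic a b s * ?N s + cubic a b s * (k' + k / (T - s))) (at s)"
      by (simp add: has_real_derivative_iff_has_vector_derivative mult.commute)
  qed (use ab in auto)
  then have 1: "((\<lambda>s. dcubic a b s * ?N s + cubic a b s * (k' + k / (T - s))) has_integral 0) {a..b}"
    by (simp add: cubic_def)
  have 2: "((\<lambda>s. k * (cubic a b s / (T - s)) + k' * cubic a b s) has_integral
      k * integral {a..b} (\<lambda>s. cubic a b s / (T - s)) + k' * ((b - a) ^ 4 / 12)) {a..b}"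
    using ab by (intro has_integral_add has_integral_mult_right has_integral_cubic integrable_integral cubic_div_integrable) auto
  show ?thesis
    using has_integral_diff[OF 1 2] by (simp add: algebra_simps)
qed

text \<open>
  Integration by parts as an inequality, without differentiating \<open>g\<close>.  Let \<open>N\<close> be the function in
  \<open>dcubic_log_integral\<close> and \<open>s0\<close> the zero of \<open>dcubic a b\<close> inside the interval.  Since the integral of
  \<open>dcubic a b\<close> vanishes, \<open>g s\<close> may be replaced by \<open>g s - g s0\<close>, and the change of sign of \<open>dcubic a b\<close> at
  \<open>s0\<close> makes \<open>\<bar>dcubic a b s * (g s - g s0)\<bar>\<close> at most \<open>- K * dcubic a b s * (N s - N s0)\<close> on both sides of
  \<open>s0\<close>.  The integral of the latter is known.
\<close>

lemma dcubic_mean_value: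
  assumes ab: "a < b" "b \<le> T" and K: "0 \<le> K" and k: "0 \<le> k" "0 \<le> k'"
    and bd: "\<And>s. s \<in> {a<..<b} \<Longrightarrow> \<bar>g s\<bar> \<le> P"
    and lip: "\<And>r s. a < r \<Longrightarrow> r \<le> s \<Longrightarrow> s < b \<Longrightarrow>
      \<bar>g s - g r\<bar> \<le> K * ((k' * s - k * ln (T - s)) - (k' * r - k * ln (T - r)))"
  shows "continuous_on {a<..<b} g"
    and "\<bar>LINT s|lebesgue_on {a<..<b}. dcubic a b s * g s\<bar> \<le>
      K * (k * integral {a..b} (\<lambda>s. cubic a b s / (T - s)) + k' * ((b - a) ^ 4 / 12))"
proof -
  define N where "N s = k' * s - k * ln (T - s)" for s
  have lipN: "\<bar>g s - g r\<bar> \<le> K * \<bar>N s - N r\<bar>" if "r \<in> {a<..<b}" "s \<in> {a<..<b}" for r s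
  proof (cases "r \<le> s")
    case True
    have "\<bar>g s - g r\<bar> \<le> K * (N s - N r)" using lip[OF _ True] that by (simp add: N_def)
    also have "\<dots> \<le> K * \<bar>N s - N r\<bar>" using K by (intro mult_left_mono) auto
    finally show ?thesis .
  next
    case False
    have "\<bar>g r - g s\<bar> \<le> K * (N r - N s)" using lip[of s r] that False by (simp add: N_def)
    also have "\<dots> \<le> K * \<bar>N s - N r\<bar>" using K by (intro mult_left_mono) auto
    finally show ?thesis by (simp add: abs_minus_commute)
  qed
  have contN: "continuous_on {a<..<b} N"
    unfolding N_def using ab by (intro continuous_intros) auto
  show cont: "continuous_on {a<..<b} g"
    unfolding continuous_on_def
  proof (intro ballI)
    fix r assume r: "r \<in> {a<..<b}"
    have "((\<lambda>s. N s) \<longlongrightarrow> N r) (at r within {a<..<b})"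
      using contN r by (auto simp: continuous_on_def)
    then have "((\<lambda>s. K * \<bar>N s - N r\<bar>) \<longlongrightarrow> K * \<bar>N r - N r\<bar>) (at r within {a<..<b})"
      by (intro tendsto_intros)
    then have lim: "((\<lambda>s. K * \<bar>N s - N r\<bar>) \<longlongrightarrow> 0) (at r within {a<..<b})" by simp
    have "((\<lambda>s. g s - g r) \<longlongrightarrow> 0) (at r within {a<..<b})"
      by (rule Lim_null_comparison[OF _ lim])
         (use lipN r in \<open>auto simp: eventually_at_filter\<close>)
    then show "(g \<longlongrightarrow> g r) (at r within {a<..<b})" by (rule LIM_zero_cancel)
  qed
  define s0 where "s0 = (b + 2 * a) / 3"
  have s0: "s0 \<in> {a<..<b}" using ab by (auto simp: s0_def)
  have d: "dcubic a b s = 3 * (b - s) * (s0 - s)" for s by (simp add: dcubic_def s0_def field_simps)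
  note int = dcubic_weighted_integrable(1)[OF ab(1) cont bd]
  define h where "h s = - K * (dcubic a b s * N s - N s0 * dcubic a b s)" for s
  have hint: "(h has_integral K * (k * integral {a..b} (\<lambda>s. cubic a b s / (T - s)) + k' * ((b - a) ^ 4 / 12))) {a..b}"
    using has_integral_mult_right[OF has_integral_diff[OF dcubic_log_integral[OF ab, of k' k]
        has_integral_mult_right[OF has_integral_dcubic[OF less_imp_le[OF ab(1)]], of "N s0"]], of "- K"]
    by (simp add: h_def[abs_def] N_def algebra_simps)
  have le: "norm (dcubic a b s * g s - g s0 * dcubic a b s) \<le> h s" if s: "s \<in> {a<..<b}" for s
  proof -
    have "dcubic a b s * g s - g s0 * dcubic a b s = dcubic a b s * (g s - g s0)"
      by (simp add: algebra_simps)
    then have eq: "norm (dcubic a b s * g s - g s0 * dcubic a b s) = \<bar>dcubic a b s\<bar> * \<bar>g s - g s0\<bar>"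
      by (simp only: real_norm_def abs_mult)
    show ?thesis
    proof (cases "s \<le> s0")
      case True
      have dn: "0 \<le> dcubic a b s" using True s by (simp add: d)
      have "\<bar>g s - g s0\<bar> \<le> K * (N s0 - N s)"
        using lip[OF _ True] s s0 by (simp add: N_def abs_minus_commute)
      from mult_left_mono[OF this dn] show ?thesis
        unfolding eq using dn by (simp add: h_def algebra_simps)
    next
      case False
      have dn: "0 \<le> - dcubic a b s" using False s by (simp add: d mult_nonneg_nonpos)
      have "\<bar>g s - g s0\<bar> \<le> K * (N s - N s0)"
        using lip[of s0 s] False s s0 by (simp add: N_def)
      from mult_left_mono[OF this dn] show ?thesis
        unfolding eq using dn by (simp add: h_def algebra_simps)
    qed
  qed
  have i1: "((\<lambda>s. dcubic a b s * g s) has_integral (LINT s|lebesgue_on {a<..<b}. dcubic a b s * g s)) {a<..<b}"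
    using has_integral_integral_lebesgue_on[OF int] by simp
  have i2: "((\<lambda>s. g s0 * dcubic a b s) has_integral 0) {a<..<b}"
    using has_integral_mult_right[OF has_integral_dcubic[OF less_imp_le[OF ab(1)]], of "g s0"]
    by (simp add: has_integral_Icc_iff_Ioo)
  have i3: "((\<lambda>s. dcubic a b s * g s - g s0 * dcubic a b s) has_integral (LINT s|lebesgue_on {a<..<b}. dcubic a b s * g s)) {a<..<b}"
    using has_integral_diff[OF i1 i2] by simp
  have i4: "(h has_integral K * (k * integral {a..b} (\<lambda>s. cubic a b s / (T - s)) + k' * ((b - a) ^ 4 / 12))) {a<..<b}"
    using hint by (simp add: has_integral_Icc_iff_Ioo)
  show "\<bar>LINT s|lebesgue_on {a<..<b}. dcubic a b s * g s\<bar> \<le>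
      K * (k * integral {a..b} (\<lambda>s. cubic a b s / (T - s)) + k' * ((b - a) ^ 4 / 12))"
    using integral_norm_bound_integral[OF has_integral_integrable[OF i3] has_integral_integrable[OF i4] le]
    unfolding integral_unique[OF i3] integral_unique[OF i4] by simp
qed

section \<open>The contribution of one time interval\<close>

lemma integral_cubic_div_pos:
  assumes "0 \<le> a" "a < b" "b \<le> T"
  shows "0 < integral {a..b} (\<lambda>s. cubic a b s / (T - s))"
proof -
  have T: "0 < T" using assms by linarith
  have "0 < (b - a) ^ 4 / 12 / T" using assms T by simp
  also have "\<dots> = integral {a..b} (\<lambda>s. cubic a b s / T)"
    using integral_unique[OF has_integral_cubic[of a b]] assms by (simp add: field_simps)
  also have "\<dots> \<le> integral {a..b} (\<lambda>s. cubic a b s / (T - s))"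
  proof (rule Henstock_Kurzweil_Integration.integral_le)
    show "(\<lambda>s. cubic a b s / T) integrable_on {a..b}"
      using has_integral_divide[OF has_integral_cubic, of a b T] assms by (auto simp: integrable_on_def)
    show "(\<lambda>s. cubic a b s / (T - s)) integrable_on {a..b}" using assms by (intro cubic_div_integrable) auto
    fix s assume s: "s \<in> {a..b}"
    show "cubic a b s / T \<le> cubic a b s / (T - s)"
    proof (cases "s = T")
      case True
      then show ?thesis using s assms by (simp add: cubic_def)
    next
      case False
      then show ?thesis using s assms by (intro divide_left_mono) (auto simp: cubic_def)
    qed
  qed
  finally show ?thesis .
qed

text \<open>
  With \<open>s\<close> as weight the integral of \<open>dcubic a b\<close> is \<open>- (b - a) ^ 4 / 12\<close>, whereas the crude bound
  majorises its modulus by \<open>b\<close> times the integral in question.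
\<close>

lemma integral_abs_dcubic_pos:
  assumes "0 \<le> a" "a < b"
  shows "0 < integral {a..b} (\<lambda>s. \<bar>dcubic a b s\<bar>)"
proof -
  have c: "continuous_on {a<..<b} (\<lambda>s::real. s)" by (rule continuous_on_id)
  have bd: "\<bar>s\<bar> \<le> b" if "s \<in> {a<..<b}" for s using that assms by auto
  note w = dcubic_weighted_integrable[OF assms(2) c bd, simplified]
  have "((\<lambda>s. dcubic a b s * s) has_integral - ((b - a) ^ 4 / 12)) {a<..<b}"
    using dcubic_log_integral[OF assms(2) order_refl, of 1 0] by (simp add: has_integral_Icc_iff_Ioo)
  then have "(LINT s|lebesgue_on {a<..<b}. dcubic a b s * s) = - ((b - a) ^ 4 / 12)"
    using lebesgue_integral_eq_integral[OF w(1)] by (simp add: integral_unique)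
  then have "(b - a) ^ 4 / 12 \<le> b * integral {a..b} (\<lambda>s. \<bar>dcubic a b s\<bar>)"
    using w(2) assms(2) by simp
  moreover have "0 < (b - a) ^ 4 / 12" using assms by simp
  ultimately show ?thesis using assms by (smt (verit) zero_less_mult_pos)
qed

lemma ennreal_mult_divide_cancel: "0 < c \<Longrightarrow> 0 \<le> x \<Longrightarrow> ennreal c * ennreal (x / c) = ennreal x"
  by (simp add: ennreal_mult[symmetric])

text \<open>
  The error committed in one interval, for an abstract Green's function \<open>g\<close>, data error \<open>F\<close> and
  functional \<open>X\<close>.  The two bounds for \<open>\<phi> s = X (g (T - s))\<close> and for its increments both contain a factor
  \<open>H\<close>, for which the sup norm of any function representing \<open>X\<close> may be taken.

  If no bounded function represents \<open>X\<close>, the right-hand side is infinite unless \<open>\<Psi> = 0\<close>.  In that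
  exceptional case the constants in the bounds for \<open>g\<close> or those for \<open>g'\<close> vanish, so that \<open>\<phi>\<close>
  is zero or constant, and a suitable real number \<open>H\<close> exists all the same.
\<close>

lemma interval_contribution:
  fixes \<Omega> :: "(real ^ 'n::finite) set" and g g' F :: "real \<Rightarrow> 'n fld" and X :: "'n functional"
    and R :: "real \<Rightarrow> real"
  assumes ab: "0 \<le> a" "a < b" "b \<le> T"
    and \<kappa>: "0 \<le> \<kappa>0" "0 \<le> \<kappa>1" "0 \<le> \<kappa>1'" and \<gamma>: "0 \<le> \<gamma>"
    and opn: "open \<Omega>"
    and g: "\<And>t. t \<in> {0<..<T} \<Longrightarrow> g t \<in> H01 \<Omega>"
    and g_bd: "\<And>t. t \<in> {0<..<T} \<Longrightarrow> L1_norm \<Omega> (g t) \<le> ennreal (\<kappa>0 * exp (- \<gamma> * t))"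
    and g': "\<And>t. t \<in> {0<..<T} \<Longrightarrow> has_L1_time_derivative \<Omega> g (g' t) t"
    and g'_bd: "\<And>t. t \<in> {0<..<T} \<Longrightarrow> L1_norm \<Omega> (g' t) \<le> ennreal ((\<kappa>1 / t + \<kappa>1') * exp (- \<gamma> * t))"
    and X_diff: "\<And>v w. v \<in> H01 \<Omega> \<Longrightarrow> w \<in> H01 \<Omega> \<Longrightarrow> X (\<lambda>x. v x - w x) = X v - X w"
    and X_null: "\<And>v. v \<in> H01 \<Omega> \<Longrightarrow> AE x in lebesgue_on \<Omega>. v x = 0 \<Longrightarrow> X v = 0"
    and R: "integrable (lebesgue_on {a<..<b}) R"
      "AE s in lebesgue_on {a<..<b}. R s = ip \<Omega> (F s) (g (T - s)) + dcubic a b s * X (g (T - s))"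
  defines "\<Psi> \<equiv> min (\<kappa>1 * integral {a..b} (\<lambda>s. cubic a b s / (T - s)) + \<kappa>1' * ((b - a) ^ 4 / 12))
      (\<kappa>0 * integral {a..b} (\<lambda>s. \<bar>dcubic a b s\<bar>))"
  shows "ennreal \<bar>LINT s|lebesgue_on {a<..<b}. R s\<bar> \<le> ennreal (exp (- \<gamma> * (T - b))) *
    (ennreal \<kappa>0 * (\<integral>\<^sup>+ s. Linf_norm \<Omega> (F s) \<partial>lebesgue_on {a<..<b}) + ennreal \<Psi> * Linf_norm_functional \<Omega> X)"
proof -
  define E where "E = exp (- \<gamma> * (T - b))"
  have E: "0 < E" by (simp add: E_def)
  define I1 where "I1 = integral {a..b} (\<lambda>s. cubic a b s / (T - s))"
  define I0 where "I0 = integral {a..b} (\<lambda>s. \<bar>dcubic a b s\<bar>)"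
  have I: "0 < I1" "0 < I0"
    unfolding I1_def I0_def using integral_cubic_div_pos integral_abs_dcubic_pos ab by auto
  have \<Psi>: "\<Psi> = min (\<kappa>1 * I1 + \<kappa>1' * ((b - a) ^ 4 / 12)) (\<kappa>0 * I0)"
    by (simp add: \<Psi>_def I1_def I0_def)
  have \<Psi>0: "0 \<le> \<Psi>" unfolding \<Psi> using \<kappa> I by simp
  have t: "T - s \<in> {0<..<T}" "exp (- \<gamma> * (T - s)) \<le> E" if "s \<in> {a<..<b}" for s
    using that ab \<gamma> by (auto simp: E_def mult_left_mono)
  define N where "N s = \<kappa>1' * s - \<kappa>1 * ln (T - s)" for s
  define \<phi> where "\<phi> s = X (g (T - s))" for s
  have gint: "integrable (lebesgue_on \<Omega>) (g t)" if "t \<in> {0<..<T}" for t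
    using g_bd[OF that] L1_norm_integrable[of \<Omega> "g t"] by (simp add: le_less_trans)
  have gs_bd: "L1_norm \<Omega> (g (T - s)) \<le> ennreal (\<kappa>0 * E)" if "s \<in> {a<..<b}" for s
    using g_bd[OF t(1)[OF that]] mult_left_mono[OF t(2)[OF that] \<kappa>(1)] by (auto intro: order_trans ennreal_leI)
  have diff: "(\<lambda>x. g (T - r) x - g (T - s) x) \<in> H01 \<Omega>" if "r \<in> {a<..<b}" "s \<in> {a<..<b}" for r s
    using H01_lincomb[OF opn g[OF t(1)[OF that(1)]] g[OF t(1)[OF that(2)]], of 1 "-1"] by simp
  have diff_bd: "L1_norm \<Omega> (\<lambda>x. g (T - r) x - g (T - s) x) \<le> ennreal (E * (N s - N r))"
    and N_mono: "N r \<le> N s"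
    if "a < r" "r \<le> s" "s < b" for r s
  proof -
    have "L1_norm \<Omega> (\<lambda>x. g (T - r) x - g (T - s) x) \<le>
      ennreal (E * (\<kappa>1 * ln (T - r) + \<kappa>1' * (T - r)) - E * (\<kappa>1 * ln (T - s) + \<kappa>1' * (T - s)))"
    proof (rule L1_norm_mean_value[where c="\<lambda>t. E * (\<kappa>1 / t + \<kappa>1')" and a=0 and b=T and g'=g'])
      fix t assume tt: "t \<in> {T - s..T - r}"
      then have t0: "t \<in> {0<..<T}" using that ab by auto
      have "exp (- \<gamma> * t) \<le> E" using tt that \<gamma> by (auto simp: E_def mult_left_mono)
      then have "(\<kappa>1 / t + \<kappa>1') * exp (- \<gamma> * t) \<le> (\<kappa>1 / t + \<kappa>1') * E"
        using \<kappa> t0 by (intro mult_left_mono) auto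
      then show "L1_norm \<Omega> (g' t) \<le> ennreal (E * (\<kappa>1 / t + \<kappa>1'))"
        using g'_bd[OF t0] by (auto intro: order_trans ennreal_leI simp: mult.commute)
      show "0 \<le> E * (\<kappa>1 / t + \<kappa>1')" using \<kappa> t0 E by simp
      show "((\<lambda>t. E * (\<kappa>1 * ln t + \<kappa>1' * t)) has_real_derivative E * (\<kappa>1 / t + \<kappa>1')) (at t)"
        using t0 by (auto intro!: derivative_eq_intros)
    qed (use that ab gint g' in auto)
    also have "E * (\<kappa>1 * ln (T - r) + \<kappa>1' * (T - r)) - E * (\<kappa>1 * ln (T - s) + \<kappa>1' * (T - s)) = E * (N s - N r)"
      by (simp add: N_def algebra_simps)
    finally show "L1_norm \<Omega> (\<lambda>x. g (T - r) x - g (T - s) x) \<le> ennreal (E * (N s - N r))" .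
    have "ln (T - s) \<le> ln (T - r)" using that ab by simp
    then show "N r \<le> N s"
      unfolding N_def using mult_left_mono[OF _ \<kappa>(2)] mult_left_mono[OF that(2) \<kappa>(3)] by (smt (verit))
  qed
  \<comment> \<open>the two bounds on \<open>\<phi>\<close> yield the two quantities in the minimum \<open>\<Psi>\<close>\<close>
  have key: "integrable (lebesgue_on {a<..<b}) (\<lambda>s. dcubic a b s * \<phi> s) \<and>
      \<bar>LINT s|lebesgue_on {a<..<b}. dcubic a b s * \<phi> s\<bar> \<le> E * \<Psi> * H"
    if H: "0 \<le> H" and 1: "\<And>s. s \<in> {a<..<b} \<Longrightarrow> \<bar>\<phi> s\<bar> \<le> H * (\<kappa>0 * E)"
      and 2: "\<And>r s. a < r \<Longrightarrow> r \<le> s \<Longrightarrow> s < b \<Longrightarrow> \<bar>\<phi> s - \<phi> r\<bar> \<le> H * (E * (N s - N r))" for H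
  proof -
    have "0 \<le> H * E" using H E by simp
    have lip: "\<bar>\<phi> s - \<phi> r\<bar> \<le> H * E * ((\<kappa>1' * s - \<kappa>1 * ln (T - s)) - (\<kappa>1' * r - \<kappa>1 * ln (T - r)))"
      if "a < r" "r \<le> s" "s < b" for r s
      using 2[OF that] by (simp add: N_def mult.assoc)
    note mv = dcubic_mean_value[of a b T "H * E" \<kappa>1 \<kappa>1' \<phi>, OF ab(2,3) \<open>0 \<le> H * E\<close> \<kappa>(2,3) 1 lip]
    note wi = dcubic_weighted_integrable[OF ab(2) mv(1) 1]
    have "\<bar>LINT s|lebesgue_on {a<..<b}. dcubic a b s * \<phi> s\<bar> \<le>
      min (H * E * (\<kappa>1 * I1 + \<kappa>1' * ((b - a) ^ 4 / 12))) (H * E * (\<kappa>0 * I0))"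
      using mv(2) wi(2) by (simp add: I1_def I0_def mult_ac)
    also have "\<dots> = H * E * \<Psi>"
      unfolding \<Psi> using \<open>0 \<le> H * E\<close> by (simp only: min_mult_distrib_left if_True)
    also have "\<dots> = E * \<Psi> * H" by simp
    finally show ?thesis using wi(1) by simp
  qed
  have "ennreal \<Psi> * Linf_norm_functional \<Omega> X = \<infinity> \<or>
    (integrable (lebesgue_on {a<..<b}) (\<lambda>s. dcubic a b s * \<phi> s) \<and>
      ennreal \<bar>LINT s|lebesgue_on {a<..<b}. dcubic a b s * \<phi> s\<bar> \<le> ennreal E * (ennreal \<Psi> * Linf_norm_functional \<Omega> X))"
  proof (cases "Linf_norm_functional \<Omega> X < \<infinity>")
    case True
    define S where "S = {h. Linf_norm \<Omega> h < \<infinity> \<and> (\<forall>v \<in> H01 \<Omega>. integrable (lebesgue_on \<Omega>) v \<longrightarrow> X v = ip \<Omega> h v)}"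
    have NX: "Linf_norm_functional \<Omega> X = Inf (Linf_norm \<Omega> ` S)"
      unfolding Linf_norm_functional_def S_def by (rule arg_cong[where f=Inf]) auto
    have bd: "integrable (lebesgue_on {a<..<b}) (\<lambda>s. dcubic a b s * \<phi> s) \<and>
      \<bar>LINT s|lebesgue_on {a<..<b}. dcubic a b s * \<phi> s\<bar> \<le> E * \<Psi> * enn2real (Linf_norm \<Omega> h)"
      if h: "h \<in> S" for h
    proof (rule key)
      let ?H = "enn2real (Linf_norm \<Omega> h)"
      have H: "Linf_norm \<Omega> h = ennreal ?H" using h by (simp add: S_def)
      have X_le: "\<bar>X v\<bar> \<le> ?H * c" if "v \<in> H01 \<Omega>" "L1_norm \<Omega> v \<le> ennreal c" "0 \<le> c" for v c
      proof -
        have "integrable (lebesgue_on \<Omega>) v"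
          using that(2) L1_norm_integrable[of \<Omega> v] by (simp add: le_less_trans)
        then have "X v = ip \<Omega> h v" "v \<in> borel_measurable (lebesgue_on \<Omega>)" using h that(1) by (auto simp: S_def)
        then have "ennreal \<bar>X v\<bar> \<le> ennreal ?H * L1_norm \<Omega> v" using ip_le_Linf_L1[of v \<Omega> h] H by simp
        also have "\<dots> \<le> ennreal ?H * ennreal c" using that(2) by (intro mult_left_mono) auto
        finally show ?thesis using that(3) by (simp add: ennreal_mult[symmetric])
      qed
      show "\<bar>\<phi> s\<bar> \<le> ?H * (\<kappa>0 * E)" if "s \<in> {a<..<b}" for s
        unfolding \<phi>_def using X_le[OF g[OF t(1)[OF that]] gs_bd[OF that]] \<kappa> E by simp
      show "\<bar>\<phi> s - \<phi> r\<bar> \<le> ?H * (E * (N s - N r))" if "a < r" "r \<le> s" "s < b" for r s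
      proof -
        have rs: "r \<in> {a<..<b}" "s \<in> {a<..<b}" using that by auto
        have "\<bar>\<phi> r - \<phi> s\<bar> \<le> ?H * (E * (N s - N r))"
          using X_le[OF diff[OF rs] diff_bd[OF that]] N_mono[OF that] E
          by (simp add: \<phi>_def X_diff[OF g[OF t(1)[OF rs(1)]] g[OF t(1)[OF rs(2)]]])
        then show ?thesis by (simp add: abs_minus_commute)
      qed
    qed simp
    \<comment> \<open>the bound holds for every representing function, hence for the infimum of their norms\<close>
    obtain h0 where h0: "h0 \<in> S"
      using True unfolding NX by (auto simp: Inf_less_iff)
    have "ennreal \<bar>LINT s|lebesgue_on {a<..<b}. dcubic a b s * \<phi> s\<bar> \<le> ennreal (E * \<Psi>) * Inf (Linf_norm \<Omega> ` S)"
    proof (cases "E * \<Psi> = 0")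
      case True
      then have "(LINT s|lebesgue_on {a<..<b}. dcubic a b s * \<phi> s) = 0"
        using bd[OF h0] by (simp only: mult_zero_left) simp
      then show ?thesis by simp
    next
      case False
      then have c: "0 < E * \<Psi>" using E \<Psi>0 by (simp add: less_le)
      have "ennreal (\<bar>LINT s|lebesgue_on {a<..<b}. dcubic a b s * \<phi> s\<bar> / (E * \<Psi>)) \<le> Inf (Linf_norm \<Omega> ` S)"
      proof (rule Inf_greatest, clarify)
        fix h assume h: "h \<in> S"
        have "\<bar>LINT s|lebesgue_on {a<..<b}. dcubic a b s * \<phi> s\<bar> / (E * \<Psi>) \<le> enn2real (Linf_norm \<Omega> h)"
          using bd[OF h] c by (simp add: pos_divide_le_eq mult.commute)
        then have "ennreal (\<bar>LINT s|lebesgue_on {a<..<b}. dcubic a b s * \<phi> s\<bar> / (E * \<Psi>)) \<le> ennreal (enn2real (Linf_norm \<Omega> h))"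
          by (rule ennreal_leI)
        also have "\<dots> = Linf_norm \<Omega> h" using h by (simp add: S_def)
        finally show "ennreal (\<bar>LINT s|lebesgue_on {a<..<b}. dcubic a b s * \<phi> s\<bar> / (E * \<Psi>)) \<le> Linf_norm \<Omega> h" .
      qed
      then have "ennreal (E * \<Psi>) * ennreal (\<bar>LINT s|lebesgue_on {a<..<b}. dcubic a b s * \<phi> s\<bar> / (E * \<Psi>))
          \<le> ennreal (E * \<Psi>) * Inf (Linf_norm \<Omega> ` S)"
        by (rule mult_left_mono) simp
      then show ?thesis using ennreal_mult_divide_cancel[OF c] by simp
    qed
    then show ?thesis using bd[OF h0] E \<Psi>0 by (simp add: NX ennreal_mult mult.assoc)
  next
    case False
    then have inf: "Linf_norm_functional \<Omega> X = \<infinity>" by (simp add: less_top[symmetric])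
    show ?thesis
    proof (cases "\<Psi> = 0")
      case False
      then show ?thesis using inf \<Psi>0 by (simp add: ennreal_mult_top)
    next
      case True
      \<comment> \<open>the exceptional case; \<open>H\<close> has no influence on the resulting bound, which is zero\<close>
      have "\<exists>H\<ge>0. (\<forall>s\<in>{a<..<b}. \<bar>\<phi> s\<bar> \<le> H * (\<kappa>0 * E)) \<and>
          (\<forall>r s. a < r \<longrightarrow> r \<le> s \<longrightarrow> s < b \<longrightarrow> \<bar>\<phi> s - \<phi> r\<bar> \<le> H * (E * (N s - N r)))"
      proof (cases "\<kappa>0 = 0")
        case True
        have "\<phi> s = 0" if "s \<in> {a<..<b}" for s
          unfolding \<phi>_def using gs_bd[OF that] True
          by (intro X_null g t(1) that L1_norm_zero) simp
        then show ?thesis by (intro exI[of _ 0]) auto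
      next
        case False
        have "0 < (b - a) ^ 4 / 12" using ab by simp
        then have k0: "\<kappa>1 = 0" "\<kappa>1' = 0"
          using \<open>\<Psi> = 0\<close> False \<kappa> I unfolding \<Psi>
          by (auto simp: min_def add_nonneg_eq_0_iff split: if_splits)
        have c: "\<phi> r = \<phi> s" if "r \<in> {a<..<b}" "s \<in> {a<..<b}" "r \<le> s" for r s
        proof -
          have "AE x in lebesgue_on \<Omega>. g (T - r) x - g (T - s) x = 0"
            using diff_bd[of r s] that by (intro L1_norm_zero) (simp add: N_def k0)
          then have "X (\<lambda>x. g (T - r) x - g (T - s) x) = 0" by (rule X_null[OF diff[OF that(1,2)]])
          then show ?thesis
            by (simp add: \<phi>_def X_diff[OF g[OF t(1)[OF that(1)]] g[OF t(1)[OF that(2)]]])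
        qed
        \<comment> \<open>any point of the interval serves, as \<open>\<phi>\<close> is constant\<close>
        define m where "m = (a + b) / 2"
        have m: "m \<in> {a<..<b}" using ab by (simp add: m_def)
        have cm: "\<phi> s = \<phi> m" if "s \<in> {a<..<b}" for s
          using c[OF that m] c[OF m that] by linarith
        have pos: "0 < \<kappa>0 * E" using False \<kappa> E by simp
        have "\<bar>\<phi> s\<bar> \<le> \<bar>\<phi> m\<bar> / (\<kappa>0 * E) * (\<kappa>0 * E)" if "s \<in> {a<..<b}" for s
          unfolding cm[OF that] using False E by simp
        moreover have "\<bar>\<phi> s - \<phi> r\<bar> \<le> \<bar>\<phi> m\<bar> / (\<kappa>0 * E) * (E * (N s - N r))" if "a < r" "r \<le> s" "s < b" for r s
          using c[of r s] that by (simp add: N_def k0)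
        moreover have "0 \<le> \<bar>\<phi> m\<bar> / (\<kappa>0 * E)" using pos by simp
        ultimately show ?thesis by blast
      qed
      then obtain H where "0 \<le> H" "\<And>s. s \<in> {a<..<b} \<Longrightarrow> \<bar>\<phi> s\<bar> \<le> H * (\<kappa>0 * E)"
        "\<And>r s. a < r \<Longrightarrow> r \<le> s \<Longrightarrow> s < b \<Longrightarrow> \<bar>\<phi> s - \<phi> r\<bar> \<le> H * (E * (N s - N r))"
        by blast
      from key[OF this] show ?thesis using True by simp
    qed
  qed
  then show ?thesis
  proof
    assume "ennreal \<Psi> * Linf_norm_functional \<Omega> X = \<infinity>"
    then show ?thesis by (simp add: ennreal_mult_top)
  next
    assume *: "integrable (lebesgue_on {a<..<b}) (\<lambda>s. dcubic a b s * \<phi> s) \<and>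
      ennreal \<bar>LINT s|lebesgue_on {a<..<b}. dcubic a b s * \<phi> s\<bar> \<le> ennreal E * (ennreal \<Psi> * Linf_norm_functional \<Omega> X)"
    \<comment> \<open>measurability of the data term is inherited from \<open>R\<close>; the norm of \<open>F s\<close> need not be measurable in \<open>s\<close>\<close>
    define FF where "FF s = R s - dcubic a b s * \<phi> s" for s
    have FF: "integrable (lebesgue_on {a<..<b}) FF" unfolding FF_def using R * by auto
    have FFm[measurable]: "FF \<in> borel_measurable (lebesgue_on {a<..<b})" using FF by auto
    have ae: "AE s in lebesgue_on {a<..<b}. ennreal \<bar>FF s\<bar> \<le> Linf_norm \<Omega> (F s) * ennreal (\<kappa>0 * E)"
      using R(2) AE_space
    proof eventually_elim
      case (elim s)
      then have s: "s \<in> {a<..<b}" by simp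
      have "FF s = ip \<Omega> (F s) (g (T - s))" using elim by (simp add: FF_def \<phi>_def)
      then have "ennreal \<bar>FF s\<bar> \<le> Linf_norm \<Omega> (F s) * L1_norm \<Omega> (g (T - s))"
        using ip_le_Linf_L1[OF borel_measurable_integrable[OF gint[OF t(1)[OF s]]], of "F s"] by simp
      also have "\<dots> \<le> Linf_norm \<Omega> (F s) * ennreal (\<kappa>0 * E)" using gs_bd[OF s] by (rule mult_left_mono) simp
      finally show ?case .
    qed
    have "ennreal \<bar>LINT s|lebesgue_on {a<..<b}. FF s\<bar> \<le> (\<integral>\<^sup>+ s. ennreal \<bar>FF s\<bar> \<partial>lebesgue_on {a<..<b})"
      using integral_norm_bound_ennreal[OF FF] by simp
    also have "\<dots> \<le> ennreal (\<kappa>0 * E) * (\<integral>\<^sup>+ s. Linf_norm \<Omega> (F s) \<partial>lebesgue_on {a<..<b})"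
    proof (cases "\<kappa>0 = 0")
      case True
      have "(\<integral>\<^sup>+ s. ennreal \<bar>FF s\<bar> \<partial>lebesgue_on {a<..<b}) \<le> (\<integral>\<^sup>+ s. 0 \<partial>lebesgue_on {a<..<b})"
        using ae True by (intro nn_integral_mono_AE) simp
      then show ?thesis by simp
    next
      case False
      then have c: "0 < \<kappa>0 * E" using \<kappa> E by simp
      have "(\<integral>\<^sup>+ s. ennreal \<bar>FF s\<bar> \<partial>lebesgue_on {a<..<b}) =
          (\<integral>\<^sup>+ s. ennreal (\<kappa>0 * E) * ennreal (\<bar>FF s\<bar> / (\<kappa>0 * E)) \<partial>lebesgue_on {a<..<b})"
        using ennreal_mult_divide_cancel[OF c] by simp
      also have "\<dots> = ennreal (\<kappa>0 * E) * (\<integral>\<^sup>+ s. ennreal (\<bar>FF s\<bar> / (\<kappa>0 * E)) \<partial>lebesgue_on {a<..<b})"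
        by (rule nn_integral_cmult) measurable
      also have "\<dots> \<le> ennreal (\<kappa>0 * E) * (\<integral>\<^sup>+ s. Linf_norm \<Omega> (F s) \<partial>lebesgue_on {a<..<b})"
      proof (intro mult_left_mono nn_integral_mono_AE)
        show "AE s in lebesgue_on {a<..<b}. ennreal (\<bar>FF s\<bar> / (\<kappa>0 * E)) \<le> Linf_norm \<Omega> (F s)"
          using ae
        proof eventually_elim
          case (elim s)
          show ?case
          proof (cases "Linf_norm \<Omega> (F s)")
            case (real z)
            then have "\<bar>FF s\<bar> \<le> z * (\<kappa>0 * E)"
              using elim c by (simp add: ennreal_mult[symmetric])
            then show ?thesis using real c by (simp add: pos_divide_le_eq ennreal_leI)
          qed simp
        qed
      qed simp
      finally show ?thesis .
    qed
    finally have FF_le: "ennreal \<bar>LINT s|lebesgue_on {a<..<b}. FF s\<bar> \<le>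
        ennreal (\<kappa>0 * E) * (\<integral>\<^sup>+ s. Linf_norm \<Omega> (F s) \<partial>lebesgue_on {a<..<b})" .
    have "(LINT s|lebesgue_on {a<..<b}. R s) = (LINT s|lebesgue_on {a<..<b}. FF s) + (LINT s|lebesgue_on {a<..<b}. dcubic a b s * \<phi> s)"
      using FF * by (subst Bochner_Integration.integral_add[symmetric]) (auto simp: FF_def)
    then have "\<bar>LINT s|lebesgue_on {a<..<b}. R s\<bar> \<le> \<bar>LINT s|lebesgue_on {a<..<b}. FF s\<bar>
        + \<bar>LINT s|lebesgue_on {a<..<b}. dcubic a b s * \<phi> s\<bar>" by linarith
    then have "ennreal \<bar>LINT s|lebesgue_on {a<..<b}. R s\<bar> \<le> ennreal (\<bar>LINT s|lebesgue_on {a<..<b}. FF s\<bar>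
        + \<bar>LINT s|lebesgue_on {a<..<b}. dcubic a b s * \<phi> s\<bar>)"
      by (rule ennreal_leI)
    also have "\<dots> = ennreal \<bar>LINT s|lebesgue_on {a<..<b}. FF s\<bar>
        + ennreal \<bar>LINT s|lebesgue_on {a<..<b}. dcubic a b s * \<phi> s\<bar>" by simp
    also have "\<dots> \<le> ennreal (\<kappa>0 * E) * (\<integral>\<^sup>+ s. Linf_norm \<Omega> (F s) \<partial>lebesgue_on {a<..<b})
        + ennreal E * (ennreal \<Psi> * Linf_norm_functional \<Omega> X)"
      using FF_le * by (intro add_mono) auto
    also have "\<dots> = ennreal E * (ennreal \<kappa>0 * (\<integral>\<^sup>+ s. Linf_norm \<Omega> (F s) \<partial>lebesgue_on {a<..<b})
        + ennreal \<Psi> * Linf_norm_functional \<Omega> X)"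
      using \<kappa> E by (simp add: ennreal_mult distrib_left mult_ac)
    finally show ?thesis unfolding E_def .
  qed
qed

section \<open>Continuous piecewise polynomials\<close>

lemma mesh_less:
  assumes "mesh T M t" "i < j" "j \<le> M"
  shows "t i < t j"
  using assms(2,3)
proof (induction j)
  case (Suc j)
  have "t j < t (Suc j)" using assms(1) Suc.prems by (simp add: mesh_def)
  then show ?case using Suc by (cases "i = j") auto
qed simp

lemma mesh_le: "mesh T M t \<Longrightarrow> i \<le> j \<Longrightarrow> j \<le> M \<Longrightarrow> t i \<le> t j"
  using mesh_less[of T M t i j] by (cases "i = j") auto

lemma mesh_interval:
  assumes "mesh T M t" "j \<in> {1..M}"
  shows "0 \<le> t (j - 1)" "t (j - 1) < t j" "t j \<le> T"
  using mesh_le[OF assms(1), of 0 "j - 1"] mesh_less[OF assms(1), of "j - 1" j] mesh_le[OF assms(1), of j M] assms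
  by (auto simp: mesh_def)

text \<open>
  The piece \<open>p j\<close> belongs to the interval from \<open>t (j - 1)\<close> to \<open>t j\<close>.  The least \<open>j\<close> with \<open>s \<le> t j\<close> is \<open>0\<close> at
  the left end of the mesh, where the first piece has to be used; hence the maximum.
\<close>

definition piecewise_poly :: "(nat \<Rightarrow> real) \<Rightarrow> (nat \<Rightarrow> real poly) \<Rightarrow> real \<Rightarrow> real" where
  "piecewise_poly t p s = poly (p (max 1 (LEAST j. s \<le> t j))) s"

context
  fixes t :: "nat \<Rightarrow> real" and M :: nat and T :: real and p :: "nat \<Rightarrow> real poly"
  assumes mesh: "mesh T M t"
    and match: "\<And>j. 1 \<le> j \<Longrightarrow> j < M \<Longrightarrow> poly (p j) (t j) = poly (p (Suc j)) (t j)"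
begin

lemma piecewise_poly_eq:
  assumes j: "j \<in> {1..M}" and s: "s \<in> {t (j - 1)..t j}"
  shows "piecewise_poly t p s = poly (p j) s"
proof -
  have L: "(LEAST i. s \<le> t i) = i" if "s \<le> t i" "i \<le> M" "\<And>k. k < i \<Longrightarrow> t k < s" for i
    using that by (intro Least_equality) (auto simp: not_less[symmetric])
  show ?thesis
  proof (cases "s = t (j - 1)")
    case True
    have "(LEAST i. s \<le> t i) = j - 1"
      using True j mesh_less[OF mesh] by (intro L) auto
    then have g: "piecewise_poly t p s = poly (p (max 1 (j - 1))) s" by (simp add: piecewise_poly_def)
    show ?thesis
    proof (cases "j = 1")
      case False
      then have "1 \<le> j - 1" "j - 1 < M" "Suc (j - 1) = j" using j by auto
      then show ?thesis using g match[of "j - 1"] True by (simp add: max_def)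
    qed (use g in simp)
  next
    case False
    have "(LEAST i. s \<le> t i) = j"
    proof (rule L)
      fix k assume "k < j"
      then have "t k \<le> t (j - 1)" using mesh_le[OF mesh, of k "j - 1"] j by auto
      then show "t k < s" using False s by auto
    qed (use s j in auto)
    then show ?thesis using j by (simp add: piecewise_poly_def max_def)
  qed
qed

lemma cont_pw_poly_piecewise_poly: "cont_pw_poly M t (piecewise_poly t p)"
proof -
  have "continuous_on {t 0..t m} (piecewise_poly t p)" if "m \<le> M" for m
    using that
  proof (induction m)
    case (Suc m)
    have "continuous_on {t m..t (Suc m)} (\<lambda>s. poly (p (Suc m)) s)" by (intro continuous_intros)
    then have 1: "continuous_on {t m..t (Suc m)} (piecewise_poly t p)"
      using piecewise_poly_eq[of "Suc m"] Suc.prems by (subst continuous_on_cong[OF refl]) auto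
    have "{t 0..t (Suc m)} = {t 0..t m} \<union> {t m..t (Suc m)}"
      using mesh_le[OF mesh, of 0 m] mesh_le[OF mesh, of m "Suc m"] Suc.prems by auto
    then show ?case using Suc 1 by (auto intro!: continuous_on_closed_Un)
  qed simp
  then show ?thesis
    unfolding cont_pw_poly_def using piecewise_poly_eq by blast
qed

lemma deriv_piecewise_poly:
  assumes j: "j \<in> {1..M}" and s: "s \<in> {t (j - 1)<..<t j}"
  shows "deriv (piecewise_poly t p) s = poly (pderiv (p j)) s"
proof (rule DERIV_imp_deriv, rule has_field_derivative_transform_within_open[where S="{t (j - 1)<..<t j}"])
  show "((\<lambda>s. poly (p j) s) has_real_derivative poly (pderiv (p j)) s) (at s)" by (rule poly_DERIV)
qed (use piecewise_poly_eq[OF j] s in auto)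

end

section \<open>The quadratic reconstruction\<close>

definition unit_map :: "(nat \<Rightarrow> real) \<Rightarrow> nat \<Rightarrow> real poly" where
  "unit_map t j = [: - t (j - 1) / tau t j, 1 / tau t j :]"

text \<open>
  The quadratic Lagrange polynomials for the nodes \<open>0\<close>, \<open>1/3\<close>, \<open>1\<close> of the unit interval, transplanted to
  the \<open>j\<close>-th interval.  As a function of time, the coefficient of \<open>U i\<close> is supported in the two intervals
  meeting at \<open>t i\<close>, and that of \<open>V i\<close> in the \<open>i\<close>-th one.
\<close>

definition node_poly :: "(nat \<Rightarrow> real) \<Rightarrow> nat \<Rightarrow> nat \<Rightarrow> real poly" where
  "node_poly t i j = (if i = j then [:0, -1/2, 3/2:] else if Suc i = j then [:1, -4, 3:] else 0) \<circ>\<^sub>p unit_map t j"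

definition mid_poly :: "(nat \<Rightarrow> real) \<Rightarrow> nat \<Rightarrow> nat \<Rightarrow> real poly" where
  "mid_poly t i j = (if i = j then [:0, 9/2, -9/2:] else 0) \<circ>\<^sub>p unit_map t j"

lemma poly_unit_map: "poly (unit_map t j) s = (s - t (j - 1)) / tau t j"
  by (simp add: unit_map_def diff_divide_distrib)

lemma nodal_comb_local:
  assumes j: "j \<in> {1..M}"
  shows "nodal_comb M U V (\<lambda>i. if i = j then A else if Suc i = j then B else 0) (\<lambda>i. if i = j then C else 0)
    = (\<lambda>x. A * U j x + B * U (j - 1) x + C * V j x)"
proof
  fix x
  have eq: "(if i = j then A else if Suc i = j then B else 0) * U i x =
      (if i = j then A * U i x else 0) + (if i = j - 1 then B * U i x else 0)" for i
    using j by auto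
  have "(\<Sum>i = 0..M. (if i = j then A else if Suc i = j then B else 0) * U i x) = A * U j x + B * U (j - 1) x"
    unfolding eq sum.distrib using j by (auto simp: sum.delta)
  moreover have "(\<Sum>i = 1..M. (if i = j then C else 0) * V i x) = C * V j x"
    using j by (simp add: if_distrib[where f="\<lambda>c. c * _"] cong: if_cong)
  ultimately show "nodal_comb M U V (\<lambda>i. if i = j then A else if Suc i = j then B else 0) (\<lambda>i. if i = j then C else 0) x
    = A * U j x + B * U (j - 1) x + C * V j x"
    by (simp add: nodal_comb_def)
qed

definition shape_right :: "real \<Rightarrow> real" where "shape_right \<sigma> = (3 * \<sigma>\<^sup>2 - \<sigma>) / 2"
definition shape_left :: "real \<Rightarrow> real" where "shape_left \<sigma> = 3 * \<sigma>\<^sup>2 - 4 * \<sigma> + 1"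
definition shape_mid :: "real \<Rightarrow> real" where "shape_mid \<sigma> = 9 * (\<sigma> - \<sigma>\<^sup>2) / 2"

lemma breve_eq:
  "breve t f j s = (\<lambda>x. shape_right ((s - t (j - 1)) / tau t j) * f (t j) x + shape_left ((s - t (j - 1)) / tau t j) * f (t (j - 1)) x
      + shape_mid ((s - t (j - 1)) / tau t j) * f (tmid t j) x)"
  if "tau t j \<noteq> 0"
proof
  fix x
  define \<sigma> where "\<sigma> = (s - t (j - 1)) / tau t j"
  have e: "(t j - s) / tau t j = 1 - \<sigma>" using that by (simp add: \<sigma>_def tau_def field_simps)
  show "breve t f j s x = shape_right ((s - t (j - 1)) / tau t j) * f (t j) x + shape_left ((s - t (j - 1)) / tau t j) * f (t (j - 1)) x
      + shape_mid ((s - t (j - 1)) / tau t j) * f (tmid t j) x"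
    unfolding breve_def \<sigma>_def[symmetric] e zeta_def shape_right_def shape_left_def shape_mid_def
    by (simp add: power2_eq_square field_simps)
qed

lemma poly_shapes:
  "poly [:0, -1/2, 3/2:] z = shape_right z" "poly [:1, -4, 3:] z = shape_left z" "poly [:0, 9/2, -9/2:] z = shape_mid z"
  "poly (pderiv [:0, -1/2, 3/2:]) z = (6 * z - 1) / 2" "poly (pderiv [:1, -4, 3:]) z = 6 * z - 4"
  "poly (pderiv [:0, 9/2, -9/2:]) z = 9 * (1 - 2 * z) / 2"
  by (simp_all add: shape_right_def shape_left_def shape_mid_def pderiv_pCons power2_eq_square field_simps)

lemma shape_functions:
  assumes mesh: "mesh T M t" and j: "j \<in> {1..M}"
  defines "\<sigma> s \<equiv> (s - t (j - 1)) / tau t j"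
  shows "s \<in> {t (j - 1)..t j} \<Longrightarrow> piecewise_poly t (node_poly t i) s = (if i = j then shape_right (\<sigma> s) else if Suc i = j then shape_left (\<sigma> s) else 0)"
    and "s \<in> {t (j - 1)<..<t j} \<Longrightarrow> deriv (piecewise_poly t (node_poly t i)) s =
        (if i = j then (6 * \<sigma> s - 1) / (2 * tau t j) else if Suc i = j then (6 * \<sigma> s - 4) / tau t j else 0)"
    and "cont_pw_poly M t (piecewise_poly t (node_poly t i))"
    and "s \<in> {t (j - 1)..t j} \<Longrightarrow> piecewise_poly t (mid_poly t i) s = (if i = j then shape_mid (\<sigma> s) else 0)"
    and "s \<in> {t (j - 1)<..<t j} \<Longrightarrow> deriv (piecewise_poly t (mid_poly t i)) s = (if i = j then 9 * (1 - 2 * \<sigma> s) / (2 * tau t j) else 0)"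
    and "cont_pw_poly M t (piecewise_poly t (mid_poly t i))"
proof -
  have unit: "poly (unit_map t k) (t k) = 1" "poly (unit_map t (Suc k)) (t k) = 0" if "1 \<le> k" "k < M" for k
    using mesh_interval[OF mesh, of k] that by (auto simp: poly_unit_map tau_def)
  have m1: "poly (node_poly t i k) (t k) = poly (node_poly t i (Suc k)) (t k)" if "1 \<le> k" "k < M" for k
    using unit[OF that] by (simp add: node_poly_def poly_pcompose)
  have m2: "poly (mid_poly t i k) (t k) = poly (mid_poly t i (Suc k)) (t k)" if "1 \<le> k" "k < M" for k
    using unit[OF that] by (simp add: mid_poly_def poly_pcompose)
  have du: "poly (pderiv (unit_map t j)) s = 1 / tau t j" for s by (simp add: unit_map_def pderiv_pCons)
  have \<sigma>: "poly (unit_map t j) s = \<sigma> s" for s by (simp add: poly_unit_map \<sigma>_def)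
  have n: "s \<in> {t (j - 1)..t j} \<Longrightarrow> piecewise_poly t (node_poly t i) s = poly (node_poly t i j) s"
    "s \<in> {t (j - 1)<..<t j} \<Longrightarrow> deriv (piecewise_poly t (node_poly t i)) s = poly (pderiv (node_poly t i j)) s"
    by (auto intro!: piecewise_poly_eq[OF mesh _ j] deriv_piecewise_poly[OF mesh _ j] m1)
  have m: "s \<in> {t (j - 1)..t j} \<Longrightarrow> piecewise_poly t (mid_poly t i) s = poly (mid_poly t i j) s"
    "s \<in> {t (j - 1)<..<t j} \<Longrightarrow> deriv (piecewise_poly t (mid_poly t i)) s = poly (pderiv (mid_poly t i j)) s"
    by (auto intro!: piecewise_poly_eq[OF mesh _ j] deriv_piecewise_poly[OF mesh _ j] m2)
  show "piecewise_poly t (node_poly t i) s = (if i = j then shape_right (\<sigma> s) else if Suc i = j then shape_left (\<sigma> s) else 0)"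
    if "s \<in> {t (j - 1)..t j}"
    unfolding n(1)[OF that]
    unfolding node_poly_def poly_pcompose \<sigma> by (simp only: poly_shapes poly_0 split: if_split) simp
  show "deriv (piecewise_poly t (node_poly t i)) s =
        (if i = j then (6 * \<sigma> s - 1) / (2 * tau t j) else if Suc i = j then (6 * \<sigma> s - 4) / tau t j else 0)"
    if "s \<in> {t (j - 1)<..<t j}"
    unfolding n(2)[OF that]
    unfolding node_poly_def pderiv_pcompose poly_mult poly_pcompose \<sigma> du
    by (simp only: poly_shapes poly_0 pderiv_0 split: if_split) simp
  show "cont_pw_poly M t (piecewise_poly t (node_poly t i))" by (rule cont_pw_poly_piecewise_poly[OF mesh m1])
  show "piecewise_poly t (mid_poly t i) s = (if i = j then shape_mid (\<sigma> s) else 0)" if "s \<in> {t (j - 1)..t j}"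
    unfolding m(1)[OF that]
    unfolding mid_poly_def poly_pcompose \<sigma> by (simp only: poly_shapes poly_0 split: if_split) simp
  show "deriv (piecewise_poly t (mid_poly t i)) s = (if i = j then 9 * (1 - 2 * \<sigma> s) / (2 * tau t j) else 0)"
    if "s \<in> {t (j - 1)<..<t j}"
    unfolding m(2)[OF that]
    unfolding mid_poly_def pderiv_pcompose poly_mult poly_pcompose \<sigma> du
    by (simp only: poly_shapes poly_0 pderiv_0 split: if_split) simp
  show "cont_pw_poly M t (piecewise_poly t (mid_poly t i))" by (rule cont_pw_poly_piecewise_poly[OF mesh m2])
qed

text \<open>
  The heart of the matter, tested with a fixed function: \<open>u\<close>, \<open>f\<close> and \<open>l\<close> stand for the pairings of the
  discrete solution, of the right-hand side and of \<open>\<L>\<close> applied to the discrete solution; \<open>0\<close>, \<open>m\<close> and \<open>j\<close>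
  mark the three nodes.  Eliminating \<open>um\<close> and \<open>uj\<close> by the equations of the scheme shows that the
  derivative of the reconstruction is the linear interpolant of \<open>f - l\<close> in the last two nodes.
\<close>

lemma dG1_residual_algebra:
  fixes \<tau> \<sigma> uj um u0 fj fm f0 lj lm l0 :: real
  assumes \<tau>: "\<tau> \<noteq> 0"
    and 1: "um - u0 + \<tau> / 12 * (5 * lm - lj) = \<tau> / 12 * (5 * fm - fj)"
    and 2: "uj - u0 + \<tau> / 4 * (3 * lm + lj) = \<tau> / 4 * (3 * fm + fj)"
  shows "- ((6 * \<sigma> - 1) / (2 * \<tau>) * uj + (6 * \<sigma> - 4) / \<tau> * u0 + 9 * (1 - 2 * \<sigma>) / (2 * \<tau>) * um)
      - (shape_right \<sigma> * lj + shape_left \<sigma> * l0 + shape_mid \<sigma> * lm)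
    = - (shape_right \<sigma> * fj + shape_left \<sigma> * f0 + shape_mid \<sigma> * fm)
      + \<tau>\<^sup>2 * shape_left \<sigma> * (((fj - lj) - 3 * (fm - lm) + 2 * (f0 - l0)) / (2 * \<tau>\<^sup>2))"
proof -
  have um: "um = u0 + \<tau> / 12 * (5 * (fm - lm) - (fj - lj))" using 1 by (simp add: field_simps)
  have uj: "uj = u0 + \<tau> / 4 * (3 * (fm - lm) + (fj - lj))" using 2 by (simp add: field_simps)
  have d: "(6 * \<sigma> - 1) / (2 * \<tau>) * uj + (6 * \<sigma> - 4) / \<tau> * u0 + 9 * (1 - 2 * \<sigma>) / (2 * \<tau>) * um =
      (6 * \<sigma> - 1) / 8 * (3 * (fm - lm) + (fj - lj)) + 9 * (1 - 2 * \<sigma>) / 24 * (5 * (fm - lm) - (fj - lj))"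
    unfolding um uj using \<tau> by (simp add: field_simps)
  have c: "\<tau>\<^sup>2 * shape_left \<sigma> * (((fj - lj) - 3 * (fm - lm) + 2 * (f0 - l0)) / (2 * \<tau>\<^sup>2)) =
      shape_left \<sigma> * ((fj - lj) - 3 * (fm - lm) + 2 * (f0 - l0)) / 2"
    using \<tau> by simp
  show ?thesis unfolding d c unfolding shape_right_def shape_left_def shape_mid_def by (simp add: field_simps)
qed

lemma integral_mesh_sum:
  fixes R :: "real \<Rightarrow> real"
  assumes mesh: "mesh T M t" and R: "integrable (lebesgue_on {0<..<T}) R"
  shows "(LINT s|lebesgue_on {0<..<T}. R s) = (\<Sum>j = 1..M. LINT s|lebesgue_on {t (j - 1)<..<t j}. R s)"
    and "j \<in> {1..M} \<Longrightarrow> integrable (lebesgue_on {t (j - 1)<..<t j}) R"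
proof -
  have sub: "integrable (lebesgue_on {t (j - 1)<..<t j}) R" if "j \<in> {1..M}" for j
  proof -
    have "set_integrable lebesgue {0<..<T} R"
      unfolding set_integrable_def by (rule integrable_restrict_space[THEN iffD1, OF _ R]) simp
    then have "set_integrable lebesgue {t (j - 1)<..<t j} R"
      using mesh_interval[OF mesh that] by (rule_tac set_integrable_subset) auto
    then show ?thesis unfolding set_integrable_def by (subst integrable_restrict_space) auto
  qed
  show "j \<in> {1..M} \<Longrightarrow> integrable (lebesgue_on {t (j - 1)<..<t j}) R" by (rule sub)
  have i: "R integrable_on {0..T}"
    using integrable_on_lebesgue_on[OF R] integrable_on_open_interval_real[of R 0 T] by simp
  have "integral {0..t m} R = (\<Sum>j = 1..m. integral {t (j - 1)..t j} R)" if "m \<le> M" for m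
    using that
  proof (induction m)
    case 0
    then show ?case using mesh by (simp add: mesh_def)
  next
    case (Suc m)
    have "t (Suc m) \<le> T" "0 \<le> t m" "t m \<le> t (Suc m)"
      using mesh_interval[OF mesh, of "Suc m"] Suc.prems by auto
    then have "integral {0..t (Suc m)} R = integral {0..t m} R + integral {t m..t (Suc m)} R"
      by (intro Henstock_Kurzweil_Integration.integral_combine[symmetric] integrable_on_subinterval[OF i]) auto
    then show ?case using Suc by simp
  qed
  from this[of M] have "integral {0..T} R = (\<Sum>j = 1..M. integral {t (j - 1)..t j} R)"
    using mesh by (simp add: mesh_def)
  then show "(LINT s|lebesgue_on {0<..<T}. R s) = (\<Sum>j = 1..M. LINT s|lebesgue_on {t (j - 1)<..<t j}. R s)"
    using lebesgue_integral_eq_integral[OF R] lebesgue_integral_eq_integral[OF sub]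
    by (simp add: integral_open_interval_real)
qed

section \<open>The residual of the reconstruction\<close>

lemma mesh_nodes_in_interval:
  assumes "mesh T M t" "j \<in> {1..M}"
  shows "t j \<in> {0..T}" "t (j - 1) \<in> {0..T}" "tmid t j \<in> {0..T}"
proof -
  have "tmid t j = (t j + 2 * t (j - 1)) / 3" by (simp add: tmid_def tau_def field_simps)
  then show "t j \<in> {0..T}" "t (j - 1) \<in> {0..T}" "tmid t j \<in> {0..T}"
    using mesh_interval[OF assms] by auto
qed

lemma ip_lincomb3:
  assumes "u \<in> L2 \<Omega>" "v \<in> L2 \<Omega>" "w \<in> L2 \<Omega>" "z \<in> L2 \<Omega>"
  shows "ip \<Omega> (\<lambda>x. a * u x + b * v x + c * w x) z = a * ip \<Omega> u z + b * ip \<Omega> v z + c * ip \<Omega> w z"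
    and "(\<lambda>x. a * u x + b * v x + c * w x) \<in> L2 \<Omega>"
  using ip_lincomb_left[OF L2_real_lincomb[OF assms(1,2)] assms(3,4), of 1 a b c] ip_lincomb_left[OF assms(1,2,4)]
    L2_real_lincomb[OF L2_real_lincomb[OF assms(1,2)] assms(3), of 1 a b c] by simp_all

lemma ip_diff_left:
  assumes "u \<in> L2 \<Omega>" "v \<in> L2 \<Omega>" "z \<in> L2 \<Omega>"
  shows "ip \<Omega> (\<lambda>x. u x - v x) z = ip \<Omega> u z - ip \<Omega> v z"
  using ip_lincomb_left[OF assms, of 1 "-1"] by simp

context
  fixes \<Omega> :: "(real ^ 'n::finite) set" and L :: "'n fld \<Rightarrow> 'n functional"
  assumes opn: "open \<Omega>" and ell: "elliptic_operator \<Omega> L"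
begin

lemma elliptic_diff_left:
  assumes "u \<in> H01 \<Omega>" "v \<in> H01 \<Omega>" "z \<in> H01 \<Omega>"
  shows "L (\<lambda>x. u x - v x) z = L u z - L v z"
  using elliptic_lincomb_left[OF opn ell assms, of 1 "-1"] by simp

lemma elliptic_lincomb3:
  assumes "u \<in> H01 \<Omega>" "v \<in> H01 \<Omega>" "w \<in> H01 \<Omega>" "z \<in> H01 \<Omega>"
  shows "L (\<lambda>x. a * u x + b * v x + c * w x) z = a * L u z + b * L v z + c * L w z"
  using elliptic_lincomb_left[OF opn ell H01_lincomb[OF opn assms(1,2)] assms(3,4), of 1 a b c]
    elliptic_lincomb_left[OF opn ell assms(1,2,4)] by simp

text \<open>
  \<open>\<K>(u - W) = (f - breve f) + q' \<chi>\<^sup>j\<close>: the derivative of the cubic is \<open>\<tau>\<^sup>2\<close> times the polynomial \<open>\<zeta>\<close> of the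
  interpolation formula, which is also the shape function of the left node.
\<close>

lemma residual_identity:
  assumes mesh: "mesh T M t" and dG: "dG1 \<Omega> L f u0 M t U V"
    and f: "\<And>s. s \<in> {0..T} \<Longrightarrow> f s \<in> L2 \<Omega>"
    and j: "j \<in> {1..M}" and s: "s \<in> {t (j - 1)<..<t j}" and v: "v \<in> H01 \<Omega>" and us: "u s \<in> H01 \<Omega>"
    and par: "parabolic_op L u u' s v = ip \<Omega> (f s) v"
  shows "parabolic_op L
      (\<lambda>s x. u s x - nodal_comb M U V (\<lambda>i. piecewise_poly t (node_poly t i) s) (\<lambda>i. piecewise_poly t (mid_poly t i) s) x)
      (\<lambda>s v. u' s v - ip \<Omega> (nodal_comb M U V (\<lambda>i. deriv (piecewise_poly t (node_poly t i)) s) (\<lambda>i. deriv (piecewise_poly t (mid_poly t i)) s)) v) s v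
    = ip \<Omega> (\<lambda>x. f s x - breve t f j s x) v + dcubic (t (j - 1)) (t j) s * chi \<Omega> L f t U V j v"
proof -
  define \<tau> where "\<tau> = tau t j"
  define \<sigma> where "\<sigma> = (s - t (j - 1)) / \<tau>"
  note int = mesh_interval[OF mesh j]
  have \<tau>: "\<tau> \<noteq> 0" "0 < \<tau>" using int by (auto simp: \<tau>_def tau_def)
  have s': "s \<in> {t (j - 1)..t j}" using s by auto
  have UV: "U j \<in> H01 \<Omega>" "U (j - 1) \<in> H01 \<Omega>" "V j \<in> H01 \<Omega>"
    using dG j by (auto simp: dG1_def)
  note UV2 = UV[THEN H01_L2[OF opn]]
  note ts = mesh_nodes_in_interval[OF mesh j]
  have sT: "s \<in> {0..T}" using int s by auto
  note f2 = f[OF ts(1)] f[OF ts(2)] f[OF ts(3)]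
  note v2 = H01_L2[OF opn v]
  have W: "nodal_comb M U V (\<lambda>i. piecewise_poly t (node_poly t i) s) (\<lambda>i. piecewise_poly t (mid_poly t i) s)
     = (\<lambda>x. shape_right \<sigma> * U j x + shape_left \<sigma> * U (j - 1) x + shape_mid \<sigma> * V j x)"
    unfolding shape_functions(1)[OF mesh j s'] shape_functions(4)[OF mesh j s'] \<sigma>_def \<tau>_def by (rule nodal_comb_local[OF j])
  have W': "nodal_comb M U V (\<lambda>i. deriv (piecewise_poly t (node_poly t i)) s) (\<lambda>i. deriv (piecewise_poly t (mid_poly t i)) s)
     = (\<lambda>x. (6 * \<sigma> - 1) / (2 * \<tau>) * U j x + (6 * \<sigma> - 4) / \<tau> * U (j - 1) x + 9 * (1 - 2 * \<sigma>) / (2 * \<tau>) * V j x)"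
    unfolding shape_functions(2)[OF mesh j s] shape_functions(5)[OF mesh j s] \<sigma>_def \<tau>_def by (rule nodal_comb_local[OF j])
  have br: "breve t f j s = (\<lambda>x. shape_right \<sigma> * f (t j) x + shape_left \<sigma> * f (t (j - 1)) x + shape_mid \<sigma> * f (tmid t j) x)"
    unfolding \<sigma>_def \<tau>_def by (rule breve_eq) (use \<tau> in \<open>simp add: \<tau>_def\<close>)
  have LW: "L (\<lambda>x. u s x - (shape_right \<sigma> * U j x + shape_left \<sigma> * U (j - 1) x + shape_mid \<sigma> * V j x)) v
     = L (u s) v - (shape_right \<sigma> * L (U j) v + shape_left \<sigma> * L (U (j - 1)) v + shape_mid \<sigma> * L (V j) v)"
    by (simp only: elliptic_diff_left[OF us H01_lincomb3[OF opn UV] v] elliptic_lincomb3[OF UV v])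
  have eqs: "ip \<Omega> (V j) v - ip \<Omega> (U (j - 1)) v + \<tau> / 12 * (5 * L (V j) v - L (U j) v)
          = \<tau> / 12 * (5 * ip \<Omega> (f (tmid t j)) v - ip \<Omega> (f (t j)) v)"
     "ip \<Omega> (U j) v - ip \<Omega> (U (j - 1)) v + \<tau> / 4 * (3 * L (V j) v + L (U j) v)
          = \<tau> / 4 * (3 * ip \<Omega> (f (tmid t j)) v + ip \<Omega> (f (t j)) v)"
    unfolding ip_diff_left[OF UV2(3,2) v2, symmetric] ip_diff_left[OF UV2(1,2) v2, symmetric] \<tau>_def
    using dG[unfolded dG1_def] j v by blast+
  have dc: "dcubic (t (j - 1)) (t j) s = \<tau>\<^sup>2 * shape_left \<sigma>"
  proof -
    have b: "t j = t (j - 1) + \<tau>" and ss: "s = t (j - 1) + \<sigma> * \<tau>" using \<tau> by (auto simp: \<tau>_def tau_def \<sigma>_def)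
    show ?thesis unfolding dcubic_def b shape_left_def by (subst (1 2) ss) (simp add: power2_eq_square algebra_simps)
  qed
  show ?thesis
    unfolding parabolic_op_def W W' LW br
      ip_diff_left[OF f[OF sT] ip_lincomb3(2)[OF f2 f2(1)] v2] ip_lincomb3(1)[OF f2 v2] ip_lincomb3(1)[OF UV2 v2]
      dc chi_def residual_def \<tau>_def[symmetric]
    using dG1_residual_algebra[OF \<tau>(1) eqs, of \<sigma> "L (U (j - 1)) v" "ip \<Omega> (f (t (j - 1))) v"] par
    unfolding parabolic_op_def by linarith
qed

lemma chi_diff:
  assumes dG: "dG1 \<Omega> L f u0 M t U V" and j: "j \<in> {1..M}" and f: "f (t j) \<in> L2 \<Omega>" "f (t (j - 1)) \<in> L2 \<Omega>" "f (tmid t j) \<in> L2 \<Omega>"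
    and vw: "v \<in> H01 \<Omega>" "w \<in> H01 \<Omega>"
  shows "chi \<Omega> L f t U V j (\<lambda>x. v x - w x) = chi \<Omega> L f t U V j v - chi \<Omega> L f t U V j w"
proof -
  have UV: "U j \<in> H01 \<Omega>" "U (j - 1) \<in> H01 \<Omega>" "V j \<in> H01 \<Omega>"
    using dG j by (auto simp: dG1_def)
  have r: "residual \<Omega> L g W (\<lambda>x. v x - w x) = residual \<Omega> L g W v - residual \<Omega> L g W w"
    if "g \<in> L2 \<Omega>" "W \<in> H01 \<Omega>" for g W
    using elliptic_lincomb_right[OF opn ell vw that(2), of 1 "-1"] ip_diff_left[OF vw[THEN H01_L2[OF opn]] that(1)]
    by (simp add: residual_def ip_commute[of \<Omega> g])
  show ?thesis
    unfolding chi_def r[OF f(1) UV(1)] r[OF f(2) UV(2)] r[OF f(3) UV(3)]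
    by (simp add: diff_divide_distrib add_divide_distrib algebra_simps)
qed

lemma chi_null:
  assumes dG: "dG1 \<Omega> L f u0 M t U V" and j: "j \<in> {1..M}"
    and v: "v \<in> H01 \<Omega>" "AE x in lebesgue_on \<Omega>. v x = 0"
  shows "chi \<Omega> L f t U V j v = 0"
proof -
  have UV: "U j \<in> H01 \<Omega>" "U (j - 1) \<in> H01 \<Omega>" "V j \<in> H01 \<Omega>"
    using dG j by (auto simp: dG1_def)
  have "ip \<Omega> g v = 0" for g
    unfolding ip_def by (rule integral_eq_zero_AE) (use v(2) in \<open>eventually_elim, simp\<close>)
  then have "residual \<Omega> L g W v = 0" if "W \<in> H01 \<Omega>" for g W
    using elliptic_null_right[OF opn ell that v] by (simp add: residual_def)
  then show ?thesis using UV by (simp add: chi_def)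
qed

end

section \<open>The error bound\<close>

lemma Psi2_eq:
  "Psi2 T t \<kappa> \<kappa>' j = min
     (\<kappa> 1 * integral {t (j - 1)..t j} (\<lambda>s. cubic (t (j - 1)) (t j) s / (T - s)) + \<kappa>' 1 * ((t j - t (j - 1)) ^ 4 / 12))
     (\<kappa> 0 * integral {t (j - 1)..t j} (\<lambda>s. \<bar>dcubic (t (j - 1)) (t j) s\<bar>))"
proof -
  have "deriv (\<lambda>s. (b - s)\<^sup>2 * (s - a)) s = dcubic a b s" for a b s
    using DERIV_imp_deriv[OF cubic_has_derivative[of a b s]] by (simp add: cubic_def[abs_def])
  then show ?thesis by (simp add: Psi2_def Phi2_def Phi2_star_def cubic_def tau_def)
qed

theorem theorem12:
  fixes \<Omega> :: "(real ^ 'n::finite) set"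
    and L :: "'n fld \<Rightarrow> 'n functional"
    and G :: "real ^ 'n \<Rightarrow> real \<Rightarrow> 'n fld"
    and f u :: "real \<Rightarrow> 'n fld"
    and u' :: "real \<Rightarrow> 'n functional"
    and u0 :: "'n fld"
    and U V :: "nat \<Rightarrow> 'n fld"
    and T \<gamma> :: real
    and \<kappa> \<kappa>' t :: "nat \<Rightarrow> real"
    and M :: nat
  assumes "lipschitz_domain \<Omega>"
    and "0 < T"
    and "elliptic_operator \<Omega> L"
    and "\<And>s. s \<in> {0..T} \<Longrightarrow> f s \<in> L2 \<Omega>"
    and "green_function \<Omega> L T G"
    and "\<And>p. p \<le> 2 \<Longrightarrow> 0 \<le> \<kappa> p" and "\<And>p. p \<le> 2 \<Longrightarrow> 0 \<le> \<kappa>' p" and "\<kappa>' 0 = 0" and "0 \<le> \<gamma>"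
    and "green_bounds \<Omega> T G \<kappa> \<kappa>' \<gamma>"
    and "mesh T M t"
    and "dG1 \<Omega> L f u0 M t U V"
    and "parabolic_solution \<Omega> L T f u0 u u'"
    and "regular_solution \<Omega> L T G M t U V u u'"
  shows "Linf_norm \<Omega> (\<lambda>x. u T x - U M x)
      \<le> (\<Sum>j = 1..M. ennreal (exp (- \<gamma> * (T - t j))) *
           (eta_f \<Omega> f t (\<kappa> 0) j + eta_chi \<Omega> L T f t U V \<kappa> \<kappa>' j))"
proof -
  note opn = assms(1)[unfolded lipschitz_domain_def, THEN conjunct1]
  note ell = assms(3) and f = assms(4) and mesh = assms(11) and dG = assms(12)
  have M: "1 \<le> M" using mesh \<open>0 < T\<close> by (cases M) (auto simp: mesh_def)
  have uH: "u s \<in> H01 \<Omega>" if "s \<in> {0..T}" for s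
    using assms(13) that by (simp add: parabolic_solution_def)
  have UM: "U M \<in> H01 \<Omega>" using dG by (simp add: dG1_def)
  define a where "a i = piecewise_poly t (node_poly t i)" for i
  define b where "b i = piecewise_poly t (mid_poly t i)" for i
  define w where "w s x = u s x - nodal_comb M U V (\<lambda>i. a i s) (\<lambda>i. b i s) x" for s x
  define w' where "w' s v = u' s v - ip \<Omega> (nodal_comb M U V (\<lambda>i. deriv (a i) s) (\<lambda>i. deriv (b i) s)) v" for s v
  have "green_representation \<Omega> L T G w w'"
    using assms(14)[unfolded regular_solution_def, rule_format, of a b] shape_functions(3,6)[OF mesh, of 1] M
    by (simp add: w_def[abs_def] w'_def[abs_def] a_def b_def)
  then have rep: "AE x in lebesgue_on \<Omega>.
        integrable (lebesgue_on {0<..<T}) (\<lambda>s. parabolic_op L w w' s (G x (T - s))) \<and>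
        w T x = ip \<Omega> (G x T) (w 0) + (LINT s|lebesgue_on {0<..<T}. parabolic_op L w w' s (G x (T - s)))"
    using \<open>0 < T\<close> unfolding green_representation_def by simp
  have t0: "t 0 = 0" and tM: "t M = T" using mesh by (auto simp: mesh_def)
  have node: "nodal_comb M U V (\<lambda>i. a i s) (\<lambda>i. b i s)
     = (\<lambda>x. shape_right ((s - t (j - 1)) / tau t j) * U j x + shape_left ((s - t (j - 1)) / tau t j) * U (j - 1) x
         + shape_mid ((s - t (j - 1)) / tau t j) * V j x)"
    if "j \<in> {1..M}" "s \<in> {t (j - 1)..t j}" for j s
    unfolding a_def b_def shape_functions(1)[OF mesh that] shape_functions(4)[OF mesh that] by (rule nodal_comb_local[OF that(1)])
  \<comment> \<open>the reconstruction interpolates at both ends of the time interval\<close>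
  have wT: "w T x = u T x - U M x" for x
    using node[of M T] mesh_interval[OF mesh, of M] M tM
    by (simp add: w_def tau_def shape_right_def shape_left_def shape_mid_def)
  have w0: "w 0 x = u 0 x - U 0 x" for x
    using node[of 1 0] mesh_interval[OF mesh, of 1] M t0
    by (simp add: w_def tau_def shape_right_def shape_left_def shape_mid_def)
  have w0_ae: "AE x in lebesgue_on \<Omega>. w 0 x = 0"
  proof -
    have "AE x in lebesgue_on \<Omega>. u 0 x = u0 x" "AE x in lebesgue_on \<Omega>. U 0 x = u0 x"
      using assms(13) dG by (auto simp: parabolic_solution_def dG1_def ae_eq_def)
    then show ?thesis by eventually_elim (simp add: w0)
  qed
  have ip0: "ip \<Omega> h (w 0) = 0" for h
    unfolding ip_def by (rule integral_eq_zero_AE) (use w0_ae in \<open>eventually_elim, simp\<close>)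
  have "AE x in lebesgue_on \<Omega>. ennreal \<bar>u T x - U M x\<bar> \<le> (\<Sum>j = 1..M. ennreal (exp (- \<gamma> * (T - t j))) *
           (eta_f \<Omega> f t (\<kappa> 0) j + eta_chi \<Omega> L T f t U V \<kappa> \<kappa>' j))"
    using rep AE_space
  proof eventually_elim
    case (elim x)
    then have x: "x \<in> \<Omega>" by simp
    define R where "R s = parabolic_op L w w' s (G x (T - s))" for s
    have R: "integrable (lebesgue_on {0<..<T}) R" and eq: "u T x - U M x = (LINT s|lebesgue_on {0<..<T}. R s)"
      using elim by (auto simp: R_def[abs_def] wT ip0)
    have GH: "G x s \<in> H01 \<Omega>" if "0 < s" for s
      using assms(5) x that by (auto simp: green_function_def)
    obtain D where D0: "D 0 = G x"
      and D: "\<And>p s. p < 2 \<Longrightarrow> s \<in> {0<..T} \<Longrightarrow> has_L1_time_derivative \<Omega> (D p) (D (Suc p) s) s"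
        "\<And>p s. p \<le> 2 \<Longrightarrow> s \<in> {0<..T} \<Longrightarrow> L1_norm \<Omega> (D p s) \<le> ennreal ((\<kappa> p / s ^ p + \<kappa>' p) * exp (- \<gamma> * s))"
      using assms(10) x unfolding green_bounds_def by metis
    have bound: "ennreal \<bar>LINT s|lebesgue_on {t (j - 1)<..<t j}. R s\<bar> \<le> ennreal (exp (- \<gamma> * (T - t j))) *
           (eta_f \<Omega> f t (\<kappa> 0) j + eta_chi \<Omega> L T f t U V \<kappa> \<kappa>' j)" if j: "j \<in> {1..M}" for j
    proof -
      note int = mesh_interval[OF mesh j]
      have ts: "f (t j) \<in> L2 \<Omega>" "f (t (j - 1)) \<in> L2 \<Omega>" "f (tmid t j) \<in> L2 \<Omega>"
        using mesh_nodes_in_interval[OF mesh j] by (auto intro: f)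
      have ae: "AE s in lebesgue_on {t (j - 1)<..<t j}.
        R s = ip \<Omega> (\<lambda>x. f s x - breve t f j s x) (G x (T - s)) + dcubic (t (j - 1)) (t j) s * chi \<Omega> L f t U V j (G x (T - s))"
      proof -
        have "AE s in lebesgue_on {0..T}. \<forall>v\<in>H01 \<Omega>. parabolic_op L u u' s v = ip \<Omega> (f s) v"
          using assms(13) by (simp add: parabolic_solution_def)
        then have "AE s in lebesgue. s \<in> {0..T} \<longrightarrow> (\<forall>v\<in>H01 \<Omega>. parabolic_op L u u' s v = ip \<Omega> (f s) v)"
          by (subst (asm) AE_restrict_space_iff) auto
        then have "AE s in lebesgue. s \<in> {t (j - 1)<..<t j} \<longrightarrow>
          R s = ip \<Omega> (\<lambda>x. f s x - breve t f j s x) (G x (T - s)) + dcubic (t (j - 1)) (t j) s * chi \<Omega> L f t U V j (G x (T - s))"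
        proof eventually_elim
          case (elim s)
          show ?case
          proof
            assume s: "s \<in> {t (j - 1)<..<t j}"
            then have sT: "s \<in> {0..T}" "0 < T - s" using int by auto
            show "R s = ip \<Omega> (\<lambda>x. f s x - breve t f j s x) (G x (T - s)) + dcubic (t (j - 1)) (t j) s * chi \<Omega> L f t U V j (G x (T - s))"
              unfolding R_def w_def[abs_def] w'_def[abs_def] a_def b_def
              by (rule residual_identity[OF opn ell mesh dG _ j s])
                 (use elim sT(1) GH[OF sT(2)] uH[OF sT(1)] f in auto)
          qed
        qed
        then show ?thesis by (subst AE_restrict_space_iff) auto
      qed
      have k: "0 \<le> \<kappa> 0" "0 \<le> \<kappa> 1" "0 \<le> \<kappa>' 1" using assms(6,7) by auto
      have "ennreal \<bar>LINT s|lebesgue_on {t (j - 1)<..<t j}. R s\<bar> \<le> ennreal (exp (- \<gamma> * (T - t j))) *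
        (ennreal (\<kappa> 0) * (\<integral>\<^sup>+ s. Linf_norm \<Omega> (\<lambda>x. f s x - breve t f j s x) \<partial>lebesgue_on {t (j - 1)<..<t j})
          + ennreal (Psi2 T t \<kappa> \<kappa>' j) * Linf_norm_functional \<Omega> (chi \<Omega> L f t U V j))"
        unfolding Psi2_eq
      proof (rule interval_contribution[OF int k assms(9) opn _ _ _ _ _ _ _ ae])
        show "G x s \<in> H01 \<Omega>" if "s \<in> {0<..<T}" for s using GH that by auto
        show "L1_norm \<Omega> (G x s) \<le> ennreal (\<kappa> 0 * exp (- \<gamma> * s))" if "s \<in> {0<..<T}" for s
          using D(2)[of 0 s] that D0 assms(8) by simp
        show "has_L1_time_derivative \<Omega> (G x) (D 1 s) s" if "s \<in> {0<..<T}" for s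
          using D(1)[of 0 s] that D0 by simp
        show "L1_norm \<Omega> (D 1 s) \<le> ennreal ((\<kappa> 1 / s + \<kappa>' 1) * exp (- \<gamma> * s))" if "s \<in> {0<..<T}" for s
          using D(2)[of 1 s] that by simp
        show "chi \<Omega> L f t U V j (\<lambda>x. v x - w x) = chi \<Omega> L f t U V j v - chi \<Omega> L f t U V j w"
          if "v \<in> H01 \<Omega>" "w \<in> H01 \<Omega>" for v w
          by (rule chi_diff[OF opn ell dG j ts that])
        show "chi \<Omega> L f t U V j v = 0" if "v \<in> H01 \<Omega>" "AE x in lebesgue_on \<Omega>. v x = 0" for v
          by (rule chi_null[OF opn ell dG j that])
        show "integrable (lebesgue_on {t (j - 1)<..<t j}) R" by (rule integral_mesh_sum(2)[OF mesh R j])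
      qed
      then show ?thesis by (simp add: eta_f_def eta_chi_def)
    qed
    have "\<bar>u T x - U M x\<bar> \<le> (\<Sum>j = 1..M. \<bar>LINT s|lebesgue_on {t (j - 1)<..<t j}. R s\<bar>)"
      unfolding eq integral_mesh_sum(1)[OF mesh R] by (rule sum_abs)
    then have "ennreal \<bar>u T x - U M x\<bar> \<le> (\<Sum>j = 1..M. ennreal \<bar>LINT s|lebesgue_on {t (j - 1)<..<t j}. R s\<bar>)"
      by (subst sum_ennreal) (auto intro: ennreal_leI)
    also have "\<dots> \<le> (\<Sum>j = 1..M. ennreal (exp (- \<gamma> * (T - t j))) *
           (eta_f \<Omega> f t (\<kappa> 0) j + eta_chi \<Omega> L T f t U V \<kappa> \<kappa>' j))"
      by (intro sum_mono bound)
    finally show ?case .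
  qed
  moreover have "(\<lambda>x. ennreal \<bar>u T x - U M x\<bar>) \<in> borel_measurable (lebesgue_on \<Omega>)"
  proof -
    have "u T \<in> L2 \<Omega>" "U M \<in> L2 \<Omega>" using uH[of T] UM \<open>0 < T\<close> by (auto intro: H01_L2[OF opn])
    then have [measurable]: "u T \<in> borel_measurable (lebesgue_on \<Omega>)" "U M \<in> borel_measurable (lebesgue_on \<Omega>)"
      by (auto simp: L2_def)
    show ?thesis by measurable
  qed
  ultimately show ?thesis unfolding Linf_norm_def by (intro esssup_I)
qed

end
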